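(* The cohomology spaces of the spline complex $\mathfrak{S}: 0 \xrightarrow{\mathrm{id}} V_0 \xrightarrow{\mathrm{grad}} V_1 \xrightarrow{\mathrm{curl}} V_2 \xrightarrow{\mathrm{div}} V_3 \xrightarrow{0} 0$ have the following dimensions: $$ \dim \mathcal{H}^0(\mathfrak{S}) = 1, \quad \dim \mathcal{H}^1(\mathfrak{S}) = 1, \quad \dim \mathcal{H}^2(\mathfrak{S}) = 0, \quad \dim \mathcal{H}^3(\mathfrak{S}) = 0. $$
   Context: Setting. Let $\Omega=[0,R]\times[0,S]\times[0,T]$. Let $\mathbb{S}^{p^r}$ be a $C^1$ periodic spline space on $[0,R]$ spanned by $n^r$ (periodic) B-splines $B_i^{p^r}$, $\mathbb{S}^{p^s}$ a $C^1$ spline space on $[0,S]$ (open knot vector) spanned by $n^s$ B-splines $B_j^{p^s}$, and $\mathbb{S}^{p^t}$ a $C^1$ periodic spline space on $[0,T]$ spanned by $n^t$ (periodic) B-splines $B_k^{p^t}$. For a univariate space of degree $p$ on knots $t_1,\dots$, let $D_j^p=\frac{p}{t_{j+p+1}-t_{j+1}}B_{j+1}^{p-1}$ be the functions spanning the derivative space (for the periodic directions these are the $n^r$, resp. $n^t$, functions spanning the $C^0$ periodic derivative space; for the $s$ direction there are $n^s-1$ of them). Tensor-product function sets are vectorized running first over $i$, then $j$, then $k$: $\pmb{B}^{(0,0,0)}=\{B_i^{p^r}B_j^{p^s}B_k^{p^t}\}$, $\pmb{B}^{(1,0,0)}=\{D_i^{p^r}B_j^{p^s}B_k^{p^t}\}$,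 $\pmb{B}^{(0,1,0)}=\{B_i^{p^r}D_j^{p^s}B_k^{p^t}\}_{j\le n^s-1}$, $\pmb{B}^{(0,0,1)}=\{B_i^{p^r}B_j^{p^s}D_k^{p^t}\}$, $\pmb{B}^{(0,1,1)}=\{B_i^{p^r}D_j^{p^s}D_k^{p^t}\}_{j\le n^s-1}$, $\pmb{B}^{(1,0,1)}=\{D_i^{p^r}B_j^{p^s}D_k^{p^t}\}$, $\pmb{B}^{(1,1,0)}=\{D_i^{p^r}D_j^{p^s}B_k^{p^t}\}_{j\le n^s-1}$, $\pmb{B}^{(1,1,1)}=\{D_i^{p^r}D_j^{p^s}D_k^{p^t}\}_{j\le n^s-1}$. Let $\theta_i=2\pi+\frac{(1-2i)\pi}{n^r}$, and let $\bar E$ be the $3\times 2n^r$ matrix with $\bar E_{\ell,(i,1)}=\frac13$ and $(\bar E_{1,(i,2)},\bar E_{2,(i,2)},\bar E_{3,(i,2)})^T=(\frac13,\frac13,\frac13)^T+\begin{pmatrix}\frac13&0\\-\frac16&\frac{\sqrt3}{6}\\-\frac16&-\frac{\sqrt3}{6}\end{pmatrix}(\cos\theta_i,\sin\theta_i)^T$. Let $E^{(0)}=\begin{pmatrix}\bar E&0\\0&I_{n^r(n^s-2)}\end{pmatrix}$. Set $\bar n_0=n^r(n^s-2)+3$, $\bar n_1=2(\bar n_0-2)$, $\bar n_2=\bar n_0-3$. Define $E^{(1,0)}$ ($\bar n_1\times n^rn^s$) by $y=E^{(1,0)}x$: $y_\ell=\sum_{i=1}^{n^r}(\bar E_{\ell+1,(i+1,2)}-\bar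 E_{\ell+1,(i,2)})x_{i+n^r}$ for $\ell=1,2$ (index $n^r+1$ read as $1$), and for $j=3,\dots,n^s$, $i=1,\dots,n^r$: $y_{2+i+(2j-6)n^r}=0$, $y_{2+i+(2j-5)n^r}=x_{i+(j-1)n^r}$. Define $E^{(0,1)}$ ($\bar n_1\times n^r(n^s-1)$) by $y=E^{(0,1)}x$: $y_\ell=\sum_{i=1}^{n^r}(\bar E_{\ell+1,(i,2)}-\bar E_{\ell+1,(i,1)})x_i$ for $\ell=1,2$, and for $j=2,\dots,n^s-1$, $i=1,\dots,n^r$: $y_{2+i+(2j-4)n^r}=x_{i+(j-1)n^r}$, $y_{2+i+(2j-3)n^r}=0$. Let $E^{(2)}$ ($\bar n_2\times n^r(n^s-1)$) be $[0_{\bar n_2\times n^r}\;|\;I_{\bar n_2}]$. Writing $[A;B]$ for stacking rows of $A$ above those of $B$ and $O$ for zero blocks of the appropriate size, define $E^{(0,0,0)}=I_{n^t}\otimes E^{(0)}$; $E^{(1,0,0)}=I_{n^t}\otimes[E^{(1,0)};O]$, $E^{(0,1,0)}=I_{n^t}\otimes[E^{(0,1)};O]$, $E^{(0,0,1)}=I_{n^t}\otimes[O;E^{(0)}]$ (zero blocks with $\bar n_0$, $\bar n_0$, $\bar n_1$ rows respectively); $E^{(0,1,1)}=I_{n^t}\otimes[O;E^{(0,1)}]$, $E^{(1,0,1)}=I_{n^t}\otimes[O;-E^{(1,0)}]$, $E^{(1,1,0)}=I_{n^t}\otimes[E^{(2)};O]$ (zero blocks with $\bar n_2$, $\bar n_2$,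 $\bar n_1$ rows respectively); $E^{(1,1,1)}=I_{n^t}\otimes E^{(2)}$. Then $V_0=\mathrm{span}(E^{(0,0,0)}\pmb{B}^{(0,0,0)})$ (dimension $n^t\bar n_0$); $V_1$ is spanned by the vector functions $(N^{(1,0,0)}_\ell,N^{(0,1,0)}_\ell,N^{(0,0,1)}_\ell)$, $\ell=1,\dots,n^t(\bar n_0+\bar n_1)$, where $\pmb N^{(1,0,0)}=E^{(1,0,0)}\pmb B^{(1,0,0)}$, etc.; $V_2$ is spanned by $(N^{(0,1,1)}_\ell,N^{(1,0,1)}_\ell,N^{(1,1,0)}_\ell)$, $\ell=1,\dots,n^t(\bar n_1+\bar n_2)$, with $\pmb N^{(0,1,1)}=E^{(0,1,1)}\pmb B^{(0,1,1)}$, etc.; $V_3=\mathrm{span}(E^{(1,1,1)}\pmb B^{(1,1,1)})$ (dimension $n^t\bar n_2$). These spaces satisfy $\mathrm{grad}\,V_0\subseteq V_1$, $\mathrm{curl}\,V_1\subseteq V_2$, $\mathrm{div}\,V_2\subseteq V_3$, so $\mathfrak S$ is a complex. *)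

theory Defs
  imports "HOL-Analysis.Analysis" "HOL-Library.Function_Algebras"
begin

definition fscale :: "real \<Rightarrow> ('a \<Rightarrow> 'b::real_vector) \<Rightarrow> 'a \<Rightarrow> 'b" where
  "fscale c f = (\<lambda>x. c *\<^sub>R f x)"

lemma vector_space_fscale: "vector_space fscale"
  by unfold_locales (auto simp: fscale_def fun_eq_iff scaleR_add_right scaleR_add_left)

abbreviation fspan :: "('a \<Rightarrow> 'b::real_vector) set \<Rightarrow> ('a \<Rightarrow> 'b) set" where
  "fspan \<equiv> module.span fscale"

abbreviation fdim :: "('a \<Rightarrow> 'b::real_vector) set \<Rightarrow> nat" where
  "fdim \<equiv> vector_space.dim fscale"

text \<open>Dimension of the cohomology space ker(d) / W, where W is the image of the
  previous differential (W \<subseteq> ker d for a complex); for finite-dimensional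
  spaces dim(ker d / W) = dim(ker d) - dim W.\<close>

definition cohom_dim ::
  "('a \<Rightarrow> 'b::real_vector) set \<Rightarrow> ('a \<Rightarrow> 'b) set \<Rightarrow> (('a \<Rightarrow> 'b) \<Rightarrow> ('c \<Rightarrow> 'd::zero)) \<Rightarrow> nat" where
  "cohom_dim W V d = fdim {f \<in> V. d f = 0} - fdim W"

text \<open>Cox--de Boor recursion on an integer-indexed knot sequence t (with the
  convention 0/0 = 0, which is Isabelle's x/0 = 0). bspl t p j is the B-spline
  of degree p supported on [t j, t (j+p+1)].\<close>

fun bspl :: "(int \<Rightarrow> real) \<Rightarrow> nat \<Rightarrow> int \<Rightarrow> real \<Rightarrow> real" where
  "bspl t 0 j x = (if t j \<le> x \<and> x < t (j + 1) then 1 else 0)"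
| "bspl t (Suc p) j x =
     (x - t j) / (t (j + int p + 1) - t j) * bspl t p j x
   + (t (j + int p + 2) - x) / (t (j + int p + 2) - t (j + 1)) * bspl t p (j + 1) x"

text \<open>Periodic B-spline with period L (for a knot sequence with
  t (j + n) = t j + L): sum of all translates by multiples of L.\<close>

definition pbspl :: "(int \<Rightarrow> real) \<Rightarrow> real \<Rightarrow> nat \<Rightarrow> int \<Rightarrow> real \<Rightarrow> real" where
  "pbspl t L p i x = (\<Sum>\<^sub>\<infinity> m::int. bspl t p i (x - real_of_int m * L))"

text \<open>Functions D_j^p = p / (t_{j+p+1} - t_{j+1}) B_{j+1}^{p-1} spanning the
  derivative spaces (open and periodic versions).\<close>

definition oD :: "(int \<Rightarrow> real) \<Rightarrow> nat \<Rightarrow> int \<Rightarrow> real \<Rightarrow> real" where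
  "oD t p j x = real p / (t (j + int p + 1) - t (j + 1)) * bspl t (p - 1) (j + 1) x"

definition pD :: "(int \<Rightarrow> real) \<Rightarrow> real \<Rightarrow> nat \<Rightarrow> int \<Rightarrow> real \<Rightarrow> real" where
  "pD t L p j x = real p / (t (j + int p + 1) - t (j + 1)) * pbspl t L (p - 1) (j + 1) x"

text \<open>Knot sequence of a C^1 periodic spline space of degree p on [0,L] with
  n periodic B-splines: nondecreasing, L-periodic with n knots per period,
  every knot of multiplicity at most p - 1.\<close>

definition periodic_C1_knots :: "(int \<Rightarrow> real) \<Rightarrow> nat \<Rightarrow> real \<Rightarrow> nat \<Rightarrow> bool" where
  "periodic_C1_knots t n L p \<longleftrightarrow>
     0 < L \<and> 1 \<le> n \<and> mono t \<and> (\<forall>j. t (j + int n) = t j + L) \<and>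
     (\<forall>j. t j < t (j + int p - 1))"

text \<open>Open knot vector t_1 \<le> ... \<le> t_{n+p+1} on [0,L] of a C^1 spline space of
  degree p spanned by n B-splines: end knots of multiplicity exactly p+1,
  interior knots of multiplicity at most p - 1.\<close>

definition open_C1_knots :: "(int \<Rightarrow> real) \<Rightarrow> nat \<Rightarrow> real \<Rightarrow> nat \<Rightarrow> bool" where
  "open_C1_knots t n L p \<longleftrightarrow>
     0 < L \<and> 1 \<le> p \<and> p + 1 \<le> n \<and>
     (\<forall>j k. 1 \<le> j \<and> j \<le> k \<and> k \<le> int (n + p + 1) \<longrightarrow> t j \<le> t k) \<and>
     (\<forall>j. 1 \<le> j \<and> j \<le> int (p + 1) \<longrightarrow> t j = 0) \<and>
     (\<forall>j. int (n + 1) \<le> j \<and> j \<le> int (n + p + 1) \<longrightarrow> t j = L) \<and>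
     0 < t (int p + 2) \<and> t (int n) < L \<and>
     (\<forall>j. int p + 2 \<le> j \<and> j + int p - 1 \<le> int n \<longrightarrow> t j < t (j + int p - 1))"

section \<open>Extraction matrices (1-based indices; entries outside the stated
  sizes are irrelevant)\<close>

definition theta :: "nat \<Rightarrow> nat \<Rightarrow> real" where
  "theta nr i = 2 * pi + (1 - 2 * real i) * pi / real nr"

text \<open>Ebar nr l i c is the entry of \<open>E\<close>-bar in row l and column (i,c).\<close>

definition Ebar :: "nat \<Rightarrow> nat \<Rightarrow> nat \<Rightarrow> nat \<Rightarrow> real" where
  "Ebar nr l i c =
     (if c = 1 then 1/3
      else 1/3 + (if l = 1 then (1/3) * cos (theta nr i)
                  else if l = 2 then (-1/6) * cos (theta nr i) + (sqrt 3 / 6) * sin (theta nr i)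
                  else (-1/6) * cos (theta nr i) - (sqrt 3 / 6) * sin (theta nr i)))"

definition nb0 :: "nat \<Rightarrow> nat \<Rightarrow> nat" where "nb0 nr ns = nr * (ns - 2) + 3"
definition nb1 :: "nat \<Rightarrow> nat \<Rightarrow> nat" where "nb1 nr ns = 2 * (nb0 nr ns - 2)"
definition nb2 :: "nat \<Rightarrow> nat \<Rightarrow> nat" where "nb2 nr ns = nb0 nr ns - 3"

text \<open>Column (i,c) of \<open>E\<close>-bar corresponds to the column index i + (c-1) nr
  (vectorisation running first over i, then j).\<close>

definition E0 :: "nat \<Rightarrow> nat \<Rightarrow> nat \<Rightarrow> nat \<Rightarrow> real" where
  "E0 nr ns a b =
     (if a \<le> 3 then (if b \<le> 2 * nr then Ebar nr a ((b - 1) mod nr + 1) ((b - 1) div nr + 1) else 0)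
      else (if b = a - 3 + 2 * nr then 1 else 0))"

definition E10 :: "nat \<Rightarrow> nat \<Rightarrow> nat \<Rightarrow> nat \<Rightarrow> real" where
  "E10 nr ns a b =
     (if a \<le> 2 then
        (if nr < b \<and> b \<le> 2 * nr
         then Ebar nr (a + 1) ((b - nr) mod nr + 1) 2 - Ebar nr (a + 1) (b - nr) 2 else 0)
      else if (\<exists>i j. 1 \<le> i \<and> i \<le> nr \<and> 3 \<le> j \<and> j \<le> ns \<and>
                    a = 2 + i + (2 * j - 5) * nr \<and> b = i + (j - 1) * nr) then 1 else 0)"

definition E01 :: "nat \<Rightarrow> nat \<Rightarrow> nat \<Rightarrow> nat \<Rightarrow> real" where
  "E01 nr ns a b =
     (if a \<le> 2 then
        (if 1 \<le> b \<and> b \<le> nr then Ebar nr (a + 1) b 2 - Ebar nr (a + 1) b 1 else 0)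
      else if (\<exists>i j. 1 \<le> i \<and> i \<le> nr \<and> 2 \<le> j \<and> j \<le> ns - 1 \<and>
                    a = 2 + i + (2 * j - 4) * nr \<and> b = i + (j - 1) * nr) then 1 else 0)"

definition E2 :: "nat \<Rightarrow> nat \<Rightarrow> nat \<Rightarrow> nat \<Rightarrow> real" where
  "E2 nr ns a b = (if b = a + nr then 1 else 0)"

text \<open>Stacking [M; N] with m rows in M, zero matrix, and I_q \<otimes> M for M with
  m rows and c columns.\<close>

definition stack :: "nat \<Rightarrow> (nat \<Rightarrow> nat \<Rightarrow> real) \<Rightarrow> (nat \<Rightarrow> nat \<Rightarrow> real) \<Rightarrow> nat \<Rightarrow> nat \<Rightarrow> real" where
  "stack m M N a b = (if a \<le> m then M a b else N (a - m) b)"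

definition zmat :: "nat \<Rightarrow> nat \<Rightarrow> real" where "zmat a b = 0"

definition kronI :: "nat \<Rightarrow> nat \<Rightarrow> (nat \<Rightarrow> nat \<Rightarrow> real) \<Rightarrow> nat \<Rightarrow> nat \<Rightarrow> real" where
  "kronI m c M a b =
     (if (a - 1) div m = (b - 1) div c then M ((a - 1) mod m + 1) ((b - 1) mod c + 1) else 0)"

type_synonym pt3 = "real \<times> real \<times> real"

text \<open>Vectorised tensor product: index b = i + (j-1) nf + (k-1) nf ng.\<close>

definition tp3 :: "(nat \<Rightarrow> real \<Rightarrow> real) \<Rightarrow> nat \<Rightarrow> (nat \<Rightarrow> real \<Rightarrow> real) \<Rightarrow> nat \<Rightarrow>
    (nat \<Rightarrow> real \<Rightarrow> real) \<Rightarrow> nat \<Rightarrow> pt3 \<Rightarrow> real" where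
  "tp3 f nf g ng h b p =
     f ((b - 1) mod nf + 1) (fst p) * g ((b - 1) div nf mod ng + 1) (fst (snd p))
     * h ((b - 1) div (nf * ng) + 1) (snd (snd p))"

definition mgen :: "(nat \<Rightarrow> nat \<Rightarrow> real) \<Rightarrow> nat \<Rightarrow> (nat \<Rightarrow> pt3 \<Rightarrow> real) \<Rightarrow> nat \<Rightarrow> pt3 \<Rightarrow> real" where
  "mgen E ncols B l p = (\<Sum>b = 1..ncols. E l b * B b p)"

text \<open>The domain: functions are considered on the interior of
  \<Omega> = [0,R] \<times> [0,S] \<times> [0,T] (extended by 0 outside).\<close>

definition Omega_int :: "real \<Rightarrow> real \<Rightarrow> real \<Rightarrow> pt3 set" where
  "Omega_int R S T = {0<..<R} \<times> {0<..<S} \<times> {0<..<T}"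

definition restr :: "pt3 set \<Rightarrow> (pt3 \<Rightarrow> 'b::zero) \<Rightarrow> pt3 \<Rightarrow> 'b" where
  "restr D f = (\<lambda>x. if x \<in> D then f x else 0)"

context
  fixes tr :: "int \<Rightarrow> real" and nr :: nat and R :: real and pr :: nat
    and ts :: "int \<Rightarrow> real" and ns :: nat and S :: real and ps :: nat
    and tt :: "int \<Rightarrow> real" and nt :: nat and T :: real and pt :: nat
begin

definition "Bfr i = pbspl tr R pr (int i)"
definition "Dfr i = pD tr R pr (int i)"
definition "Bfs j = bspl ts ps (int j)"
definition "Dfs j = oD ts ps (int j)"
definition "Bft k = pbspl tt T pt (int k)"
definition "Dft k = pD tt T pt (int k)"

definition V0 :: "(pt3 \<Rightarrow> real) set" where
  "V0 = fspan {restr (Omega_int R S T)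
          (mgen (kronI (nb0 nr ns) (nr * ns) (E0 nr ns)) (nr * ns * nt)
                (tp3 Bfr nr Bfs ns Bft) l) | l. 1 \<le> l \<and> l \<le> nt * nb0 nr ns}"

definition N100 where
  "N100 = mgen (kronI (nb1 nr ns + nb0 nr ns) (nr * ns) (stack (nb1 nr ns) (E10 nr ns) zmat))
                (nr * ns * nt) (tp3 Dfr nr Bfs ns Bft)"
definition N010 where
  "N010 = mgen (kronI (nb1 nr ns + nb0 nr ns) (nr * (ns - 1)) (stack (nb1 nr ns) (E01 nr ns) zmat))
                (nr * (ns - 1) * nt) (tp3 Bfr nr Dfs (ns - 1) Bft)"
definition N001 where
  "N001 = mgen (kronI (nb1 nr ns + nb0 nr ns) (nr * ns) (stack (nb1 nr ns) zmat (E0 nr ns)))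
                (nr * ns * nt) (tp3 Bfr nr Bfs ns Dft)"

definition V1 :: "(pt3 \<Rightarrow> pt3) set" where
  "V1 = fspan {restr (Omega_int R S T) (\<lambda>p. (N100 l p, N010 l p, N001 l p)) | l.
                 1 \<le> l \<and> l \<le> nt * (nb0 nr ns + nb1 nr ns)}"

definition N011 where
  "N011 = mgen (kronI (nb2 nr ns + nb1 nr ns) (nr * (ns - 1)) (stack (nb2 nr ns) zmat (E01 nr ns)))
                (nr * (ns - 1) * nt) (tp3 Bfr nr Dfs (ns - 1) Dft)"
definition N101 where
  "N101 = mgen (kronI (nb2 nr ns + nb1 nr ns) (nr * ns) (stack (nb2 nr ns) zmat (\<lambda>a b. - E10 nr ns a b)))
                (nr * ns * nt) (tp3 Dfr nr Bfs ns Dft)"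
definition N110 where
  "N110 = mgen (kronI (nb2 nr ns + nb1 nr ns) (nr * (ns - 1)) (stack (nb2 nr ns) (E2 nr ns) zmat))
                (nr * (ns - 1) * nt) (tp3 Dfr nr Dfs (ns - 1) Bft)"

definition V2 :: "(pt3 \<Rightarrow> pt3) set" where
  "V2 = fspan {restr (Omega_int R S T) (\<lambda>p. (N011 l p, N101 l p, N110 l p)) | l.
                 1 \<le> l \<and> l \<le> nt * (nb1 nr ns + nb2 nr ns)}"

definition V3 :: "(pt3 \<Rightarrow> real) set" where
  "V3 = fspan {restr (Omega_int R S T)
          (mgen (kronI (nb2 nr ns) (nr * (ns - 1)) (E2 nr ns)) (nr * (ns - 1) * nt)
                (tp3 Dfr nr Dfs (ns - 1) Dft) l) | l. 1 \<le> l \<and> l \<le> nt * nb2 nr ns}"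

end

section \<open>Differential operators (partial derivatives in the parametric
  coordinates r, s, t, taken at interior points of \<Omega>)\<close>

definition pd1 :: "(pt3 \<Rightarrow> real) \<Rightarrow> pt3 \<Rightarrow> real" where
  "pd1 f p = deriv (\<lambda>x. f (x, fst (snd p), snd (snd p))) (fst p)"
definition pd2 :: "(pt3 \<Rightarrow> real) \<Rightarrow> pt3 \<Rightarrow> real" where
  "pd2 f p = deriv (\<lambda>y. f (fst p, y, snd (snd p))) (fst (snd p))"
definition pd3 :: "(pt3 \<Rightarrow> real) \<Rightarrow> pt3 \<Rightarrow> real" where
  "pd3 f p = deriv (\<lambda>z. f (fst p, fst (snd p), z)) (snd (snd p))"

definition comp1 :: "(pt3 \<Rightarrow> pt3) \<Rightarrow> pt3 \<Rightarrow> real" where "comp1 F = (\<lambda>p. fst (F p))"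
definition comp2 :: "(pt3 \<Rightarrow> pt3) \<Rightarrow> pt3 \<Rightarrow> real" where "comp2 F = (\<lambda>p. fst (snd (F p)))"
definition comp3 :: "(pt3 \<Rightarrow> pt3) \<Rightarrow> pt3 \<Rightarrow> real" where "comp3 F = (\<lambda>p. snd (snd (F p)))"

definition grad3 :: "real \<Rightarrow> real \<Rightarrow> real \<Rightarrow> (pt3 \<Rightarrow> real) \<Rightarrow> pt3 \<Rightarrow> pt3" where
  "grad3 R S T f = restr (Omega_int R S T) (\<lambda>p. (pd1 f p, pd2 f p, pd3 f p))"

definition curl3 :: "real \<Rightarrow> real \<Rightarrow> real \<Rightarrow> (pt3 \<Rightarrow> pt3) \<Rightarrow> pt3 \<Rightarrow> pt3" where
  "curl3 R S T F = restr (Omega_int R S T)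
     (\<lambda>p. (pd2 (comp3 F) p - pd3 (comp2 F) p,
           pd3 (comp1 F) p - pd1 (comp3 F) p,
           pd1 (comp2 F) p - pd2 (comp1 F) p))"

definition div3 :: "real \<Rightarrow> real \<Rightarrow> real \<Rightarrow> (pt3 \<Rightarrow> pt3) \<Rightarrow> pt3 \<Rightarrow> real" where
  "div3 R S T F = restr (Omega_int R S T)
     (\<lambda>p. pd1 (comp1 F) p + pd2 (comp2 F) p + pd3 (comp3 F) p)"

end

(* The 3D complex is the tensor product of a 2D polar complex in (r,s) with the periodic spline
   complex in t. Since the B-splines and the functions spanning the derivative spaces are linearly
   independent, and a derivative acts on spline coefficients as a forward difference (cyclic in the
   periodic directions), everything reduces to difference complexes of coefficients.
   Near the pole the coefficients of a 0-form are (A, A + w_i, ...), those of a 1-form are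
   (0, w_(i+1) - w_i, ...) and (w_i, ...), those of a 2-form (0, ...), with w in the span of
   cos theta_i and sin theta_i. Summing the s-coefficients of a closed 2D 1-form from the pole
   outwards yields a potential, and 2-forms are integrated the same way, so the 2D complex
   only has constants as cohomology. In t a sequence is a cyclic difference plus its mean; the mean
   contributes the single class dt in degree 1. *)

theory Submission
  imports Defs
begin

section \<open>B-splines on one knot interval and at knots\<close>

text \<open>No generators are counted: for \<open>nr\<close> equal to 1 or 2 the values of cos and
  sin at the angles \<open>theta nr i\<close> are linearly dependent, so the rows of the extraction
  matrices can yield dependent functions and an Euler characteristic count would break down. Kernels
  and images are compared as sets instead. In degrees 2 and 3 they coincide, so the truncated
  difference in \<open>cohom_dim\<close> is 0; in degree 1 the kernel is the image plus one line,
  and finite dimension turns this into a difference of 1. The r-direction is periodic too, yet it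
  adds no class: the angular coefficients of a 1-form vanish at the pole, which kills the angular
  period. The analytic obstacle is a multiple knot. The recursion describes a spline interval by
  interval, whereas \<open>deriv\<close> is two-sided; the multiplicity bound for C^1 splines makes
  the one-sided derivatives agree. Linear independence is proved on a single nonempty knot interval,
  so it also covers a small \<open>n\<close>, where a periodic B-spline overlaps its own
  translates.\<close>

text \<open>The B-spline recursion with the degree-0 values replaced by constants: each \<open>cell_poly\<close> is a
  polynomial in \<open>x\<close> that agrees with the B-spline on one knot interval, so derivatives at a knot
  can be computed separately from the left and from the right.\<close>

fun cell_poly :: "(int \<Rightarrow> real) \<Rightarrow> (int \<Rightarrow> real) \<Rightarrow> nat \<Rightarrow> int \<Rightarrow> real \<Rightarrow> real" where
  "cell_poly t b 0 j x = b j"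
| "cell_poly t b (Suc p) j x =
     (x - t j) / (t (j + int p + 1) - t j) * cell_poly t b p j x
   + (t (j + int p + 2) - x) / (t (j + int p + 2) - t (j + 1)) * cell_poly t b p (j + 1) x"

text \<open>The degree 0 values at the points of a nonempty interval from \<open>t m\<close> to
  \<open>t (m + 1)\<close>; with them \<open>cell_poly\<close> is the polynomial piece of the
  B-spline on that interval.\<close>

abbreviation kron :: "int \<Rightarrow> int \<Rightarrow> real" where
  "kron m \<equiv> \<lambda>i. if i = m then 1 else 0"

lemma bspl_eq_cell_poly:
  assumes "\<And>i. bspl t 0 i x = b i"
  shows "bspl t p j x = cell_poly t b p j x"
  using assms by (induction p arbitrary: j) auto

lemma bspl_0_cell:
  assumes "mono t" "t m \<le> x" "x < t (m + 1)"
  shows "bspl t 0 i x = kron m i"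
proof -
  have "i < m \<Longrightarrow> t (i + 1) \<le> t m" "i > m \<Longrightarrow> t (m + 1) \<le> t i"
    using monoD[OF assms(1)] by auto
  then show ?thesis using assms by force
qed

lemma bspl_on_cell:
  assumes "mono t" "t m \<le> x" "x < t (m + 1)"
  shows "bspl t p j x = cell_poly t (kron m) p j x"
  by (rule bspl_eq_cell_poly) (rule bspl_0_cell[OF assms])

lemma bspl_support:
  assumes "mono t" "bspl t p j x \<noteq> 0"
  shows "t j \<le> x \<and> x < t (j + int p + 1)"
  using assms(2)
proof (induction p arbitrary: j)
  case 0
  then show ?case by (auto split: if_splits)
next
  case (Suc p)
  have m: "t j \<le> t (j + 1)" "t (j + int p + 1) \<le> t (j + int p + 2)"
    using monoD[OF assms(1)] by auto
  from Suc.prems have "bspl t p j x \<noteq> 0 \<or> bspl t p (j + 1) x \<noteq> 0" by auto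
  then show ?case
    using Suc.IH[of j] Suc.IH[of "j + 1"] m by (auto simp: algebra_simps)
qed

lemma cell_poly_eq_0:
  assumes "j < m - int p \<or> m < j"
  shows "cell_poly t (kron m) p j x = 0"
  using assms by (induction p arbitrary: j) auto

text \<open>Product rule on the recursion. Neither \<open>b\<close> nor \<open>x\<close> is tied to
  an interval, so the formula yields the left and the right derivative at a knot alike. The terms
  that do not fit the claim collect into one multiple of \<open>key\<close>.\<close>

lemma cell_poly_deriv:
  assumes "mono t"
  shows "(cell_poly t b (Suc p) j has_real_derivative
     real (Suc p) * (cell_poly t b p j x / (t (j + int p + 1) - t j)
       - cell_poly t b p (j + 1) x / (t (j + int p + 2) - t (j + 1)))) (at x)"
proof (induction p arbitrary: j)
  case 0
  show ?case
    by (auto intro!: derivative_eq_intros simp: divide_simps)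
next
  case (Suc p)
  define Q where "Q = (\<lambda>i. cell_poly t b p i x)"
  define u0 u1 u2 v0 v1 where
    "u0 = 1 / (t (j + int p + 1) - t j)" "u1 = 1 / (t (j + int p + 2) - t (j + 1))"
    "u2 = 1 / (t (j + int p + 3) - t (j + 2))"
    "v0 = 1 / (t (j + int p + 2) - t j)" "v1 = 1 / (t (j + int p + 3) - t (j + 1))"
  note ud = this
  note D0 = Suc.IH[of j] and D1 = Suc.IH[of "j + 1"]
  have fn: "cell_poly t b (Suc (Suc p)) j = (\<lambda>x. (x - t j) * v0 * cell_poly t b (Suc p) j x
      + (t (j + int p + 3) - x) * v1 * cell_poly t b (Suc p) (j + 1) x)"
    by (rule ext) (simp add: ud algebra_simps del: cell_poly.simps add: cell_poly.simps(2)[of t b "Suc p"])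
  have P0: "cell_poly t b (Suc p) j x = (x - t j) * u0 * Q j + (t (j + int p + 2) - x) * u1 * Q (j + 1)"
    by (simp add: ud Q_def)
  have P1: "cell_poly t b (Suc p) (j + 1) x = (x - t (j + 1)) * u1 * Q (j + 1) + (t (j + int p + 3) - x) * u2 * Q (j + 2)"
    by (simp add: ud Q_def algebra_simps)
  have D0': "(cell_poly t b (Suc p) j has_real_derivative real (Suc p) * (u0 * Q j - u1 * Q (j + 1))) (at x)"
    using D0 by (simp add: ud Q_def del: cell_poly.simps)
  have D1': "(cell_poly t b (Suc p) (j + 1) has_real_derivative real (Suc p) * (u1 * Q (j + 1) - u2 * Q (j + 2))) (at x)"
    using D1 by (simp add: ud Q_def algebra_simps del: cell_poly.simps)
  \<comment> \<open>If the knots differ, both products in the bracket are 1 and cancel; if they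
    coincide, \<open>u1\<close> is 0 by the convention for division by 0.\<close>
  have key: "u1 * ((t (j + int p + 2) - t j) * v0 - (t (j + int p + 3) - t (j + 1)) * v1) = 0"
  proof (cases "t (j + int p + 2) = t (j + 1)")
    case True
    then show ?thesis by (simp add: ud)
  next
    case False
    have "t j \<le> t (j + 1)" "t (j + 1) \<le> t (j + int p + 2)" "t (j + int p + 2) \<le> t (j + int p + 3)"
      using monoD[OF assms] by auto
    then show ?thesis using False by (simp add: ud)
  qed
  have "(cell_poly t b (Suc (Suc p)) j has_real_derivative
     v0 * cell_poly t b (Suc p) j x + (x - t j) * v0 * (real (Suc p) * (u0 * Q j - u1 * Q (j + 1)))
     - v1 * cell_poly t b (Suc p) (j + 1) x
     + (t (j + int p + 3) - x) * v1 * (real (Suc p) * (u1 * Q (j + 1) - u2 * Q (j + 2)))) (at x)"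
    unfolding fn
    by (rule derivative_eq_intros D0' D1' refl)+ (simp add: algebra_simps del: cell_poly.simps)
  moreover have "v0 * cell_poly t b (Suc p) j x + (x - t j) * v0 * (real (Suc p) * (u0 * Q j - u1 * Q (j + 1)))
     - v1 * cell_poly t b (Suc p) (j + 1) x
     + (t (j + int p + 3) - x) * v1 * (real (Suc p) * (u1 * Q (j + 1) - u2 * Q (j + 2)))
     = real (Suc (Suc p)) * (v0 * cell_poly t b (Suc p) j x - v1 * cell_poly t b (Suc p) (j + 1) x)
       - real (Suc p) * (Q (j + 1) * (u1 * ((t (j + int p + 2) - t j) * v0 - (t (j + int p + 3) - t (j + 1)) * v1)))"
  proof -
    \<comment> \<open>With both recursions substituted this is a polynomial identity; its last
      summand is the multiple of \<open>key\<close>.\<close>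
    have id: "v0 * P + (x - a) * v0 * (k * (u0 * q0 - u1 * q1)) - v1 * P' + (f - x) * v1 * (k * (u1 * q1 - u2 * q2))
      = (k + 1) * (v0 * P - v1 * P') - k * (q1 * (u1 * ((e - a) * v0 - (f - c) * v1)))"
      if "P = (x - a) * u0 * q0 + (e - x) * u1 * q1" "P' = (x - c) * u1 * q1 + (f - x) * u2 * q2"
      for P P' a c e f k q0 q1 q2 :: real
      unfolding that by (simp add: algebra_simps)
    show ?thesis using id[OF P0 P1, of "real (Suc p)"] by (simp add: add_ac del: cell_poly.simps)
  qed
  ultimately have "(cell_poly t b (Suc (Suc p)) j has_real_derivative
      real (Suc (Suc p)) * (v0 * cell_poly t b (Suc p) j x - v1 * cell_poly t b (Suc p) (j + 1) x)) (at x)"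
    by (simp only: key mult_zero_right diff_zero)
  moreover have i: "j + int (Suc p) + 1 = j + int p + 2" "j + int (Suc p) + 2 = j + int p + 3" by simp_all
  ultimately show ?case unfolding i by (simp add: ud del: cell_poly.simps)
qed

text \<open>Partition of unity. Regrouped by the polynomials of degree \<open>p\<close>, the two
  weights of each one share a denominator and add up to 1, and the two extreme indices contribute
  nothing. The denominators are positive because each contains the nonempty interval number
  \<open>m\<close>.\<close>

lemma cell_poly_sum:
  assumes "mono t" "t m < t (m + 1)"
  shows "(\<Sum>j = m - int p..m. cell_poly t (kron m) p j x) = 1"
proof (induction p)
  case 0
  then show ?case by simp
next
  case (Suc p)
  define P where "P = (\<lambda>j. cell_poly t (kron m) p j x)"
  define v where "v = (\<lambda>j. 1 / (t (j + int p + 1) - t j))"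
  have split1: "{m - int (Suc p)..m} = insert (m - int (Suc p)) {m - int p..m}"
    and split2: "{m - int p..m + 1} = insert (m + 1) {m - int p..m}" by auto
  have P0: "P (m - int (Suc p)) = 0" "P (m + 1) = 0"
    unfolding P_def by (auto intro!: cell_poly_eq_0)
  have "(\<Sum>j = m - int (Suc p)..m. cell_poly t (kron m) (Suc p) j x)
      = (\<Sum>j = m - int (Suc p)..m. (x - t j) * v j * P j)
        + (\<Sum>j = m - int (Suc p)..m. (t (j + int p + 2) - x) * v (j + 1) * P (j + 1))"
    by (simp add: sum.distrib P_def v_def algebra_simps)
  also have "(\<Sum>j = m - int (Suc p)..m. (t (j + int p + 2) - x) * v (j + 1) * P (j + 1))
      = (\<Sum>j = m - int p..m + 1. (t (j + int p + 1) - x) * v j * P j)"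
    by (rule sum.reindex_bij_witness[of _ "\<lambda>j. j - 1" "\<lambda>j. j + 1"]) (auto simp: algebra_simps)
  also have "(\<Sum>j = m - int (Suc p)..m. (x - t j) * v j * P j) = (\<Sum>j = m - int p..m. (x - t j) * v j * P j)"
    unfolding split1 using P0 by simp
  also have "(\<Sum>j = m - int p..m + 1. (t (j + int p + 1) - x) * v j * P j)
      = (\<Sum>j = m - int p..m. (t (j + int p + 1) - x) * v j * P j)"
    unfolding split2 using P0 by simp
  also have "(\<Sum>j = m - int p..m. (x - t j) * v j * P j)
        + (\<Sum>j = m - int p..m. (t (j + int p + 1) - x) * v j * P j) = (\<Sum>j = m - int p..m. P j)"
    unfolding sum.distrib[symmetric]
  proof (rule sum.cong[OF refl])
    fix j assume j: "j \<in> {m - int p..m}"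
    have "t j \<le> t m" "t (m + 1) \<le> t (j + int p + 1)" using j monoD[OF assms(1)] by auto
    then have "t (j + int p + 1) - t j \<noteq> 0" using assms(2) by linarith
    then have "(t (j + int p + 1) - t j) * v j = 1" by (simp add: v_def)
    then have "(t (j + int p + 1) - t j) * v j * P j = P j" by simp
    then show "(x - t j) * v j * P j + (t (j + int p + 1) - x) * v j * P j = P j"
      by (simp add: algebra_simps)
  qed
  finally show ?case using Suc.IH by (simp add: P_def)
qed

text \<open>Differentiation turns the coefficients into their differences times nonzero factors one
  degree lower, so by induction all coefficients are equal, and the partition of unity then makes
  them 0. Since polynomials are involved, any interval from \<open>u\<close> to \<open>v\<close>
  will do; later it is the overlap of a knot interval with the domain.\<close>

lemma cell_poly_independent:
  assumes "mono t" "t m < t (m + 1)" "u < v"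
    and "\<And>x. u < x \<Longrightarrow> x < v \<Longrightarrow> (\<Sum>j = m - int p..m. c j * cell_poly t (kron m) p j x) = 0"
    and "m - int p \<le> j" "j \<le> m"
  shows "c j = 0"
  using assms(4-)
proof (induction p arbitrary: c j)
  case 0
  obtain x where "u < x" "x < v" using dense[OF assms(3)] by auto
  from 0(1)[OF this] 0(2,3) show ?case by simp
next
  case (Suc p)
  let ?P = "\<lambda>q. cell_poly t (kron m) q"
  define w where "w = (\<lambda>j. real (Suc p) / (t (j + int p + 1) - t j))"
  have D: "(\<Sum>j = m - int p..m. ((c j - c (j - 1)) * w j) * ?P p j x) = 0" if x: "u < x" "x < v" for x
  proof -
    have split1: "{m - int (Suc p)..m} = insert (m - int (Suc p)) {m - int p..m}"
      and split2: "{m - int p..m + 1} = insert (m + 1) {m - int p..m}" by auto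
    have P0: "?P p (m - int (Suc p)) x = 0" "?P p (m + 1) x = 0"
      by (auto intro!: cell_poly_eq_0)
    have d1: "((\<lambda>x. \<Sum>j = m - int (Suc p)..m. c j * ?P (Suc p) j x) has_real_derivative
        (\<Sum>j = m - int (Suc p)..m. c j * (w j * ?P p j x - w (j + 1) * ?P p (j + 1) x))) (at x)"
    proof (rule DERIV_sum, rule DERIV_cmult)
      fix j
      show "(?P (Suc p) j has_real_derivative w j * ?P p j x - w (j + 1) * ?P p (j + 1) x) (at x)"
        using cell_poly_deriv[OF assms(1), of "kron m" p j x]
        by (simp add: w_def algebra_simps)
    qed
    have "eventually (\<lambda>y. y \<in> {u<..<v}) (nhds x)" using x by (intro eventually_nhds_in_open) auto
    then have "eventually (\<lambda>y. (\<Sum>j = m - int (Suc p)..m. c j * ?P (Suc p) j y) = 0) (nhds x)"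
      by eventually_elim (use Suc.prems(1) in auto)
    then have "((\<lambda>x. \<Sum>j = m - int (Suc p)..m. c j * ?P (Suc p) j x) has_real_derivative 0) (at x)"
      by (subst DERIV_cong_ev[OF refl _ refl, where g = "\<lambda>_. 0"]) auto
    from DERIV_unique[OF d1 this]
    have "(\<Sum>j = m - int (Suc p)..m. c j * (w j * ?P p j x))
        - (\<Sum>j = m - int (Suc p)..m. c j * (w (j + 1) * ?P p (j + 1) x)) = 0"
      by (simp add: sum_subtractf algebra_simps)
    also have "(\<Sum>j = m - int (Suc p)..m. c j * (w (j + 1) * ?P p (j + 1) x))
        = (\<Sum>j = m - int p..m + 1. c (j - 1) * (w j * ?P p j x))"
      by (rule sum.reindex_bij_witness[of _ "\<lambda>j. j - 1" "\<lambda>j. j + 1"]) auto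
    also have "\<dots> = (\<Sum>j = m - int p..m. c (j - 1) * (w j * ?P p j x))"
      unfolding split2 using P0 by simp
    also have "(\<Sum>j = m - int (Suc p)..m. c j * (w j * ?P p j x)) = (\<Sum>j = m - int p..m. c j * (w j * ?P p j x))"
      unfolding split1 using P0 by simp
    finally show ?thesis by (simp add: sum_subtractf algebra_simps)
  qed
  have step: "c j = c (j - 1)" if j: "m - int p \<le> j" "j \<le> m" for j
  proof -
    have "t j \<le> t m" "t (m + 1) \<le> t (j + int p + 1)" using j monoD[OF assms(1)] by auto
    then have "w j \<noteq> 0" using assms(2) by (simp add: w_def)
    moreover have "(c j - c (j - 1)) * w j = 0" by (rule Suc.IH[OF D j])
    ultimately show ?thesis by simp
  qed
  have const: "c (m - int k) = c m" if "k \<le> Suc p" for k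
    using that
  proof (induction k)
    case (Suc k)
    have "c (m - int (Suc k)) = c (m - int k - 1)" by (simp add: algebra_simps)
    then show ?case using step[of "m - int k"] Suc by simp
  qed simp
  obtain x where x: "u < x" "x < v" using dense[OF assms(3)] by auto
  have "c i = c m" if "i \<in> {m - int (Suc p)..m}" for i
    using const[of "nat (m - i)"] that by auto
  then have "(\<Sum>j = m - int (Suc p)..m. c j * ?P (Suc p) j x) = c m * (\<Sum>j = m - int (Suc p)..m. ?P (Suc p) j x)"
    unfolding sum_distrib_left by (intro sum.cong refl) metis
  then have "c m = 0" unfolding Suc.prems(1)[OF x] cell_poly_sum[OF assms(1,2)] by simp
  then show ?case using const[of "nat (m - j)"] Suc.prems(2,3) by (auto simp del: cell_poly.simps)
qed

text \<open>At a knot repeated \<open>m\<close> times, seen from the interval on its right, raising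
  the degree kills the old surviving index (its factor \<open>x - t j\<close> is 0) and hands the
  value 1 to the index one lower, with weight 1.\<close>

lemma cell_poly_at_knot_right:
  assumes "\<And>i. a < i \<Longrightarrow> i \<le> a + int m \<Longrightarrow> t i = x" "x < t (a + int m + 1)" "q \<le> m"
  shows "cell_poly t (kron (a + int m)) q j x = kron (a + int m - int q) j"
  using assms(3)
proof (induction q arbitrary: j)
  case (Suc q)
  then have IH: "\<And>j. cell_poly t (kron (a + int m)) q j x = kron (a + int m - int q) j" by simp
  have tx: "t (a + int m - int q) = x" using Suc.prems by (intro assms(1)) auto
  consider "j = a + int m - int q" | "j = a + int m - int q - 1"
    | "j \<noteq> a + int m - int q" "j + 1 \<noteq> a + int m - int q" by linarith
  then show ?case
  proof cases
    case 2
    have i: "j + 1 = a + int m - int q" "j + int q + 2 = a + int m + 1"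
      "j = a + int m - int (Suc q)" using 2 by auto
    show ?thesis unfolding cell_poly.simps IH i(1,2) tx using assms(2) i(3) by simp
  qed (use tx in \<open>simp_all add: IH\<close>)
qed simp

text \<open>Seen from the left, the weight of index \<open>a\<close> stays 1 because
  \<open>t (a + q + 1) = x\<close>, and its neighbour gets the factor
  \<open>t (a + q + 1) - x = 0\<close>.\<close>

lemma cell_poly_at_knot_left:
  assumes "\<And>i. a < i \<Longrightarrow> i \<le> a + int m \<Longrightarrow> t i = x" "t a < x" "q \<le> m"
  shows "cell_poly t (kron a) q j x = kron a j"
  using assms(3)
proof (induction q arbitrary: j)
  case (Suc q)
  then have IH: "\<And>j. cell_poly t (kron a) q j x = kron a j" by simp
  have tx: "t (a + int q + 1) = x" using Suc.prems by (intro assms(1)) auto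
  consider "j = a" | "j = a - 1" | "j \<noteq> a" "j + 1 \<noteq> a" by linarith
  then show ?case
  proof cases
    case 2
    have i: "j + int q + 2 = a + int q + 1" using 2 by auto
    show ?thesis unfolding cell_poly.simps IH i tx using 2 by simp
  qed (use tx assms(2) in \<open>simp_all add: IH\<close>)
qed simp

text \<open>At degree \<open>m\<close> the surviving index is \<open>a\<close> from both sides, and
  beyond it both sides follow the same recursion. This is the continuity of splines whose degree is
  at least the multiplicity of the knot.\<close>

lemma cell_poly_eq_at_knot:
  assumes "\<And>i. a < i \<Longrightarrow> i \<le> a + int m \<Longrightarrow> t i = x" "t a < x" "x < t (a + int m + 1)" "m \<le> p"
  shows "cell_poly t (kron a) p j x = cell_poly t (kron (a + int m)) p j x"
  using assms(4)
proof (induction p arbitrary: j rule: dec_induct)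
  case base
  show ?case
    using cell_poly_at_knot_left[of a m t x m j, OF assms(1,2)] cell_poly_at_knot_right[of a m t x m j, OF assms(1,3)]
    by simp
qed simp

lemma cell_exists:
  fixes t :: "int \<Rightarrow> real"
  assumes "t a \<le> x" "x < t b"  "a < b"
  obtains m where "a \<le> m" "m < b" "t m \<le> x" "x < t (m + 1)"
proof -
  have "\<exists>m\<ge>a. m < b \<and> t m \<le> x \<and> x < t (m + 1)"
    using assms(3,2)
  proof (induction b rule: int_gr_induct)
    case base
    then show ?case using assms(1) by auto
  next
    case (step i)
    show ?case
    proof (cases "x < t i")
      case True
      with step show ?thesis by force
    next
      case False
      with step show ?thesis by (intro exI[of _ i]) auto
    qed
  qed
  then show ?thesis using that by blast
qed

text \<open>Here the interval is closed on the right: it touches \<open>x\<close> from the left, as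
  the left derivative requires.\<close>

lemma cell_exists_left:
  fixes t :: "int \<Rightarrow> real"
  assumes "t a < x" "x \<le> t b" "a < b"
  obtains m where "a \<le> m" "m < b" "t m < x" "x \<le> t (m + 1)"
proof -
  have "\<exists>m\<ge>a. m < b \<and> t m < x \<and> x \<le> t (m + 1)"
    using assms(3,2)
  proof (induction b rule: int_gr_induct)
    case base
    then show ?case using assms(1) by auto
  next
    case (step i)
    show ?case
    proof (cases "x \<le> t i")
      case True
      with step show ?thesis by force
    next
      case False
      with step show ?thesis by (intro exI[of _ i]) auto
    qed
  qed
  then show ?thesis using that by blast
qed

text \<open>Only the knots from \<open>t (a + 1)\<close> to \<open>t (a + p)\<close> can equal
  \<open>x\<close>, so splines of degree \<open>p\<close> are continuous at \<open>x\<close>. Both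
  one-sided derivatives of the spline of degree \<open>Suc p\<close> are then the same combination
  of their values.\<close>

lemma bspl_deriv:
  assumes mono: "mono t" and a: "t a < x" "x < t (a + int p + 1)"
  shows "(bspl t (Suc p) j has_real_derivative oD t (Suc p) (j - 1) x - oD t (Suc p) j x) (at x)"
proof -
  obtain l where l: "a \<le> l" "t l < x" "x \<le> t (l + 1)"
    using cell_exists_left[of t a x "a + int p + 1"] a by auto
  obtain r where r: "l \<le> r" "r < a + int p + 1" "t r \<le> x" "x < t (r + 1)"
  proof -
    have "l < a + int p + 1"
    proof (rule ccontr)
      assume "\<not> l < a + int p + 1"
      then have "t (a + int p + 1) \<le> t l" using monoD[OF mono] by simp
      then show False using l(2) a(2) by simp
    qed
    with cell_exists[of t l x "a + int p + 1"] l a(2) that show thesis by auto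
  qed
  \<comment> \<open>The intervals \<open>l\<close> and \<open>r\<close> touch \<open>x\<close> from
    the left and from the right, so \<open>m\<close> is the multiplicity of \<open>x\<close> as a
    knot, and 0 inside an interval.\<close>
  define m where "m = nat (r - l)"
  have m: "r = l + int m" "m \<le> p" using r(1,2) l(1) by (auto simp: m_def)
  have eqx: "t i = x" if "l < i" "i \<le> l + int m" for i
  proof -
    have "t (l + 1) \<le> t i" "t i \<le> t r" using that m monoD[OF mono] by auto
    then show ?thesis using l(3) r(3) by simp
  qed
  have glue: "cell_poly t (kron l) q i x = cell_poly t (kron r) q i x" if "p \<le> q" for q i
    using cell_poly_eq_at_knot[of l m t x q i, OF eqx l(2)] r(4) m that by auto
  have at_x: "bspl t q i x = cell_poly t (kron r) q i x" for q i
    by (rule bspl_on_cell[OF mono r(3,4)])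
  define d where "d = oD t (Suc p) (j - 1) x - oD t (Suc p) j x"
  have d_r: "(cell_poly t (kron r) (Suc p) j has_real_derivative d) (at x)"
    using cell_poly_deriv[OF mono, of "kron r" p j x]
    by (simp add: d_def oD_def at_x algebra_simps)
  have d_l: "(cell_poly t (kron l) (Suc p) j has_real_derivative d) (at x)"
    using cell_poly_deriv[OF mono, of "kron l" p j x]
    by (simp add: d_def oD_def at_x glue algebra_simps)
  have "((\<lambda>y. (bspl t (Suc p) j y - bspl t (Suc p) j x) / (y - x)) \<longlongrightarrow> d) (at_left x)"
  proof (rule Lim_transform_eventually)
    show "((\<lambda>y. (cell_poly t (kron l) (Suc p) j y - cell_poly t (kron l) (Suc p) j x) / (y - x)) \<longlongrightarrow> d) (at_left x)"
      using d_l unfolding has_field_derivative_iff by (rule filterlim_mono) (simp_all add: at_within_le_at)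
    have "eventually (\<lambda>y. y \<in> {t l<..<x}) (at_left x)"
      using l(2) by (rule eventually_at_left_real)
    then show "eventually (\<lambda>y. (cell_poly t (kron l) (Suc p) j y - cell_poly t (kron l) (Suc p) j x) / (y - x)
       = (bspl t (Suc p) j y - bspl t (Suc p) j x) / (y - x)) (at_left x)"
    proof eventually_elim
      case (elim y)
      then have "bspl t (Suc p) j y = cell_poly t (kron l) (Suc p) j y"
        using l(3) by (intro bspl_on_cell[OF mono]) auto
      then show ?case unfolding at_x glue[OF le_SucI[OF order_refl]] by simp
    qed
  qed
  moreover have "((\<lambda>y. (bspl t (Suc p) j y - bspl t (Suc p) j x) / (y - x)) \<longlongrightarrow> d) (at_right x)"
  proof (rule Lim_transform_eventually)
    show "((\<lambda>y. (cell_poly t (kron r) (Suc p) j y - cell_poly t (kron r) (Suc p) j x) / (y - x)) \<longlongrightarrow> d) (at_right x)"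
      using d_r unfolding has_field_derivative_iff by (rule filterlim_mono) (simp_all add: at_within_le_at)
    have "eventually (\<lambda>y. y \<in> {x<..<t (r + 1)}) (at_right x)"
      using r(4) by (rule eventually_at_right_real)
    then show "eventually (\<lambda>y. (cell_poly t (kron r) (Suc p) j y - cell_poly t (kron r) (Suc p) j x) / (y - x)
       = (bspl t (Suc p) j y - bspl t (Suc p) j x) / (y - x)) (at_right x)"
    proof eventually_elim
      case (elim y)
      then have "bspl t (Suc p) j y = cell_poly t (kron r) (Suc p) j y"
        using r(3) by (intro bspl_on_cell[OF mono]) auto
      then show ?case unfolding at_x by simp
    qed
  qed
  ultimately show ?thesis
    unfolding has_field_derivative_iff d_def[symmetric] by (rule filterlim_split_at)
qed

section \<open>Periodic and open univariate spline spaces\<close>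

text \<open>What the complex needs of one coordinate direction, shared by the periodic and the open
  case. The map \<open>nx\<close> is the successor of an index (cyclic or \<open>Suc\<close>), so
  differentiation is the forward difference along \<open>nx\<close>; by \<open>nx_connected\<close>
  vanishing differences leave only constant coefficients.\<close>

locale spline_pair =
  fixes n m :: nat and L :: real and B D :: "nat \<Rightarrow> real \<Rightarrow> real" and nx :: "nat \<Rightarrow> nat"
  assumes L_pos: "0 < L" and n_pos: "1 \<le> n"
    and nx_range: "i \<in> {1..m} \<Longrightarrow> nx i \<in> {1..n}"
    and nx_connected: "(\<And>i. i \<in> {1..m} \<Longrightarrow> (f (nx i) :: real) = f i) \<Longrightarrow> i \<in> {1..n} \<Longrightarrow> f i = f 1"
    and deriv_sum: "0 < x \<Longrightarrow> x < L \<Longrightarrow>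
      ((\<lambda>x. \<Sum>i = 1..n. f i * B i x) has_real_derivative (\<Sum>i = 1..m. (f (nx i) - f i) * D i x)) (at x)"
    and unity: "0 < x \<Longrightarrow> x < L \<Longrightarrow> (\<Sum>i = 1..n. B i x) = 1"
    and D_independent: "(\<And>x. 0 < x \<Longrightarrow> x < L \<Longrightarrow> (\<Sum>i = 1..m. f i * D i x) = 0) \<Longrightarrow> i \<in> {1..m} \<Longrightarrow> f i = 0"
begin

text \<open>Differentiating a vanishing combination makes its coefficients constant, and the
  partition of unity makes the constant 0.\<close>

lemma B_independent:
  assumes "\<And>x. 0 < x \<Longrightarrow> x < L \<Longrightarrow> (\<Sum>i = 1..n. f i * B i x) = 0" "i \<in> {1..n}"
  shows "f i = 0"
proof -
  have "(\<Sum>i = 1..m. (f (nx i) - f i) * D i x) = 0" if x: "0 < x" "x < L" for x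
  proof -
    have "eventually (\<lambda>y. y \<in> {0<..<L}) (nhds x)" using x by (intro eventually_nhds_in_open) auto
    then have "eventually (\<lambda>y. (\<Sum>i = 1..n. f i * B i y) = 0) (nhds x)"
      by eventually_elim (use assms(1) in auto)
    then have "((\<lambda>x. \<Sum>i = 1..n. f i * B i x) has_real_derivative 0) (at x)"
      by (subst DERIV_cong_ev[OF refl _ refl, where g = "\<lambda>_. 0"]) auto
    from DERIV_unique[OF deriv_sum[OF x] this] show ?thesis .
  qed
  from D_independent[of "\<lambda>i. f (nx i) - f i", OF this]
  have const: "f i = f 1" if "i \<in> {1..n}" for i using nx_connected[of f, OF _ that] by simp
  obtain x where x: "0 < x" "x < L" using dense[OF L_pos] by auto
  have "(\<Sum>i = 1..n. f i * B i x) = f 1 * (\<Sum>i = 1..n. B i x)"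
    unfolding sum_distrib_left by (intro sum.cong refl) (metis const)
  then have "f 1 = 0" unfolding assms(1)[OF x] unity[OF x] by simp
  then show ?thesis unfolding const[OF assms(2)] .
qed

end

lemma bspl_cell_support:
  assumes "mono t" "t m \<le> x" "x < t (m + 1)" "bspl t p j x \<noteq> 0"
  shows "m - int p \<le> j \<and> j \<le> m"
  using assms(4) cell_poly_eq_0[of j m p t x] unfolding bspl_on_cell[OF assms(1-3)] by linarith

section \<open>Periodic knot sequences and periodic B-splines\<close>

locale periodic_knots =
  fixes t :: "int \<Rightarrow> real" and n :: nat and L :: real
  assumes L_pos: "0 < L" and n_pos: "1 \<le> n" and mono: "mono t"
    and period: "t (j + int n) = t j + L"
begin

lemma knot_shift: "t (j + k * int n) = t j + real_of_int k * L"
proof (induction k rule: int_induct[of _ 0])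
  case (step1 i)
  have "t (j + (i + 1) * int n) = t (j + i * int n) + L"
    using period[of "j + i * int n"] by (simp add: algebra_simps)
  then show ?case using step1 by (simp add: algebra_simps)
next
  case (step2 i)
  have "t (j + i * int n) = t (j + (i - 1) * int n) + L"
    using period[of "j + (i - 1) * int n"] by (simp add: algebra_simps)
  then show ?case using step2 by (simp add: algebra_simps)
qed simp

lemma bspl_shift: "bspl t p (j + k * int n) x = bspl t p j (x - real_of_int k * L)"
proof (induction p arbitrary: j)
  case 0
  show ?case using knot_shift[of j k] knot_shift[of "j + 1" k] by (auto simp: algebra_simps)
next
  case (Suc p)
  have k: "t (j + k * int n + i) = t (j + i) + real_of_int k * L" for i
    using knot_shift[of "j + i" k] by (simp add: algebra_simps)
  have IH: "bspl t p (j + k * int n + 1) x = bspl t p (j + 1) (x - real_of_int k * L)"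
    using Suc.IH[of "j + 1"] by (simp add: algebra_simps)
  show ?case
    using k[of 0] k[of 1] k[of "int p + 1"] k[of "int p + 2"] Suc.IH[of j] IH
    by (simp add: add.assoc[symmetric]) (simp add: algebra_simps)
qed

lemma bracket:
  obtains a where "t a < x" "x \<le> t (a + 1)"
proof -
  define k where "k = \<lfloor>(x - t 0) / L\<rfloor>"
  have k1: "real_of_int k * L \<le> x - t 0" "x - t 0 < (real_of_int k + 1) * L"
    using floor_divide_lower[OF L_pos] floor_divide_upper[OF L_pos] by (simp_all add: k_def)
  have "t (0 + (k - 1) * int n) < x" "x \<le> t (0 + (k + 1) * int n)"
    unfolding knot_shift using k1 L_pos by (simp_all add: algebra_simps)
  moreover have "0 + (k - 1) * int n < 0 + (k + 1) * int n" using n_pos by (simp add: algebra_simps)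
  ultimately show ?thesis using cell_exists_left that by blast
qed

text \<open>Translating by \<open>m\<close> periods shifts the index by \<open>m * n\<close>, so the
  infinite sum runs over one residue class modulo \<open>n\<close>, and only the window of indices
  active at \<open>x\<close> contributes.\<close>

lemma pbspl_window:
  assumes "\<And>j. bspl t p j x \<noteq> 0 \<Longrightarrow> lo \<le> j \<and> j \<le> hi"
  shows "pbspl t L p i x = (\<Sum>j \<in> {j \<in> {lo..hi}. j mod int n = i mod int n}. bspl t p j x)"
proof -
  have inj: "inj (\<lambda>m. i + m * int n)" using n_pos by (auto simp: inj_on_def)
  have "pbspl t L p i x = (\<Sum>\<^sub>\<infinity>m. bspl t p (i + m * int n) x)"
    unfolding pbspl_def bspl_shift ..
  also have "\<dots> = infsum (\<lambda>j. bspl t p j x) (range (\<lambda>m. i + m * int n))"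
    by (subst infsum_reindex[OF inj]) (simp add: o_def)
  also have "\<dots> = infsum (\<lambda>j. bspl t p j x) {j \<in> {lo..hi}. j mod int n = i mod int n}"
  proof (rule infsum_cong_neutral)
    fix j assume j: "j \<in> range (\<lambda>m. i + m * int n) - {j \<in> {lo..hi}. j mod int n = i mod int n}"
    then have "j mod int n = i mod int n" by auto
    then show "bspl t p j x = 0" using j assms[of j] by auto
  next
    fix j assume j: "j \<in> {j \<in> {lo..hi}. j mod int n = i mod int n} - range (\<lambda>m. i + m * int n)"
    then have "int n dvd j - i" by (auto simp: mod_eq_dvd_iff)
    then obtain k where "j - i = int n * k" by (elim dvdE)
    then have "j = i + k * int n" by (simp add: algebra_simps)
    then show "bspl t p j x = 0" using j by auto
  qed simp
  also have "\<dots> = (\<Sum>j \<in> {j \<in> {lo..hi}. j mod int n = i mod int n}. bspl t p j x)"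
    by (rule infsum_finite) (auto intro: finite_subset[of _ "{lo..hi}"])
  finally show ?thesis .
qed

text \<open>The function \<open>oD t p j\<close> sits on the B-spline of index \<open>j + 1\<close>,
  hence the shifted bounds. Its scaling factor is constant on a residue class because knot
  differences are periodic.\<close>

lemma pD_window:
  assumes "\<And>j. bspl t (p - 1) j x \<noteq> 0 \<Longrightarrow> lo + 1 \<le> j \<and> j \<le> hi + 1"
  shows "pD t L p i x = (\<Sum>j \<in> {j \<in> {lo..hi}. j mod int n = i mod int n}. oD t p j x)"
proof -
  have "pD t L p i x = (\<Sum>j \<in> {j \<in> {lo + 1..hi + 1}. j mod int n = (i + 1) mod int n}.
      real p / (t (i + int p + 1) - t (i + 1)) * bspl t (p - 1) j x)"
    unfolding pD_def by (subst pbspl_window[OF assms]) (auto simp: sum_distrib_left)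
  also have "\<dots> = (\<Sum>j \<in> {j \<in> {lo..hi}. j mod int n = i mod int n}. oD t p j x)"
  proof (rule sum.reindex_bij_witness[of _ "\<lambda>j. j + 1" "\<lambda>j. j - 1"])
    fix j assume "j \<in> {j \<in> {lo + 1..hi + 1}. j mod int n = (i + 1) mod int n}"
    then have d: "j \<in> {lo + 1..hi + 1}" "int n dvd j - (i + 1)" by (auto simp: mod_eq_dvd_iff)
    then obtain k where "j - (i + 1) = int n * k" by (elim dvdE)
    then have j: "j = i + 1 + k * int n" by (simp add: algebra_simps)
    show "j - 1 \<in> {j \<in> {lo..hi}. j mod int n = i mod int n}" using d by (auto simp: mod_eq_dvd_iff algebra_simps)
    show "oD t p (j - 1) x = real p / (t (i + int p + 1) - t (i + 1)) * bspl t (p - 1) j x"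
      using knot_shift[of "i + int p + 1" k] knot_shift[of "i + 1" k]
      unfolding oD_def j by (simp add: algebra_simps)
  next
    fix j assume "j \<in> {j \<in> {lo..hi}. j mod int n = i mod int n}"
    then have d: "j \<in> {lo..hi}" "int n dvd j - i" by (auto simp: mod_eq_dvd_iff)
    then show "j + 1 \<in> {j \<in> {lo + 1..hi + 1}. j mod int n = (i + 1) mod int n}" 
      by (auto simp: mod_eq_dvd_iff algebra_simps)
  qed auto
  finally show ?thesis .
qed

lemma pD_period: "pD t L p (i + int n) x = pD t L p i x"
proof -
  obtain a where a: "t a < x" "x \<le> t (a + 1)" by (rule bracket)
  have "a - int p - 1 + 1 \<le> j \<and> j \<le> a + int n + 1 + 1" if "bspl t (p - 1) j x \<noteq> 0" for j
  proof -
    from bspl_support[OF mono that] have 1: "t j \<le> x" "x < t (j + int (p - 1) + 1)" by auto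
    have "\<not> j \<ge> a + int n + 2"
    proof
      assume "j \<ge> a + int n + 2"
      then have "t (a + 1 + int n) \<le> t j" using monoD[OF mono] by simp
      then show False using a 1 L_pos period[of "a + 1"] by simp
    qed
    moreover have "\<not> j + int (p - 1) + 1 \<le> a"
      using monoD[OF mono, of "j + int (p - 1) + 1" a] a 1 by auto
    ultimately show ?thesis by auto
  qed
  from pD_window[of p x "a - int p - 1" "a + int n + 1", OF] this
  show ?thesis by (subst (1 2) pD_window[of p x "a - int p - 1" "a + int n + 1"]) auto
qed

text \<open>One window contains all active indices on a whole neighbourhood of \<open>x\<close>, so
  the infinite sum is differentiated as a finite one.\<close>

lemma pbspl_deriv:
  assumes "t a < x" "x < t (a + int p + 1)"
  shows "(pbspl t L (Suc p) i has_real_derivative pD t L (Suc p) (i - 1) x - pD t L (Suc p) i x) (at x)"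
proof -
  \<comment> \<open>The margins keep every active index inside the window after the shift by one
    caused by the derivative.\<close>
  define lo hi where "lo = a - int p - 3" "hi = a + int p + 2"
  have supp: "lo + 2 \<le> j \<and> j < hi" if "bspl t q j y \<noteq> 0" "q \<le> Suc p" "t a < y" "y < t (a + int p + 1)" for q j y
  proof -
    from bspl_support[OF mono that(1)] have 1: "t j \<le> y" "y < t (j + int q + 1)" by auto
    have "\<not> j \<ge> a + int p + 1" using monoD[OF mono, of "a + int p + 1" j] 1 that by auto
    moreover have "\<not> j + int q + 1 \<le> a"
      using monoD[OF mono, of "j + int q + 1" a] that 1 by auto
    ultimately show ?thesis using that(2) by (auto simp: lo_hi_def)
  qed
  let ?C = "{j \<in> {lo..hi}. j mod int n = i mod int n}"
  have d: "((\<lambda>y. \<Sum>j \<in> ?C. bspl t (Suc p) j y) has_real_derivative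
      (\<Sum>j \<in> ?C. oD t (Suc p) (j - 1) x - oD t (Suc p) j x)) (at x)"
    by (rule DERIV_sum) (rule bspl_deriv[OF mono assms])
  have "eventually (\<lambda>y. y \<in> {t a<..<t (a + int p + 1)}) (nhds x)"
    using assms by (intro eventually_nhds_in_open) auto
  then have ev: "eventually (\<lambda>y. pbspl t L (Suc p) i y = (\<Sum>j \<in> ?C. bspl t (Suc p) j y)) (nhds x)"
  proof eventually_elim
    case (elim y)
    show ?case by (rule pbspl_window) (use supp[of "Suc p" _ y] elim in force)
  qed
  have "(\<Sum>j \<in> ?C. oD t (Suc p) (j - 1) x) = (\<Sum>j \<in> {j \<in> {lo - 1..hi - 1}. j mod int n = (i - 1) mod int n}. oD t (Suc p) j x)"
    by (rule sum.reindex_bij_witness[of _ "\<lambda>j. j + 1" "\<lambda>j. j - 1"]) (auto simp: mod_eq_dvd_iff algebra_simps)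
  also have "\<dots> = pD t L (Suc p) (i - 1) x"
    by (rule pD_window[symmetric]) (use supp[of p _ x] assms in force)
  finally have 1: "(\<Sum>j \<in> ?C. oD t (Suc p) (j - 1) x) = pD t L (Suc p) (i - 1) x" .
  have 2: "(\<Sum>j \<in> ?C. oD t (Suc p) j x) = pD t L (Suc p) i x"
    by (rule pD_window[symmetric]) (use supp[of p _ x] assms in force)
  show ?thesis
    using d unfolding sum_subtractf 1 2 DERIV_cong_ev[OF refl ev refl] .
qed

definition residue_index :: "int \<Rightarrow> nat" where
  "residue_index j = nat ((j - 1) mod int n) + 1"

lemma residue_index_range: "residue_index j \<in> {1..n}"
  using n_pos by (auto simp: residue_index_def Suc_le_eq nat_less_iff)

lemma residue_index_eq:
  assumes "i \<in> {1..n}"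
  shows "residue_index j = i \<longleftrightarrow> j mod int n = int i mod int n"
proof -
  have "residue_index j = i \<longleftrightarrow> (j - 1) mod int n = int i - 1"
    using n_pos assms by (auto simp: residue_index_def)
  also have "int i - 1 = (int i - 1) mod int n" using assms by (intro mod_pos_pos_trivial[symmetric]) auto
  also have "(j - 1) mod int n = (int i - 1) mod int n \<longleftrightarrow> j mod int n = int i mod int n"
    by (simp add: mod_eq_dvd_iff)
  finally show ?thesis .
qed

lemma sum_residue_classes:
  assumes "finite W"
  shows "(\<Sum>i = 1..n. c i * (\<Sum>j \<in> {j \<in> W. j mod int n = int i mod int n}. g j))
       = (\<Sum>j \<in> W. c (residue_index j) * (g j :: real))"
proof -
  have "(\<Sum>j \<in> W. c (residue_index j) * g j)
      = (\<Sum>i = 1..n. \<Sum>j \<in> {j \<in> W. residue_index j = i}. c (residue_index j) * g j)"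
    by (rule sum.group[symmetric]) (use assms residue_index_range in auto)
  also have "\<dots> = (\<Sum>i = 1..n. c i * (\<Sum>j \<in> {j \<in> W. j mod int n = int i mod int n}. g j))"
    unfolding sum_distrib_left by (intro sum.cong) (auto simp: residue_index_eq, metis atLeastAtMost_iff One_nat_def residue_index_eq)
  finally show ?thesis ..
qed

lemma pbspl_unity: "(\<Sum>i = 1..n. pbspl t L p (int i) x) = 1"
proof -
  obtain m where m: "t m \<le> x" "x < t (m + 1)"
  proof -
    obtain a where a: "t a < x" "x \<le> t (a + 1)" by (rule bracket)
    have "x < t (a + 1 + int n)" using a L_pos period[of "a + 1"] by simp
    with cell_exists[of t a x "a + 1 + int n"] a that show thesis by auto
  qed
  have "(\<Sum>i = 1..n. pbspl t L p (int i) x)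
      = (\<Sum>i = 1..n. 1 * (\<Sum>j \<in> {j \<in> {m - int p..m}. j mod int n = int i mod int n}. bspl t p j x))"
    by (subst pbspl_window[of p x "m - int p" m])
      (use bspl_cell_support[OF mono m] in auto)
  also have "\<dots> = 1"
    unfolding sum_residue_classes[OF finite_atLeastAtMost_int]
    using cell_poly_sum[OF mono, of m] m by (simp add: bspl_on_cell[OF mono m])
  finally show ?thesis .
qed

text \<open>A nonempty knot interval in the support of the function with index \<open>i\<close> is
  moved by whole periods until it meets the domain; there the combination is a sum of polynomial
  pieces and local independence applies.\<close>

lemma pD_independent:
  assumes mult: "\<And>j. t j < t (j + int p + 1)"
    and sum0: "\<And>x. 0 < x \<Longrightarrow> x < L \<Longrightarrow> (\<Sum>i = 1..n. c i * pD t L (Suc p) (int i) x) = 0"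
    and i: "i \<in> {1..n}"
  shows "c i = 0"
proof -
  obtain m0 where m0: "int i + 1 \<le> m0" "m0 < int i + 1 + int p + 1" "t m0 \<le> t (int i + 1)" "t (int i + 1) < t (m0 + 1)"
    using cell_exists[of t "int i + 1" "t (int i + 1)" "int i + 1 + int p + 1"] mult[of "int i + 1"] by auto
  define z where "z = t (int i + 1)"
  \<comment> \<open>This many periods carry the knot \<open>z\<close> to a point that is at least 0
    and less than \<open>L\<close>.\<close>
  define k where "k = - \<lfloor>z / L\<rfloor>"
  have z: "0 \<le> z + real_of_int k * L" "z + real_of_int k * L < L"
  proof -
    from floor_divide_lower[OF L_pos, of z] floor_divide_upper[OF L_pos, of z] show "0 \<le> z + real_of_int k * L" "z + real_of_int k * L < L" by (simp_all add: k_def algebra_simps)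
  qed
  define m where "m = m0 + k * int n"
  define j where "j = int i + 1 + k * int n"
  have tm: "t m \<le> z + real_of_int k * L" "z + real_of_int k * L < t (m + 1)"
    using m0 knot_shift[of m0 k] knot_shift[of "m0 + 1" k] by (auto simp: m_def z_def algebra_simps)
  \<comment> \<open>The interval may stick out of the domain. The overlap has positive length
    because both are closed on the left, open on the right, and contain the moved knot.\<close>
  define u v where "u = max 0 (t m)" "v = min L (t (m + 1))"
  have uv: "u < v" using z tm L_pos by (auto simp: u_v_def)
  let ?w = "\<lambda>j. real (Suc p) / (t (j + int p + 1) - t j)"
  have D0: "(\<Sum>j = m - int p..m. c (residue_index (j - 1)) * ?w j * cell_poly t (kron m) p j x) = 0"
    if x: "u < x" "x < v" for x
  proof -
    have cell: "t m \<le> x" "x < t (m + 1)" and x0: "0 < x" "x < L" using x by (auto simp: u_v_def)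
    have "(\<Sum>i = 1..n. c i * pD t L (Suc p) (int i) x) = (\<Sum>i = 1..n. c i *
       (\<Sum>j \<in> {j \<in> {m - int p - 1..m - 1}. j mod int n = int i mod int n}. oD t (Suc p) j x))"
      by (subst pD_window[of "Suc p" x "m - int p - 1" "m - 1"])
        (use bspl_cell_support[OF mono cell, of p] in auto)
    also have "\<dots> = (\<Sum>j = m - int p - 1..m - 1. c (residue_index j) * oD t (Suc p) j x)"
      by (rule sum_residue_classes) simp
    also have "\<dots> = (\<Sum>j = m - int p..m. c (residue_index (j - 1)) * ?w j * cell_poly t (kron m) p j x)"
      by (rule sum.reindex_bij_witness[of _ "\<lambda>j. j - 1" "\<lambda>j. j + 1"])
        (auto simp: oD_def bspl_on_cell[OF mono cell] algebra_simps)
    finally show ?thesis using sum0[OF x0] by simp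
  qed
  have "t m < t (m + 1)" using tm by linarith
  moreover have "m - int p \<le> j" "j \<le> m" using m0 by (auto simp: m_def j_def)
  \<comment> \<open>For small \<open>n\<close> several indices of the window share one coefficient;
    independence is applied over the integer indices, where this does no harm.\<close>
  ultimately have "c (residue_index (j - 1)) * ?w j = 0"
    using cell_poly_independent[OF mono _ uv D0] by blast
  moreover have "?w j \<noteq> 0" using mult[of j] by simp
  moreover have "residue_index (j - 1) = i"
    unfolding residue_index_eq[OF i] by (simp add: j_def)
  ultimately show ?thesis by simp
qed

end

lemma periodic_spline_pair:
  assumes "periodic_C1_knots t n L p"
  shows "spline_pair n n L (\<lambda>i. pbspl t L p (int i)) (\<lambda>i. pD t L p (int i)) (\<lambda>i. i mod n + 1)"
proof -
  have a: "0 < L" "1 \<le> n" "mono t" "\<And>j. t (j + int n) = t j + L" and mult: "\<And>j. t j < t (j + int p - 1)"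
    using assms unfolding periodic_C1_knots_def by auto
  interpret periodic_knots t n L using a by unfold_locales
  \<comment> \<open>For a smaller degree the multiplicity bound would place a knot strictly below
    itself or below an earlier one.\<close>
  have "p \<ge> 2"
  proof (rule ccontr)
    assume "\<not> 2 \<le> p"
    then have "t (0 + int p - 1) \<le> t 0" by (intro monoD[OF mono]) auto
    then show False using mult[of 0] by simp
  qed
  then obtain q where p: "p = Suc (Suc q)" using le_Suc_ex by (metis add_2_eq_Suc)
  have mult': "t j < t (j + int q + 1)" for j using mult[of j] by (simp add: p algebra_simps)
  have d: "(pbspl t L p i has_real_derivative pD t L p (i - 1) x - pD t L p i x) (at x)" for i x
  proof -
    obtain l where l: "t l < x" "x \<le> t (l + 1)" by (rule bracket)
    have "x < t (l + int (Suc q) + 1)" using mult'[of "l + 1"] l by (simp add: algebra_simps)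
    from pbspl_deriv[OF l(1) this] show ?thesis by (simp add: p)
  qed
  let ?B = "\<lambda>i. pbspl t L p (int i)" and ?D = "\<lambda>i. pD t L p (int i)"
  show ?thesis
  proof
    show "((\<lambda>x. \<Sum>i = 1..n. f i * ?B i x) has_real_derivative
       (\<Sum>i = 1..n. (f (i mod n + 1) - f i) * ?D i x)) (at x)" for f x
    proof -
      have "((\<lambda>x. \<Sum>i = 1..n. f i * ?B i x) has_real_derivative
         (\<Sum>i = 1..n. f i * (pD t L p (int i - 1) x - ?D i x))) (at x)"
        by (intro DERIV_sum DERIV_cmult d)
      also have "(\<Sum>i = 1..n. f i * (pD t L p (int i - 1) x - ?D i x))
         = (\<Sum>i = 1..n. f i * pD t L p (int i - 1) x) - (\<Sum>i = 1..n. f i * ?D i x)"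
        by (simp add: right_diff_distrib sum_subtractf)
      \<comment> \<open>Summation by parts around the circle: the successor of \<open>n\<close> is
        1, and the indices 0 and \<open>n\<close> give the same periodic function.\<close>
      also have "(\<Sum>i = 1..n. f i * pD t L p (int i - 1) x) = (\<Sum>i = 1..n. f (i mod n + 1) * ?D i x)"
      proof (rule sum.reindex_bij_witness[of _ "\<lambda>i. i mod n + 1" "\<lambda>i. if i = 1 then n else i - 1"])
        fix i assume i: "i \<in> {1..n}"
        show "f ((if i = 1 then n else i - 1) mod n + 1) * ?D (if i = 1 then n else i - 1) x
           = f i * pD t L p (int i - 1) x"
          using i pD_period[of p 0 x] by (auto simp: of_nat_diff)
      qed (use n_pos in \<open>auto simp: Suc_le_eq le_less split: if_splits\<close>)
      finally show ?thesis by (simp add: left_diff_distrib sum_subtractf)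
    qed
    show "(\<Sum>i = 1..n. ?B i x) = 1" for x by (rule pbspl_unity)
    show "f i = 0" if "\<And>x. 0 < x \<Longrightarrow> x < L \<Longrightarrow> (\<Sum>i = 1..n. f i * ?D i x) = 0" "i \<in> {1..n}" for f i
    proof (rule pD_independent[of "Suc q" f])
      show "t j < t (j + int (Suc q) + 1)" for j
        using mult'[of j] monoD[OF mono, of "j + int q + 1" "j + int (Suc q) + 1"] by simp
    qed (use that p in auto)
    show "f i = f 1" if "\<And>i. i \<in> {1..n} \<Longrightarrow> f (i mod n + 1) = f i" "i \<in> {1..n}" for f :: "nat \<Rightarrow> real" and i
    proof -
      have "Suc k \<le> n \<Longrightarrow> f (Suc k) = f 1" for k
      proof (induction k)
        case (Suc k)
        then show ?case using that(1)[of "Suc k"] by simp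
      qed simp
      from this[of "i - 1"] that(2) show ?thesis by simp
    qed
  qed (use a n_pos in \<open>auto simp: Suc_le_eq\<close>)
qed

section \<open>Open knot vectors\<close>

lemma bspl_cong:
  assumes "\<And>i. j \<le> i \<Longrightarrow> i \<le> j + int p + 1 \<Longrightarrow> t i = t' i"
  shows "bspl t p j x = bspl t' p j x"
  using assms
proof (induction p arbitrary: j)
  case (Suc p)
  have "bspl t p j x = bspl t' p j x" "bspl t p (j + 1) x = bspl t' p (j + 1) x"
    by (auto intro!: Suc)
  then show ?case using Suc.prems by simp
qed auto

text \<open>The end knots are repeated \<open>p + 1\<close> times, so the outermost derivative
  functions vanish, \<open>n - 1\<close> of them remain, and the difference of coefficients is the
  ordinary one without wrap-around.\<close>

lemma open_spline_pair:
  assumes "open_C1_knots t n L p"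
  shows "spline_pair n (n - 1) L (\<lambda>i. bspl t p (int i)) (\<lambda>i. oD t p (int i)) Suc"
    and "2 \<le> n"
proof -
  have L: "0 < L" and p1: "1 \<le> p" and pn: "p + 1 \<le> n"
    and tmono: "\<And>j k. 1 \<le> j \<Longrightarrow> j \<le> k \<Longrightarrow> k \<le> int (n + p + 1) \<Longrightarrow> t j \<le> t k"
    and t0: "\<And>j. 1 \<le> j \<Longrightarrow> j \<le> int (p + 1) \<Longrightarrow> t j = 0"
    and tL: "\<And>j. int (n + 1) \<le> j \<Longrightarrow> j \<le> int (n + p + 1) \<Longrightarrow> t j = L"
    and tin: "0 < t (int p + 2)" "t (int n) < L"
    and mult: "\<And>j. int p + 2 \<le> j \<Longrightarrow> j + int p - 1 \<le> int n \<Longrightarrow> t j < t (j + int p - 1)"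
    using assms unfolding open_C1_knots_def by auto
  show n2: "2 \<le> n" using p1 pn by simp
  obtain q where p: "p = Suc q" using p1 by (cases p) auto
  text \<open>The knots outside the index range of the open knot vector are arbitrary; clamping them
    makes the sequence globally monotone without changing any spline in use.\<close>
  define s where "s = (\<lambda>j. t (min (int (n + p + 1)) (max 1 j)))"
  have s: "s j = t j" if "1 \<le> j" "j \<le> int (n + p + 1)" for j using that by (simp add: s_def)
  have smono: "mono s" unfolding s_def by (intro monoI tmono) auto
  have Bs: "bspl t p (int i) x = bspl s p (int i) x" if "i \<in> {1..n}" for i x
    by (rule bspl_cong) (use that in \<open>auto simp: s\<close>)
  have Ds: "oD t p (int i) x = oD s p (int i) x" if "i \<le> n" for i x
  proof -
    have "bspl t q (int i + 1) x = bspl s q (int i + 1) x"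
      by (rule bspl_cong) (use that in \<open>auto simp: s p\<close>)
    then show ?thesis using that by (simp add: oD_def s p)
  qed
  \<comment> \<open>Both denominators are differences of equal end knots, so the quotients are 0 by
    convention; this removes the boundary terms of the summation by parts below.\<close>
  have D0: "oD t p 0 x = 0" "oD t p (int n) x = 0" for x
    using t0[of 1] t0[of "int p + 1"] tL[of "int n + 1"] tL[of "int n + int p + 1"]
    by (auto simp: oD_def)
  have d: "(bspl t p (int i) has_real_derivative oD t p (int i - 1) x - oD t p (int i) x) (at x)"
    if i: "i \<in> {1..n}" and x: "0 < x" "x < L" for i x
  proof -
    obtain l where l: "1 \<le> l" "l < int n + 1" "t l < x" "x \<le> t (l + 1)"
      using cell_exists_left[of t 1 x "int n + 1"] t0[of 1] tL[of "int n + 1"] x n2 by auto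
    have lp: "int p + 1 \<le> l"
    proof (rule ccontr)
      assume "\<not> int p + 1 \<le> l"
      then have "t (l + 1) = 0" using l by (intro t0) auto
      then show False using l x by simp
    qed
    \<comment> \<open>Fewer than \<open>p\<close> knots equal \<open>x\<close>: in the interior by
      the multiplicity bound, and near the right end because the knot number \<open>l + p\<close> is
      already \<open>L\<close>.\<close>
    have "x < t (l + int p)"
    proof (cases "l + int p \<le> int n")
      case True
      then have "t (l + 1) < t (l + 1 + int p - 1)" using lp by (intro mult) auto
      then show ?thesis using l by (simp add: algebra_simps)
    next
      case False
      then have "t (l + int p) = L" using l by (intro tL) auto
      then show ?thesis using x by simp
    qed
    then have "s l < x" "x < s (l + int q + 1)" using l lp by (auto simp: s p algebra_simps)
    from bspl_deriv[OF smono this]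
    have "(bspl s p (int i) has_real_derivative oD s p (int i - 1) x - oD s p (int i) x) (at x)"
      by (simp add: p)
    moreover have "bspl t p (int i) = bspl s p (int i)" using Bs[OF i] by auto
    moreover have "oD s p (int i - 1) x = oD t p (int i - 1) x" using Ds[of "i - 1" x] i by (auto simp: of_nat_diff)
    ultimately show ?thesis using Ds[of i x] i by simp
  qed
  have cell: "\<exists>m. int p + 1 \<le> m \<and> m \<le> int n \<and> t m \<le> x \<and> x < t (m + 1)" if x: "0 < x" "x < L" for x
  proof -
    have "t (int p + 1) \<le> x" "x < t (int n + 1)" "int p + 1 < int n + 1"
      using t0[of "int p + 1"] tL[of "int n + 1"] x pn by auto
    from cell_exists[OF this] show ?thesis by (metis zle_add1_eq_le)
  qed
  let ?B = "\<lambda>i. bspl t p (int i)" and ?D = "\<lambda>i. oD t p (int i)"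
  show "spline_pair n (n - 1) L ?B ?D Suc"
  proof
    show "((\<lambda>x. \<Sum>i = 1..n. f i * ?B i x) has_real_derivative
       (\<Sum>i = 1..n - 1. (f (Suc i) - f i) * ?D i x)) (at x)" if x: "0 < x" "x < L" for f x
    proof -
      have "((\<lambda>x. \<Sum>i = 1..n. f i * ?B i x) has_real_derivative
         (\<Sum>i = 1..n. f i * (oD t p (int i - 1) x - ?D i x))) (at x)"
        by (intro DERIV_sum DERIV_cmult d x) auto
      also have "(\<Sum>i = 1..n. f i * (oD t p (int i - 1) x - ?D i x))
         = (\<Sum>i = 1..n. f i * oD t p (int i - 1) x) - (\<Sum>i = 1..n. f i * ?D i x)"
        by (simp add: right_diff_distrib sum_subtractf)
      also have "(\<Sum>i = 1..n. f i * ?D i x) = (\<Sum>i = 1..n - 1. f i * ?D i x)"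
      proof (rule sum.mono_neutral_right)
        show "\<forall>i \<in> {1..n} - {1..n - 1}. f i * ?D i x = 0"
        proof
          fix i assume "i \<in> {1..n} - {1..n - 1}"
          then have "i = n" by auto
          then show "f i * ?D i x = 0" using D0 by simp
        qed
      qed auto
      also have "(\<Sum>i = 1..n. f i * oD t p (int i - 1) x) = (\<Sum>i = 2..n. f i * oD t p (int i - 1) x)"
      proof (rule sum.mono_neutral_right)
        show "\<forall>i \<in> {1..n} - {2..n}. f i * oD t p (int i - 1) x = 0"
        proof
          fix i assume "i \<in> {1..n} - {2..n}"
          then have "i = 1" by auto
          then show "f i * oD t p (int i - 1) x = 0" using D0 by simp
        qed
      qed auto
      also have "(\<Sum>i = 2..n. f i * oD t p (int i - 1) x) = (\<Sum>i = 1..n - 1. f (Suc i) * ?D i x)"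
        by (rule sum.reindex_bij_witness[of _ Suc "\<lambda>i. i - 1"]) (auto simp: of_nat_diff)
      finally show ?thesis by (simp add: left_diff_distrib sum_subtractf)
    qed
    show "(\<Sum>i = 1..n. ?B i x) = 1" if x: "0 < x" "x < L" for x
    proof -
      obtain m where m: "int p + 1 \<le> m" "m \<le> int n" "t m \<le> x" "x < t (m + 1)" using cell[OF x] by auto
      then have sm: "s m \<le> x" "x < s (m + 1)" by (auto simp: s)
      have z: "bspl s p j x = 0" if "\<not> (m - int p \<le> j \<and> j \<le> m)" for j
        using bspl_cell_support[OF smono sm] that by blast
      have "(\<Sum>i = 1..n. ?B i x) = (\<Sum>j = 1..int n. bspl s p j x)"
        by (rule sum.reindex_bij_witness[of _ nat int]) (auto simp: Bs)
      also have "\<dots> = (\<Sum>j = m - int p..m. bspl s p j x)"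
        by (rule sum.mono_neutral_right)
          (use m in \<open>auto simp: z\<close>)
      also have "\<dots> = 1"
        using cell_poly_sum[OF smono, of m] sm by (simp add: bspl_on_cell[OF smono sm])
      finally show ?thesis .
    qed
    show "f i = 0" if sum0: "\<And>x. 0 < x \<Longrightarrow> x < L \<Longrightarrow> (\<Sum>i = 1..n - 1. f i * ?D i x) = 0"
      and i: "i \<in> {1..n - 1}" for f i
    proof -
      \<comment> \<open>The support has positive length: it begins at the left end knot, ends at the
        right one, or is governed by the interior multiplicity bound.\<close>
      have ti: "t (int i + 1) < t (int i + 1 + int p)"
      proof -
        consider "i \<le> p" | "p < i" "n < i + 1 + p" | "p < i" "i + 1 + p \<le> n" by linarith
        then show ?thesis
        proof cases
          case 1
          have "t (int p + 2) \<le> t (int i + 1 + int p)" using i by (intro tmono) auto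
          then show ?thesis using t0[of "int i + 1"] 1 tin by auto
        next
          case 2
          have "t (int i + 1) \<le> t (int n)" using i by (intro tmono) auto
          then show ?thesis using tL[of "int i + 1 + int p"] 2 i tin by auto
        next
          case 3
          have "t (int i + 1) < t (int i + 1 + int p - 1)" using 3 by (intro mult) auto
          also have "\<dots> \<le> t (int i + 1 + int p)" using i by (intro tmono) auto
          finally show ?thesis .
        qed
      qed
      obtain m where m: "int i + 1 \<le> m" "m < int i + 1 + int p" "t m \<le> t (int i + 1)" "t (int i + 1) < t (m + 1)"
        using cell_exists[of t "int i + 1" "t (int i + 1)" "int i + 1 + int p"] ti p1 by auto
      have tm: "t m < t (m + 1)" using m by simp
      have mp: "int p + 1 \<le> m"
        using t0[of m] t0[of "m + 1"] tm m i by (cases "int p + 1 \<le> m") auto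
      have mn: "m \<le> int n"
        using tL[of m] tL[of "m + 1"] tm m i by (cases "m \<le> int n") auto
      have t0L: "0 \<le> t m" "t (m + 1) \<le> L"
        using tmono[of 1 m] t0[of 1] tmono[of "m + 1" "int n + 1"] tL[of "int n + 1"] mp mn by auto
      let ?w = "\<lambda>j. real p / (s (j + int p) - s j)"
      have "(\<Sum>j = m - int q..m. (f (nat (j - 1)) * ?w j) * cell_poly s (kron m) q j x) = 0"
        if x: "t m < x" "x < t (m + 1)" for x
      proof -
        have sm: "s m \<le> x" "x < s (m + 1)" using x mp mn by (auto simp: s)
        have z: "bspl s q j x = 0" if "\<not> (m - int q \<le> j \<and> j \<le> m)" for j
          using bspl_cell_support[OF smono sm] that by blast
        have "0 = (\<Sum>i = 1..n - 1. f i * ?D i x)"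
          using sum0[of x] x t0L by simp
        also have "\<dots> = (\<Sum>i = 1..n - 1. f i * oD s p (int i) x)"
          by (intro sum.cong refl) (auto simp: Ds)
        also have "\<dots> = (\<Sum>j = 2..int n. (f (nat (j - 1)) * ?w j) * bspl s q j x)"
          by (rule sum.reindex_bij_witness[of _ "\<lambda>j. nat (j - 1)" "\<lambda>i. int i + 1"])
            (auto simp: oD_def p algebra_simps nat_diff_distrib)
        also have "\<dots> = (\<Sum>j = m - int q..m. (f (nat (j - 1)) * ?w j) * bspl s q j x)"
          by (rule sum.mono_neutral_right)
            (use mp mn in \<open>auto simp: p z\<close>)
        finally show ?thesis by (simp add: bspl_on_cell[OF smono sm])
      qed
      moreover have "s m < s (m + 1)" using tm mp mn by (simp add: s)
      ultimately have "f (nat (int i + 1 - 1)) * ?w (int i + 1) = 0"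
        using cell_poly_independent[where m = m and p = q and c = "\<lambda>j. f (nat (j - 1)) * ?w j" and j = "int i + 1", OF smono _ tm] m by (auto simp: p)
      moreover have "i \<le> n" using i by auto
      then have "?w (int i + 1) \<noteq> 0" using ti p1 s[of "int i + 1"] s[of "int i + 1 + int p"] by auto
      ultimately show ?thesis by simp
    qed
    show "f i = f 1" if "\<And>i. i \<in> {1..n - 1} \<Longrightarrow> f (Suc i) = f i" "i \<in> {1..n}" for f :: "nat \<Rightarrow> real" and i
    proof -
      have "Suc k \<le> n \<Longrightarrow> f (Suc k) = f 1" for k
      proof (induction k)
        case (Suc k)
        then show ?case using that(1)[of "Suc k"] by simp
      qed simp
      from this[of "i - 1"] that(2) show ?thesis by simp
    qed
  qed (use L n2 in auto)
qed

section \<open>Tensor product sums\<close>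

interpretation fun_vs: vector_space fscale by (rule vector_space_fscale)

lemma fscale_eq_scaleR: "fscale c f x = c *\<^sub>R f x"
  by (simp add: fscale_def)

lemma sum_apply: "sum F A x = (\<Sum>a\<in>A. F a x)"
  by (induction A rule: infinite_finite_induct) auto

lemma fspan_family:
  fixes g :: "nat \<Rightarrow> 'a \<Rightarrow> 'b::real_vector"
  shows "fspan {g l | l. 1 \<le> l \<and> l \<le> N} = {\<lambda>x. \<Sum>l = 1..N. y l *\<^sub>R g l x | y. True}"
    (is "_ = ?S")
proof
  have S: "?S = range (\<lambda>y. \<Sum>l = 1..N. fscale (y l) (g l))"
    by (auto simp: image_iff fun_eq_iff sum_apply fscale_eq_scaleR intro!: exI)
  show "?S \<subseteq> fspan {g l | l. 1 \<le> l \<and> l \<le> N}"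
    unfolding S
  proof (rule image_subsetI)
    fix y :: "nat \<Rightarrow> real"
    have "g l \<in> fspan {g l | l. 1 \<le> l \<and> l \<le> N}" if "l \<in> {1..N}" for l
      using that by (intro fun_vs.span_base) auto
    then show "(\<Sum>l = 1..N. fscale (y l) (g l)) \<in> fspan {g l | l. 1 \<le> l \<and> l \<le> N}"
      by (intro fun_vs.span_sum fun_vs.span_scale)
  qed
  have "fun_vs.subspace ?S"
  proof (rule fun_vs.subspaceI)
    show "0 \<in> ?S" by (auto intro!: exI[of _ "\<lambda>_. 0"])
  next
    fix u v assume "u \<in> ?S" "v \<in> ?S"
    then obtain y z where "u = (\<lambda>x. \<Sum>l = 1..N. y l *\<^sub>R g l x)" "v = (\<lambda>x. \<Sum>l = 1..N. z l *\<^sub>R g l x)" by auto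
    then show "u + v \<in> ?S"
      by (auto intro!: exI[of _ "\<lambda>l. y l + z l"] simp: fun_eq_iff scaleR_add_left sum.distrib)
  next
    fix c u assume "u \<in> ?S"
    then obtain y where "u = (\<lambda>x. \<Sum>l = 1..N. y l *\<^sub>R g l x)" by auto
    then show "fscale c u \<in> ?S"
      by (auto intro!: exI[of _ "\<lambda>l. c * y l"] simp: fun_eq_iff fscale_eq_scaleR scaleR_sum_right)
  qed
  moreover have "{g l | l. 1 \<le> l \<and> l \<le> N} \<subseteq> ?S"
  proof
    fix h assume "h \<in> {g l | l. 1 \<le> l \<and> l \<le> N}"
    then obtain l where l: "h = g l" "1 \<le> l" "l \<le> N" by auto
    have "h = (\<lambda>x. \<Sum>i = 1..N. (if i = l then 1 else 0) *\<^sub>R g i x)"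
    proof
      fix x
      have "(\<Sum>i = 1..N. (if i = l then 1 else 0) *\<^sub>R g i x) = (\<Sum>i = 1..N. if i = l then g i x else 0)"
        by (intro sum.cong) auto
      also have "\<dots> = h x" using l by simp
      finally show "h x = (\<Sum>i = 1..N. (if i = l then 1 else 0) *\<^sub>R g i x)" ..
    qed
    then show "h \<in> ?S" unfolding mem_Collect_eq by (intro exI conjI TrueI)
  qed
  ultimately show "fspan {g l | l. 1 \<le> l \<and> l \<le> N} \<subseteq> ?S" using fun_vs.span_minimal by blast
qed

text \<open>The finite \<open>F\<close> makes a basis of \<open>U\<close> finite, and
  \<open>e\<close> extends it by one element. An infinite basis would have cardinality 0 and spoil
  the count.\<close>

lemma fdim_insert_span:
  fixes U :: "('a \<Rightarrow> 'b::real_vector) set"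
  assumes "fun_vs.subspace U" "U \<subseteq> fspan F" "finite F" "e \<notin> U"
  shows "fdim (fspan (insert e U)) = fdim U + 1"
proof -
  obtain C where C: "C \<subseteq> U" "\<not> fun_vs.dependent C" "U \<subseteq> fspan C" "card C = fdim U"
    using fun_vs.basis_exists[of U] by blast
  have "finite C"
    using fun_vs.independent_span_bound[OF assms(3) C(2)] C(1) assms(2) by auto
  have span_C: "fspan C = U"
    using C fun_vs.span_minimal[OF C(1) assms(1)] by auto
  have ind: "\<not> fun_vs.dependent (insert e C)"
    using C(2) assms(4) span_C by (simp add: fun_vs.independent_insert)
  have "fspan (insert e U) = fspan (insert e C)"
  proof
    show "fspan (insert e C) \<subseteq> fspan (insert e U)" using C(1) by (intro fun_vs.span_mono) auto
    have "U \<subseteq> fspan (insert e C)"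
      using span_C fun_vs.span_mono[of C "insert e C"] by blast
    then show "fspan (insert e U) \<subseteq> fspan (insert e C)"
      by (intro fun_vs.span_minimal) (auto intro: fun_vs.span_base)
  qed
  then have "fdim (fspan (insert e U)) = card (insert e C)"
    using fun_vs.dim_span_eq_card_independent[OF ind] by simp
  also have "e \<notin> C" using C(1) assms(4) by auto
  then have "card (insert e C) = fdim U + 1" using \<open>finite C\<close> C(4) by simp
  finally show ?thesis .
qed

text \<open>Coefficients are indexed in the order \<open>f k i j\<close> with \<open>k\<close> for the third coordinate, so that
  \<open>f k\<close> is the coefficient array of one layer in \<open>t\<close>.\<close>

definition tsum :: "nat \<Rightarrow> (nat \<Rightarrow> real \<Rightarrow> real) \<Rightarrow> nat \<Rightarrow> (nat \<Rightarrow> real \<Rightarrow> real) \<Rightarrow> nat \<Rightarrow> (nat \<Rightarrow> real \<Rightarrow> real)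
    \<Rightarrow> (nat \<Rightarrow> nat \<Rightarrow> nat \<Rightarrow> real) \<Rightarrow> pt3 \<Rightarrow> real" where
  "tsum a F b G c H f p =
    (\<Sum>k = 1..c. \<Sum>i = 1..a. \<Sum>j = 1..b. f k i j * F i (fst p) * G j (fst (snd p)) * H k (snd (snd p)))"

lemma tsum_cong:
  assumes "\<And>k i j. k \<in> {1..c} \<Longrightarrow> i \<in> {1..a} \<Longrightarrow> j \<in> {1..b} \<Longrightarrow> f k i j = g k i j"
  shows "tsum a F b G c H f p = tsum a F b G c H g p"
  unfolding tsum_def by (intro sum.cong refl) (simp add: assms)

lemma tsum_add: "tsum a F b G c H (\<lambda>k i j. f k i j + g k i j) p = tsum a F b G c H f p + tsum a F b G c H g p"
  by (simp add: tsum_def sum.distrib ring_distribs)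

lemma tsum_diff: "tsum a F b G c H (\<lambda>k i j. f k i j - g k i j) p = tsum a F b G c H f p - tsum a F b G c H g p"
  by (simp add: tsum_def sum_subtractf left_diff_distrib)

lemma tsum_scale: "tsum a F b G c H (\<lambda>k i j. r * f k i j) p = r * tsum a F b G c H f p"
  by (simp add: tsum_def sum_distrib_left mult.assoc)

lemma tsum_zero: "tsum a F b G c H (\<lambda>k i j. 0) p = 0"
  by (simp add: tsum_def)

text \<open>This and the next two regroupings present the sum as a univariate spline in one
  coordinate, with coefficients that depend on the other two; derivatives and independence are then
  inherited from one variable.\<close>

lemma tsum_first: "tsum a F b G c H f (x, y, z)
    = (\<Sum>i = 1..a. (\<Sum>k = 1..c. \<Sum>j = 1..b. f k i j * G j y * H k z) * F i x)"
proof -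
  have "tsum a F b G c H f (x, y, z) = (\<Sum>i = 1..a. \<Sum>k = 1..c. \<Sum>j = 1..b. f k i j * F i x * G j y * H k z)"
    unfolding tsum_def by (subst sum.swap) simp
  then show ?thesis by (simp add: sum_distrib_left sum_distrib_right mult_ac)
qed

lemma tsum_second: "tsum a F b G c H f (x, y, z)
    = (\<Sum>j = 1..b. (\<Sum>k = 1..c. \<Sum>i = 1..a. f k i j * F i x * H k z) * G j y)"
proof -
  have "tsum a F b G c H f (x, y, z) = (\<Sum>k = 1..c. \<Sum>j = 1..b. \<Sum>i = 1..a. f k i j * F i x * G j y * H k z)"
    unfolding tsum_def by (rule sum.cong[OF refl]) (simp, rule sum.swap)
  also have "\<dots> = (\<Sum>j = 1..b. \<Sum>k = 1..c. \<Sum>i = 1..a. f k i j * F i x * G j y * H k z)"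
    by (rule sum.swap)
  finally show ?thesis by (simp add: sum_distrib_left sum_distrib_right mult_ac)
qed

lemma tsum_third: "tsum a F b G c H f (x, y, z)
    = (\<Sum>k = 1..c. (\<Sum>i = 1..a. \<Sum>j = 1..b. f k i j * F i x * G j y) * H k z)"
  unfolding tsum_def by (simp add: sum_distrib_right)

definition independent_on :: "nat \<Rightarrow> real \<Rightarrow> (nat \<Rightarrow> real \<Rightarrow> real) \<Rightarrow> bool" where
  "independent_on n L F \<longleftrightarrow>
    (\<forall>c. (\<forall>x. 0 < x \<longrightarrow> x < L \<longrightarrow> (\<Sum>i = 1..n. c i * F i x) = 0) \<longrightarrow> (\<forall>i \<in> {1..n}. c i = 0))"

lemma independent_onD:
  assumes "independent_on n L F" "\<And>x. 0 < x \<Longrightarrow> x < L \<Longrightarrow> (\<Sum>i = 1..n. c i * F i x) = 0" "i \<in> {1..n}"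
  shows "c i = 0"
  using assms unfolding independent_on_def by blast

text \<open>Coordinates are peeled off one at a time: with the others fixed, the sum is a univariate
  combination whose coefficients must vanish.\<close>

lemma tsum_independent:
  assumes F: "independent_on a R F" and G: "independent_on b S G" and H: "independent_on c T H"
    and 0: "\<And>p. p \<in> Omega_int R S T \<Longrightarrow> tsum a F b G c H f p = 0"
    and "k \<in> {1..c}" "i \<in> {1..a}" "j \<in> {1..b}"
  shows "f k i j = 0"
proof -
  have 1: "(\<Sum>i = 1..a. \<Sum>j = 1..b. f k i j * F i x * G j y) = 0"
    if x: "0 < x" "x < R" "0 < y" "y < S" for x y
  proof (rule independent_onD[OF H, where c = "\<lambda>k. \<Sum>i = 1..a. \<Sum>j = 1..b. f k i j * F i x * G j y"])
    fix z :: real assume "0 < z" "z < T"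
    then have "(x, y, z) \<in> Omega_int R S T" using x by (simp add: Omega_int_def)
    from 0[OF this] show "(\<Sum>k = 1..c. (\<Sum>i = 1..a. \<Sum>j = 1..b. f k i j * F i x * G j y) * H k z) = 0"
      unfolding tsum_third .
  qed fact
  have 2: "(\<Sum>j = 1..b. f k i j * G j y) = 0" if y: "0 < y" "y < S" for y
  proof (rule independent_onD[OF F, where c = "\<lambda>i. \<Sum>j = 1..b. f k i j * G j y"])
    fix x :: real assume "0 < x" "x < R"
    from 1[OF this y] show "(\<Sum>i = 1..a. (\<Sum>j = 1..b. f k i j * G j y) * F i x) = 0"
      by (simp add: sum_distrib_left sum_distrib_right mult_ac)
  qed fact
  show ?thesis by (rule independent_onD[OF G, where c = "f k i"]) (use 2 assms in auto)
qed

context spline_pair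
begin

lemma independent_on_B: "independent_on n L B"
  unfolding independent_on_def using B_independent by blast

lemma independent_on_D: "independent_on m L D"
  unfolding independent_on_def using D_independent by blast

lemma tsum_deriv1:
  assumes "0 < x" "x < L"
  shows "((\<lambda>x. tsum n B b G c H f (x, y, z)) has_real_derivative
    tsum m D b G c H (\<lambda>k i j. f k (nx i) j - f k i j) (x, y, z)) (at x)"
  unfolding tsum_first
  using deriv_sum[OF assms, of "\<lambda>i. \<Sum>k = 1..c. \<Sum>j = 1..b. f k i j * G j y * H k z"]
  by (simp add: left_diff_distrib sum_subtractf)

lemma tsum_deriv2:
  assumes "0 < y" "y < L"
  shows "((\<lambda>y. tsum a F n B c H f (x, y, z)) has_real_derivative
    tsum a F m D c H (\<lambda>k i j. f k i (nx j) - f k i j) (x, y, z)) (at y)"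
  unfolding tsum_second
  using deriv_sum[OF assms, of "\<lambda>j. \<Sum>k = 1..c. \<Sum>i = 1..a. f k i j * F i x * H k z"]
  by (simp add: left_diff_distrib sum_subtractf)

lemma tsum_deriv3:
  assumes "0 < z" "z < L"
  shows "((\<lambda>z. tsum a F b G n B f (x, y, z)) has_real_derivative
    tsum a F b G m D (\<lambda>k i j. f (nx k) i j - f k i j) (x, y, z)) (at z)"
  unfolding tsum_third
  using deriv_sum[OF assms, of "\<lambda>k. \<Sum>i = 1..a. \<Sum>j = 1..b. f k i j * F i x * G j y"]
  by (simp add: left_diff_distrib sum_subtractf)

end

text \<open>Forms are cut off to 0 outside the open box. Near an interior point the cut-off is
  invisible along each coordinate line, so the derivative may be taken of the uncut
  function.\<close>

lemma pd_eqI: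
  assumes fg: "\<And>q. q \<in> Omega_int R S T \<Longrightarrow> f q = g q" and p: "(x, y, z) \<in> Omega_int R S T"
  shows "((\<lambda>x. g (x, y, z)) has_real_derivative d) (at x) \<Longrightarrow> pd1 f (x, y, z) = d"
    and "((\<lambda>y. g (x, y, z)) has_real_derivative d) (at y) \<Longrightarrow> pd2 f (x, y, z) = d"
    and "((\<lambda>z. g (x, y, z)) has_real_derivative d) (at z) \<Longrightarrow> pd3 f (x, y, z) = d"
proof -
  have I: "x \<in> {0<..<R}" "y \<in> {0<..<S}" "z \<in> {0<..<T}" using p by (auto simp: Omega_int_def)
  have e: "eventually (\<lambda>x. x \<in> {0<..<R}) (nhds x)" "eventually (\<lambda>y. y \<in> {0<..<S}) (nhds y)"
    "eventually (\<lambda>z. z \<in> {0<..<T}) (nhds z)"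
    using I by (auto intro!: eventually_nhds_in_open simp del: greaterThanLessThan_iff)
  have "eventually (\<lambda>x. f (x, y, z) = g (x, y, z)) (nhds x)"
    using e(1) by eventually_elim (use I in \<open>auto intro!: fg simp: Omega_int_def\<close>)
  moreover assume "((\<lambda>x. g (x, y, z)) has_real_derivative d) (at x)"
  ultimately have "((\<lambda>x. f (x, y, z)) has_real_derivative d) (at x)"
    by (subst DERIV_cong_ev[OF refl _ refl])
  then show "pd1 f (x, y, z) = d" by (simp add: pd1_def DERIV_imp_deriv)
next
  have I: "x \<in> {0<..<R}" "y \<in> {0<..<S}" "z \<in> {0<..<T}" using p by (auto simp: Omega_int_def)
  then have e: "eventually (\<lambda>y. y \<in> {0<..<S}) (nhds y)" by (intro eventually_nhds_in_open) auto
  have "eventually (\<lambda>y. f (x, y, z) = g (x, y, z)) (nhds y)"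
    using e by eventually_elim (use I in \<open>auto intro!: fg simp: Omega_int_def\<close>)
  moreover assume "((\<lambda>y. g (x, y, z)) has_real_derivative d) (at y)"
  ultimately have "((\<lambda>y. f (x, y, z)) has_real_derivative d) (at y)"
    by (subst DERIV_cong_ev[OF refl _ refl])
  then show "pd2 f (x, y, z) = d" by (simp add: pd2_def DERIV_imp_deriv)
next
  have I: "x \<in> {0<..<R}" "y \<in> {0<..<S}" "z \<in> {0<..<T}" using p by (auto simp: Omega_int_def)
  then have e: "eventually (\<lambda>z. z \<in> {0<..<T}) (nhds z)" by (intro eventually_nhds_in_open) auto
  have "eventually (\<lambda>z. f (x, y, z) = g (x, y, z)) (nhds z)"
    using e by eventually_elim (use I in \<open>auto intro!: fg simp: Omega_int_def\<close>)
  moreover assume "((\<lambda>z. g (x, y, z)) has_real_derivative d) (at z)"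
  ultimately have "((\<lambda>z. f (x, y, z)) has_real_derivative d) (at z)"
    by (subst DERIV_cong_ev[OF refl _ refl])
  then show "pd3 f (x, y, z) = d" by (simp add: pd3_def DERIV_imp_deriv)
qed

lemma cyclic_difference_sum:
  fixes b :: "nat \<Rightarrow> real"
  assumes "1 \<le> n"
  shows "(\<Sum>k = 1..n. b (k mod n + 1) - b k) = 0"
proof -
  have "(\<Sum>k = 1..n. b (k mod n + 1)) = (\<Sum>k = 1..n. b k)"
    by (rule sum.reindex_bij_witness[of _ "\<lambda>k. if k = 1 then n else k - 1" "\<lambda>k. k mod n + 1"])
      (use assms in \<open>auto simp: Suc_le_eq le_less split: if_splits\<close>)
  then show ?thesis by (simp add: sum_subtractf)
qed

text \<open>The mean is the only obstruction: the partial sums of \<open>g\<close> minus its mean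
  return to 0 after a full turn, which settles the wrap-around index \<open>k = n\<close>.\<close>

lemma cyclic_difference_exists:
  fixes g :: "nat \<Rightarrow> real"
  assumes "1 \<le> n"
  obtains b c where "\<And>k. k \<in> {1..n} \<Longrightarrow> g k = b (k mod n + 1) - b k + c"
proof -
  define c where "c = (\<Sum>k = 1..n. g k) / real n"
  define b where "b = (\<lambda>k. \<Sum>l = 1..<k. g l - c)"
  have tot: "(\<Sum>k = 1..n. g k - c) = 0" using assms by (simp add: sum_subtractf c_def)
  have "g k = b (k mod n + 1) - b k + c" if k: "k \<in> {1..n}" for k
  proof (cases "k = n")
    case True
    have "{1..n} = insert n {1..<n}" using assms by auto
    then have "(\<Sum>l = 1..<n. g l - c) + (g n - c) = 0" using tot by simp
    then show ?thesis using True by (simp add: b_def)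
  next
    case False
    then have "k mod n + 1 = Suc k" using k by simp
    then show ?thesis using k by (simp add: b_def)
  qed
  then show ?thesis using that by blast
qed

section \<open>The coefficient complex\<close>

text \<open>The geometry at the pole enters through a linear space \<open>W\<close> of admissible
  angular waves; the span of cos and sin is put in its place later.\<close>

locale torus_complex =
  r: spline_pair nr nr R Br Dr sr +
  s: spline_pair ns ms S Bs Ds Suc +
  t: spline_pair nt nt T Bt Dt "\<lambda>k. k mod nt + 1"
  for nr R Br Dr sr ns ms S Bs Ds nt T Bt Dt +
  fixes W :: "(nat \<Rightarrow> real) set"
  assumes ns_eq: "ns = Suc ms" and ms_pos: "1 \<le> ms" and W_zero: "(\<lambda>i. 0) \<in> W"
    and W_lin: "v \<in> W \<Longrightarrow> w \<in> W \<Longrightarrow> (\<lambda>i. a * v i + b * w i) \<in> W"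
begin

abbreviation "Om \<equiv> Omega_int R S T"

definition d1 :: "(nat \<Rightarrow> nat \<Rightarrow> nat \<Rightarrow> real) \<Rightarrow> nat \<Rightarrow> nat \<Rightarrow> nat \<Rightarrow> real" where
  "d1 f k i j = f k (sr i) j - f k i j"
definition d2 :: "(nat \<Rightarrow> nat \<Rightarrow> nat \<Rightarrow> real) \<Rightarrow> nat \<Rightarrow> nat \<Rightarrow> nat \<Rightarrow> real" where
  "d2 f k i j = f k i (Suc j) - f k i j"
definition d3 :: "(nat \<Rightarrow> nat \<Rightarrow> nat \<Rightarrow> real) \<Rightarrow> nat \<Rightarrow> nat \<Rightarrow> nat \<Rightarrow> real" where
  "d3 f k i j = f (k mod nt + 1) i j - f k i j"

definition "form0 f = restr Om (tsum nr Br ns Bs nt Bt f)"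
definition "form1 g h f = restr Om (\<lambda>p.
  (tsum nr Dr ns Bs nt Bt g p, tsum nr Br ms Ds nt Bt h p, tsum nr Br ns Bs nt Dt f p))"
text \<open>The minus sign is that of \<open>N101\<close>. With it \<open>(g, h)\<close> obeys the
  same pole condition in 2-forms as in 1-forms, and the curl sends it to the planar gradient of
  \<open>f\<close> minus the t-difference of \<open>(g, h)\<close>.\<close>

definition "form2 h g w = restr Om (\<lambda>p.
  (tsum nr Br ms Ds nt Dt h p, - tsum nr Dr ns Bs nt Dt g p, tsum nr Dr ms Ds nt Bt w p))"
definition "form3 w = restr Om (tsum nr Dr ms Ds nt Dt w)"

text \<open>Coefficient arrays are total functions, but a form sees only the entries in range;
  \<open>b\<close> is the number of functions in the s-direction, \<open>ns\<close> or
  \<open>ms\<close>.\<close>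

definition agree :: "nat \<Rightarrow> (nat \<Rightarrow> nat \<Rightarrow> nat \<Rightarrow> real) \<Rightarrow> (nat \<Rightarrow> nat \<Rightarrow> nat \<Rightarrow> real) \<Rightarrow> bool" where
  "agree b f g \<longleftrightarrow> (\<forall>k \<in> {1..nt}. \<forall>i \<in> {1..nr}. \<forall>j \<in> {1..b}. f k i j = g k i j)"

lemma agreeD: "agree b f g \<Longrightarrow> k \<in> {1..nt} \<Longrightarrow> i \<in> {1..nr} \<Longrightarrow> j \<in> {1..b} \<Longrightarrow> f k i j = g k i j"
  by (simp add: agree_def)

lemma tsum_agree: "agree b f g \<Longrightarrow> tsum nr F b G nt H f p = tsum nr F b G nt H g p"
  by (rule tsum_cong) (simp add: agree_def)

lemma form0_cong: "agree ns f f' \<Longrightarrow> form0 f = form0 f'"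
  by (simp add: form0_def restr_def fun_eq_iff tsum_agree[of ns f f'])

lemma form1_cong:
  assumes "agree ns g g'" "agree ms h h'" "agree ns f f'"
  shows "form1 g h f = form1 g' h' f'"
  by (simp add: form1_def restr_def fun_eq_iff assms[THEN tsum_agree])

lemma form2_cong:
  assumes "agree ms h h'" "agree ns g g'" "agree ms w w'"
  shows "form2 h g w = form2 h' g' w'"
  by (simp add: form2_def restr_def fun_eq_iff assms[THEN tsum_agree])

lemma form3_cong: "agree ms w w' \<Longrightarrow> form3 w = form3 w'"
  by (simp add: form3_def restr_def fun_eq_iff tsum_agree[of ms w w'])

lemma tsum_zero_agree:
  assumes "independent_on nr R F" "independent_on b S G" "independent_on nt T H"
    and "\<And>p. p \<in> Om \<Longrightarrow> tsum nr F b G nt H f p = 0"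
  shows "agree b f (\<lambda>k i j. 0)"
  unfolding agree_def using tsum_independent[OF assms] by blast

lemmas independent_families = r.independent_on_B r.independent_on_D s.independent_on_B s.independent_on_D
  t.independent_on_B t.independent_on_D

lemma restr_eq_0: "restr A F = 0 \<Longrightarrow> p \<in> A \<Longrightarrow> F p = 0"
  by (metis restr_def zero_fun_apply)

lemma form1_eq_0:
  assumes "form1 g h f = 0"
  shows "agree ns g (\<lambda>k i j. 0)" "agree ms h (\<lambda>k i j. 0)" "agree ns f (\<lambda>k i j. 0)"
proof -
  have z: "tsum nr Dr ns Bs nt Bt g p = 0" "tsum nr Br ms Ds nt Bt h p = 0" "tsum nr Br ns Bs nt Dt f p = 0"
    if "p \<in> Om" for p
    using restr_eq_0[OF assms[unfolded form1_def] that] by (simp_all add: zero_prod_def)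
  show "agree ns g (\<lambda>k i j. 0)" by (rule tsum_zero_agree[OF independent_families(2) independent_families(3) independent_families(5)]) (rule z)
  show "agree ms h (\<lambda>k i j. 0)" by (rule tsum_zero_agree[OF independent_families(1) independent_families(4) independent_families(5)]) (rule z)
  show "agree ns f (\<lambda>k i j. 0)" by (rule tsum_zero_agree[OF independent_families(1) independent_families(3) independent_families(6)]) (rule z)
qed

lemma form2_eq_0:
  assumes "form2 h g w = 0"
  shows "agree ms h (\<lambda>k i j. 0)" "agree ns g (\<lambda>k i j. 0)" "agree ms w (\<lambda>k i j. 0)"
proof -
  have z: "tsum nr Br ms Ds nt Dt h p = 0" "tsum nr Dr ns Bs nt Dt g p = 0" "tsum nr Dr ms Ds nt Bt w p = 0"
    if "p \<in> Om" for p
    using restr_eq_0[OF assms[unfolded form2_def] that] by (simp_all add: zero_prod_def)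
  show "agree ms h (\<lambda>k i j. 0)" by (rule tsum_zero_agree[OF independent_families(1) independent_families(4) independent_families(6)]) (rule z)
  show "agree ns g (\<lambda>k i j. 0)" by (rule tsum_zero_agree[OF independent_families(2) independent_families(3) independent_families(6)]) (rule z)
  show "agree ms w (\<lambda>k i j. 0)" by (rule tsum_zero_agree[OF independent_families(2) independent_families(4) independent_families(5)]) (rule z)
qed

lemma form3_eq_0:
  assumes "form3 w = 0"
  shows "agree ms w (\<lambda>k i j. 0)"
  by (rule tsum_zero_agree[OF independent_families(2) independent_families(4) independent_families(6)]) (rule restr_eq_0[OF assms[unfolded form3_def]])

lemma form_zero:
  "form1 (\<lambda>k i j. 0) (\<lambda>k i j. 0) (\<lambda>k i j. 0) = 0"
  "form2 (\<lambda>k i j. 0) (\<lambda>k i j. 0) (\<lambda>k i j. 0) = 0" "form3 (\<lambda>k i j. 0) = 0"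
  by (auto simp: form1_def form2_def form3_def tsum_zero restr_def fun_eq_iff zero_prod_def)

lemma grad_form0: "grad3 R S T (form0 f) = form1 (d1 f) (d2 f) (d3 f)"
proof
  fix p :: pt3
  obtain x y z where p: "p = (x, y, z)" by (cases p)
  show "grad3 R S T (form0 f) p = form1 (d1 f) (d2 f) (d3 f) p"
  proof (cases "p \<in> Om")
    case True
    have e: "form0 f q = tsum nr Br ns Bs nt Bt f q" if "q \<in> Om" for q
      using that by (simp add: form0_def restr_def)
    have I: "0 < x" "x < R" "0 < y" "y < S" "0 < z" "z < T" using True by (auto simp: p Omega_int_def)
    note pd = pd_eqI[of R S T "form0 f" "tsum nr Br ns Bs nt Bt f", OF e True[unfolded p]]
    have "pd1 (form0 f) p = tsum nr Dr ns Bs nt Bt (d1 f) p"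
      unfolding p by (rule pd(1)) (use I r.tsum_deriv1 in \<open>simp_all add: d1_def[abs_def]\<close>)
    moreover have "pd2 (form0 f) p = tsum nr Br ms Ds nt Bt (d2 f) p"
      unfolding p by (rule pd(2)) (use I s.tsum_deriv2 in \<open>simp_all add: d2_def[abs_def]\<close>)
    moreover have "pd3 (form0 f) p = tsum nr Br ns Bs nt Dt (d3 f) p"
      unfolding p by (rule pd(3)) (use I t.tsum_deriv3 in \<open>simp_all add: d3_def[abs_def]\<close>)
    ultimately show ?thesis using True by (simp add: grad3_def restr_def form1_def)
  qed (simp add: grad3_def restr_def form1_def)
qed

lemma curl_form1:
  "curl3 R S T (form1 g h f) = form2 (\<lambda>k i j. d2 f k i j - d3 h k i j)
     (\<lambda>k i j. d1 f k i j - d3 g k i j) (\<lambda>k i j. d1 h k i j - d2 g k i j)"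
  (is "_ = ?rhs")
proof
  fix p :: pt3
  obtain x y z where p: "p = (x, y, z)" by (cases p)
  let ?F = "form1 g h f"
  show "curl3 R S T ?F p = ?rhs p"
  proof (cases "p \<in> Om")
    case True
    have I: "0 < x" "x < R" "0 < y" "y < S" "0 < z" "z < T" using True by (auto simp: p Omega_int_def)
    have e: "comp1 ?F q = tsum nr Dr ns Bs nt Bt g q" "comp2 ?F q = tsum nr Br ms Ds nt Bt h q"
      "comp3 ?F q = tsum nr Br ns Bs nt Dt f q" if "q \<in> Om" for q
      using that by (simp_all add: form1_def restr_def comp1_def comp2_def comp3_def)
    note pdc1 = pd_eqI[of R S T "comp1 ?F" "tsum nr Dr ns Bs nt Bt g", OF e(1) True[unfolded p]]
    note pdc2 = pd_eqI[of R S T "comp2 ?F" "tsum nr Br ms Ds nt Bt h", OF e(2) True[unfolded p]]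
    note pdc3 = pd_eqI[of R S T "comp3 ?F" "tsum nr Br ns Bs nt Dt f", OF e(3) True[unfolded p]]
    have "pd2 (comp1 ?F) p = tsum nr Dr ms Ds nt Bt (d2 g) p"
      unfolding p by (rule pdc1(2)) (use I s.tsum_deriv2 in \<open>simp_all add: d2_def[abs_def]\<close>)
    moreover have "pd3 (comp1 ?F) p = tsum nr Dr ns Bs nt Dt (d3 g) p"
      unfolding p by (rule pdc1(3)) (use I t.tsum_deriv3 in \<open>simp_all add: d3_def[abs_def]\<close>)
    moreover have "pd1 (comp2 ?F) p = tsum nr Dr ms Ds nt Bt (d1 h) p"
      unfolding p by (rule pdc2(1)) (use I r.tsum_deriv1 in \<open>simp_all add: d1_def[abs_def]\<close>)
    moreover have "pd3 (comp2 ?F) p = tsum nr Br ms Ds nt Dt (d3 h) p"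
      unfolding p by (rule pdc2(3)) (use I t.tsum_deriv3 in \<open>simp_all add: d3_def[abs_def]\<close>)
    moreover have "pd1 (comp3 ?F) p = tsum nr Dr ns Bs nt Dt (d1 f) p"
      unfolding p by (rule pdc3(1)) (use I r.tsum_deriv1 in \<open>simp_all add: d1_def[abs_def]\<close>)
    moreover have "pd2 (comp3 ?F) p = tsum nr Br ms Ds nt Dt (d2 f) p"
      unfolding p by (rule pdc3(2)) (use I s.tsum_deriv2 in \<open>simp_all add: d2_def[abs_def]\<close>)
    ultimately show ?thesis using True by (simp add: curl3_def restr_def form2_def tsum_diff)
  qed (simp add: curl3_def restr_def form2_def)
qed

lemma div_form2:
  "div3 R S T (form2 h g w) = form3 (\<lambda>k i j. d1 h k i j - d2 g k i j + d3 w k i j)"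
  (is "_ = ?rhs")
proof
  fix p :: pt3
  obtain x y z where p: "p = (x, y, z)" by (cases p)
  let ?F = "form2 h g w"
  show "div3 R S T ?F p = ?rhs p"
  proof (cases "p \<in> Om")
    case True
    have I: "0 < x" "x < R" "0 < y" "y < S" "0 < z" "z < T" using True by (auto simp: p Omega_int_def)
    have e: "comp1 ?F q = tsum nr Br ms Ds nt Dt h q" "comp2 ?F q = - tsum nr Dr ns Bs nt Dt g q"
      "comp3 ?F q = tsum nr Dr ms Ds nt Bt w q" if "q \<in> Om" for q
      using that by (simp_all add: form2_def restr_def comp1_def comp2_def comp3_def)
    note pdc1 = pd_eqI[of R S T "comp1 ?F" "tsum nr Br ms Ds nt Dt h", OF e(1) True[unfolded p]]
    note pdc2 = pd_eqI[of R S T "comp2 ?F" "\<lambda>q. - tsum nr Dr ns Bs nt Dt g q", OF e(2) True[unfolded p]]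
    note pdc3 = pd_eqI[of R S T "comp3 ?F" "tsum nr Dr ms Ds nt Bt w", OF e(3) True[unfolded p]]
    have "pd1 (comp1 ?F) p = tsum nr Dr ms Ds nt Dt (d1 h) p"
      unfolding p by (rule pdc1(1)) (use I r.tsum_deriv1 in \<open>simp_all add: d1_def[abs_def]\<close>)
    moreover have "pd2 (comp2 ?F) p = - tsum nr Dr ms Ds nt Dt (d2 g) p"
      unfolding p by (rule pdc2(2), simp, rule DERIV_minus) (use I s.tsum_deriv2 in \<open>simp_all add: d2_def[abs_def]\<close>)
    moreover have "pd3 (comp3 ?F) p = tsum nr Dr ms Ds nt Dt (d3 w) p"
      unfolding p by (rule pdc3(3)) (use I t.tsum_deriv3 in \<open>simp_all add: d3_def[abs_def]\<close>)
    ultimately show ?thesis using True by (simp add: div3_def restr_def form3_def tsum_diff tsum_add)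
  qed (simp add: div3_def restr_def form3_def)
qed

section \<open>Coefficient spaces with pole conditions\<close>

definition C0 :: "(nat \<Rightarrow> nat \<Rightarrow> nat \<Rightarrow> real) set" where
  "C0 = {f. \<forall>k \<in> {1..nt}. \<exists>A. \<exists>w \<in> W. \<forall>i \<in> {1..nr}. f k i 1 = A \<and> f k i 2 = A + w i}"

text \<open>One wave prescribes \<open>h\<close> on the first ring and, through its angular
  difference, \<open>g\<close> on the second. This coupling makes the rotation vanish on the first
  ring, as \<open>C2\<close> demands.\<close>

definition C1 :: "((nat \<Rightarrow> nat \<Rightarrow> nat \<Rightarrow> real) \<times> (nat \<Rightarrow> nat \<Rightarrow> nat \<Rightarrow> real)) set" where
  "C1 = {(g, h). \<forall>k \<in> {1..nt}. \<exists>w \<in> W. \<forall>i \<in> {1..nr}.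
     g k i 1 = 0 \<and> g k i 2 = w (sr i) - w i \<and> h k i 1 = w i}"

definition C2 :: "(nat \<Rightarrow> nat \<Rightarrow> nat \<Rightarrow> real) set" where
  "C2 = {w. \<forall>k \<in> {1..nt}. \<forall>i \<in> {1..nr}. w k i 1 = 0}"

text \<open>Coefficient versions of the four spline spaces; \<open>U0_eq\<close> to
  \<open>U3_eq\<close> identify them with the spans of the matrix rows.\<close>

definition "U0 = form0 ` C0"
definition "U1 = {form1 g h f | g h f. (g, h) \<in> C1 \<and> f \<in> C0}"
definition "U2 = {form2 h g w | h g w. (g, h) \<in> C1 \<and> w \<in> C2}"
definition "U3 = form3 ` C2"

lemma nt_shift: "k \<in> {1..nt} \<Longrightarrow> k mod nt + 1 \<in> {1..nt}"
  by (rule t.nx_range)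

lemma C0_lin:
  assumes "f \<in> C0" "f' \<in> C0"
  shows "(\<lambda>k i j. a * f k i j + b * f' k i j) \<in> C0"
  unfolding C0_def
proof (rule CollectI, rule ballI)
  fix k assume "k \<in> {1..nt}"
  with assms obtain A w A' w' where "w \<in> W" "\<forall>i\<in>{1..nr}. f k i 1 = A \<and> f k i 2 = A + w i"
    "w' \<in> W" "\<forall>i\<in>{1..nr}. f' k i 1 = A' \<and> f' k i 2 = A' + w' i"
    unfolding C0_def by blast
  then show "\<exists>A. \<exists>w \<in> W. \<forall>i \<in> {1..nr}. a * f k i 1 + b * f' k i 1 = A \<and> a * f k i 2 + b * f' k i 2 = A + w i"
    by (intro exI[of _ "a * A + b * A'"] bexI[OF _ W_lin[of w w' a b]]) (auto simp: algebra_simps)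
qed

lemma C1_lin:
  assumes "(g, h) \<in> C1" "(g', h') \<in> C1"
  shows "(\<lambda>k i j. a * g k i j + b * g' k i j, \<lambda>k i j. a * h k i j + b * h' k i j) \<in> C1"
  unfolding C1_def
proof (rule CollectI, rule case_prodI, rule ballI)
  fix k assume "k \<in> {1..nt}"
  with assms obtain w w' where
    "w \<in> W" "\<forall>i\<in>{1..nr}. g k i 1 = 0 \<and> g k i 2 = w (sr i) - w i \<and> h k i 1 = w i"
    "w' \<in> W" "\<forall>i\<in>{1..nr}. g' k i 1 = 0 \<and> g' k i 2 = w' (sr i) - w' i \<and> h' k i 1 = w' i"
    unfolding C1_def by blast
  then show "\<exists>w\<in>W. \<forall>i\<in>{1..nr}. a * g k i 1 + b * g' k i 1 = 0 \<and>
      a * g k i 2 + b * g' k i 2 = w (sr i) - w i \<and> a * h k i 1 + b * h' k i 1 = w i"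
    by (intro bexI[OF _ W_lin[of w w' a b]]) (auto simp: right_diff_distrib)
qed

lemma C0_shift: "f \<in> C0 \<Longrightarrow> (\<lambda>k. f (k mod nt + 1)) \<in> C0"
  using nt_shift unfolding C0_def by blast

lemma C1_shift: "(g, h) \<in> C1 \<Longrightarrow> (\<lambda>k. g (k mod nt + 1), \<lambda>k. h (k mod nt + 1)) \<in> C1"
  using nt_shift unfolding C1_def by blast

lemma C0_d3: "f \<in> C0 \<Longrightarrow> d3 f \<in> C0"
  using C0_lin[OF C0_shift, of f f 1 "-1"] by (simp add: d3_def[abs_def])

lemma C1_d3: "(g, h) \<in> C1 \<Longrightarrow> (d3 g, d3 h) \<in> C1"
  using C1_lin[OF C1_shift, of g h g h 1 "-1"] by (simp add: d3_def[abs_def])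

lemma C0_const: "(\<lambda>k i j. c k) \<in> C0"
  unfolding C0_def using W_zero by (auto intro!: bexI[of _ "\<lambda>i. 0"])

lemma C0_grad: 
  assumes "f \<in> C0"
  shows "(d1 f, d2 f) \<in> C1"
  unfolding C1_def
proof (rule CollectI, rule case_prodI, rule ballI)
  fix k assume "k \<in> {1..nt}"
  with assms obtain A w where "w \<in> W" "\<forall>i\<in>{1..nr}. f k i 1 = A \<and> f k i 2 = A + w i"
    unfolding C0_def by blast
  then show "\<exists>w\<in>W. \<forall>i\<in>{1..nr}. d1 f k i 1 = 0 \<and> d1 f k i 2 = w (sr i) - w i \<and> d2 f k i 1 = w i"
    using r.nx_range by (intro bexI[of _ w]) (auto simp: d1_def d2_def numeral_2_eq_2)
qed

lemma C1_rot: 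
  assumes "(g, h) \<in> C1"
  shows "(\<lambda>k i j. d1 h k i j - d2 g k i j) \<in> C2"
  unfolding C2_def
proof (rule CollectI, intro ballI)
  fix k i assume "k \<in> {1..nt}" and i: "i \<in> {1..nr}"
  with assms obtain w where "\<forall>i\<in>{1..nr}. g k i 1 = 0 \<and> g k i 2 = w (sr i) - w i \<and> h k i 1 = w i"
    unfolding C1_def by blast
  with i r.nx_range[OF i] show "d1 h k i 1 - d2 g k i 1 = 0"
    by (auto simp: d1_def d2_def numeral_2_eq_2)
qed

text \<open>The potential is normalised to 0 at the pole and equals the wave of \<open>h\<close> on
  the second ring, which puts it into \<open>C0\<close>. Its angular difference telescopes to
  \<open>g\<close> minus the pole value of \<open>g\<close>, and that value is 0: no angular period
  can obstruct.\<close>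

lemma C1_potential:
  assumes C: "(g, h) \<in> C1" and rot: "agree ms (d1 h) (d2 g)"
  obtains a where "a \<in> C0" "agree ns (d1 a) g" "agree ms (d2 a) h"
proof -
  define a where "a = (\<lambda>k i j. \<Sum>l = 1..<j. h k i l)"
  have "a \<in> C0"
    unfolding C0_def
  proof (rule CollectI, rule ballI)
    fix k assume "k \<in> {1..nt}"
    with C obtain w where "w \<in> W" "\<forall>i\<in>{1..nr}. g k i 1 = 0 \<and> g k i 2 = w (sr i) - w i \<and> h k i 1 = w i"
      unfolding C1_def by blast
    then show "\<exists>A. \<exists>w \<in> W. \<forall>i \<in> {1..nr}. a k i 1 = A \<and> a k i 2 = A + w i"
      by (intro exI[of _ 0] bexI[of _ w]) (auto simp: a_def numeral_2_eq_2)
  qed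
  moreover have "agree ms (d2 a) h" by (auto simp: agree_def d2_def a_def)
  moreover have "agree ns (d1 a) g"
    unfolding agree_def
  proof (intro ballI)
    fix k i j assume k: "k \<in> {1..nt}" and i: "i \<in> {1..nr}" and j: "j \<in> {1..ns}"
    have g1: "g k i 1 = 0" using C k i unfolding C1_def by blast
    have "d1 a k i j = (\<Sum>l = 1..<j. d1 h k i l)" by (simp add: d1_def a_def sum_subtractf)
    also have "\<dots> = (\<Sum>l = 1..<j. g k i (Suc l) - g k i l)"
      by (intro sum.cong refl) (use agreeD[OF rot k i] j ns_eq in \<open>auto simp: d2_def\<close>)
    also have "\<dots> = g k i j - g k i 1" using j by (intro sum_Suc_diff') auto
    finally show "d1 a k i j = g k i j" using g1 by simp
  qed
  ultimately show ?thesis using that by blast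
qed

text \<open>Integration outwards with zero wave: on the first ring the sum is empty, on the second
  it is the pole value of \<open>w\<close>, which is 0. The bound \<open>j \<ge> 1\<close> excludes
  index 0, where both sums are empty.\<close>

lemma C2_primitive:
  assumes "w \<in> C2"
  obtains g where "(g, \<lambda>k i j. 0) \<in> C1" "\<And>k i j. j \<ge> 1 \<Longrightarrow> d2 g k i j = - w k i j"
proof -
  define g where "g = (\<lambda>k i j. - (\<Sum>l = 1..<j. w k i l))"
  have "(g, \<lambda>k i j. 0) \<in> C1"
    unfolding C1_def using assms W_zero
    by (auto simp: C2_def g_def numeral_2_eq_2 intro!: bexI[of _ "\<lambda>i. 0"])
  moreover have "d2 g k i j = - w k i j" if "j \<ge> 1" for k i j using that by (simp add: d2_def g_def)
  ultimately show ?thesis using that by blast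
qed

section \<open>Cohomology in degree 0: constants\<close>

lemma one_apply: "p \<in> Om \<Longrightarrow> form0 (\<lambda>k i j. c) p = c"
proof -
  assume p: "p \<in> Om"
  obtain x y z where xyz: "p = (x, y, z)" by (cases p)
  have "form0 (\<lambda>k i j. c) p = (\<Sum>k = 1..nt. (\<Sum>i = 1..nr. (\<Sum>j = 1..ns. Bs j y) * Br i x) * Bt k z) * c"
    using p unfolding form0_def xyz restr_def tsum_third
    by (simp add: sum_distrib_left sum_distrib_right mult_ac)
  also have "\<dots> = c" using p r.unity s.unity t.unity by (simp add: xyz Omega_int_def)
  finally show ?thesis .
qed

lemma Om_nonempty: "Om \<noteq> {}"
proof -
  have "(R / 2, S / 2, T / 2) \<in> Om" using r.L_pos s.L_pos t.L_pos by (simp add: Omega_int_def)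
  then show ?thesis by blast
qed

lemma form0_ker:
  assumes "f \<in> C0" "grad3 R S T (form0 f) = 0"
  shows "form0 f = form0 (\<lambda>k i j. f 1 1 1)"
proof (rule form0_cong)
  note z = form1_eq_0[OF assms(2)[unfolded grad_form0]]
  show "agree ns f (\<lambda>k i j. f 1 1 1)"
    unfolding agree_def
  proof (intro ballI)
    fix k i j assume k: "k \<in> {1..nt}" and i: "i \<in> {1..nr}" and j: "j \<in> {1..ns}"
    have "f k i j = f k i 1"
      using agreeD[OF z(2) k i] by (intro s.nx_connected[of "f k i", OF _ j]) (auto simp: d2_def)
    also have "\<dots> = f k 1 1"
      using agreeD[OF z(1) k, of _ 1] ns_eq by (intro r.nx_connected[of "\<lambda>i. f k i 1", OF _ i]) (auto simp: d1_def)
    also have "\<dots> = f 1 1 1"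
      using agreeD[OF z(3), of _ 1 1] ns_eq r.n_pos by (intro t.nx_connected[of "\<lambda>k. f k 1 1", OF _ k]) (auto simp: d3_def)
    finally show "f k i j = f 1 1 1" .
  qed
qed

lemma cohom_dim_0: "cohom_dim {0} U0 (grad3 R S T) = 1"
proof -
  let ?e = "form0 (\<lambda>k i j. 1)"
  have const: "form0 (\<lambda>k i j. c) = fscale c ?e" for c
    by (rule ext) (use one_apply in \<open>auto simp: fscale_def form0_def restr_def\<close>)
  have "{f \<in> U0. grad3 R S T f = 0} = fspan {?e}"
  proof (intro equalityI subsetI)
    fix u assume "u \<in> {f \<in> U0. grad3 R S T f = 0}"
    then obtain f where "f \<in> C0" "u = form0 f" "grad3 R S T (form0 f) = 0" by (auto simp: U0_def)
    then have "u = fscale (f 1 1 1) ?e" using form0_ker const by metis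
    then show "u \<in> fspan {?e}" by (simp add: fun_vs.span_base fun_vs.span_scale)
  next
    fix u assume "u \<in> fspan {?e}"
    then obtain c where "u = fscale c ?e" unfolding fun_vs.span_singleton by auto
    then have u: "u = form0 (\<lambda>k i j. c)" by (simp only: const[of c])
    have "grad3 R S T u = 0"
      unfolding u grad_form0 d1_def[abs_def] d2_def[abs_def] d3_def[abs_def] by (simp add: form_zero)
    then show "u \<in> {f \<in> U0. grad3 R S T f = 0}" using C0_const[of "\<lambda>k. c"] by (auto simp: u U0_def)
  qed
  moreover obtain p where "p \<in> Om" using Om_nonempty by blast
  then have "?e p \<noteq> 0" using one_apply[of p 1] by simp
  then have "?e \<noteq> 0" by (metis zero_fun_apply)
  then have "fdim (fspan {?e}) = 1"
    using fun_vs.dim_span_eq_card_independent[of "{?e}"] by (simp add: fun_vs.dependent_single)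
  moreover have "fdim ({0} :: (pt3 \<Rightarrow> real) set) = 0"
    using fun_vs.dim_span_eq_card_independent[of "{}"] fun_vs.span_empty fun_vs.independent_empty by simp
  ultimately show ?thesis by (simp add: cohom_dim_def)
qed

section \<open>Cohomology in degree 1\<close>

lemma form1_lin: "fscale a (form1 g h f) + fscale b (form1 g' h' f')
   = form1 (\<lambda>k i j. a * g k i j + b * g' k i j) (\<lambda>k i j. a * h k i j + b * h' k i j)
       (\<lambda>k i j. a * f k i j + b * f' k i j)"
  by (rule ext) (simp add: form1_def restr_def fscale_def tsum_add tsum_scale)

text \<open>Linearity is read off the coefficients, where it is plain; for \<open>deriv\<close>
  itself it would require differentiability each time.\<close>

lemma grad_lin:
  "fscale a (grad3 R S T (form0 f)) + fscale b (grad3 R S T (form0 f'))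
   = grad3 R S T (form0 (\<lambda>k i j. a * f k i j + b * f' k i j))"
  unfolding grad_form0 form1_lin
  by (intro form1_cong) (auto simp: agree_def d1_def d2_def d3_def algebra_simps)

lemma grad_subspace: "fun_vs.subspace (grad3 R S T ` U0)"
proof (rule fun_vs.subspaceI)
  have "grad3 R S T (form0 (\<lambda>k i j. 0)) = 0"
    unfolding grad_form0 d1_def[abs_def] d2_def[abs_def] d3_def[abs_def] by (simp add: form_zero)
  then show "0 \<in> grad3 R S T ` U0" using C0_const[of "\<lambda>_. 0"] unfolding U0_def by (metis image_eqI)
next
  fix u v assume "u \<in> grad3 R S T ` U0" "v \<in> grad3 R S T ` U0"
  then obtain f f' where "f \<in> C0" "f' \<in> C0" "u = grad3 R S T (form0 f)" "v = grad3 R S T (form0 f')"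
    by (auto simp: U0_def)
  then show "u + v \<in> grad3 R S T ` U0"
    using grad_lin[of 1 f 1 f'] C0_lin[of f f' 1 1] by (auto simp: U0_def)
next
  fix c u assume "u \<in> grad3 R S T ` U0"
  then obtain f where "f \<in> C0" "u = grad3 R S T (form0 f)" by (auto simp: U0_def)
  then show "fscale c u \<in> grad3 R S T ` U0"
    using grad_lin[of c f 0 f] C0_lin[of f f c 0] by (auto simp: U0_def)
qed

text \<open>Forward differences in different directions commute, which is the vanishing of curl grad
  on coefficients.\<close>

lemma grad_U0: "grad3 R S T ` U0 \<subseteq> {F \<in> U1. curl3 R S T F = 0}"
proof
  fix u assume "u \<in> grad3 R S T ` U0"
  then obtain f where f: "f \<in> C0" "u = form1 (d1 f) (d2 f) (d3 f)" by (auto simp: U0_def grad_form0)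
  have "curl3 R S T u = form2 (\<lambda>k i j. 0) (\<lambda>k i j. 0) (\<lambda>k i j. 0)"
    unfolding f curl_form1
    by (intro form2_cong) (auto simp: agree_def d1_def d2_def d3_def)
  then show "u \<in> {F \<in> U1. curl3 R S T F = 0}"
    using f C0_grad[OF f(1)] C0_d3[OF f(1)] by (auto simp: U1_def form_zero)
qed

text \<open>The kernel is the image plus the line through \<open>e\<close>, the 1-form in the
  t-direction with all coefficients 1. The finite set \<open>F\<close> supplies finite
  dimension.\<close>

lemma cohom_dim_1:
  assumes "U1 \<subseteq> fspan F" "finite F"
  shows "cohom_dim (grad3 R S T ` U0) U1 (curl3 R S T) = 1"
proof -
  define e where "e = form1 (\<lambda>k i j. 0) (\<lambda>k i j. 0) (\<lambda>k i j. 1)"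
  let ?K = "{F \<in> U1. curl3 R S T F = 0}"
  \<comment> \<open>A potential of \<open>e\<close> would grow by 1 at every step around the
    t-circle, whereas cyclic differences add up to 0.\<close>
  have "e \<notin> grad3 R S T ` U0"
  proof
    assume "e \<in> grad3 R S T ` U0"
    then obtain f where "form1 (d1 f) (d2 f) (d3 f) = e" by (auto simp: U0_def grad_form0)
    then have "fscale 1 (form1 (d1 f) (d2 f) (d3 f)) + fscale (-1) e = 0"
      by (simp add: fscale_def fun_eq_iff)
    then have "agree ns (\<lambda>k i j. 1 * d3 f k i j + - 1 * 1) (\<lambda>k i j. 0)"
      unfolding e_def form1_lin by (rule form1_eq_0(3))
    from agreeD[OF this, of _ 1 1] have "f (k mod nt + 1) 1 1 - f k 1 1 = 1" if "k \<in> {1..nt}" for k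
      using that r.n_pos ns_eq by (simp add: d3_def)
    then have "(\<Sum>k = 1..nt. f (k mod nt + 1) 1 1 - f k 1 1) = real nt" by simp
    then show False using cyclic_difference_sum[OF t.n_pos, of "\<lambda>k. f k 1 1"] t.n_pos by simp
  qed
  moreover have "?K = fspan (insert e (grad3 R S T ` U0))"
  proof
    show "?K \<subseteq> fspan (insert e (grad3 R S T ` U0))"
    proof
      fix u assume "u \<in> ?K"
      then obtain g h f where C: "(g, h) \<in> C1" "f \<in> C0" and u: "u = form1 g h f"
        and curl: "curl3 R S T (form1 g h f) = 0" by (auto simp: U1_def)
      note z = form2_eq_0[OF curl[unfolded curl_form1]]
      have "agree ms (d1 h) (d2 g)" using z(3) by (auto simp: agree_def)
      then obtain a where a: "a \<in> C0" "agree ns (d1 a) g" "agree ms (d2 a) h"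
        using C1_potential[OF C(1)] by blast
      \<comment> \<open>What the layerwise potential leaves of the t-component, with explicit
        factors to fit \<open>C0_lin\<close>; it depends on \<open>k\<close> only.\<close>
      define c where "c = (\<lambda>k i j. 1 * f k i j + - 1 * d3 a k i j)"
      have "c \<in> C0" unfolding c_def by (intro C0_lin C C0_d3 a)
      have c: "c k i j = c k 1 1" if k: "k \<in> {1..nt}" and i: "i \<in> {1..nr}" and j: "j \<in> {1..ns}" for k i j
      proof -
        have "c k i j = c k i 1"
        proof (rule s.nx_connected[of "c k i", OF _ j])
          fix j assume j: "j \<in> {1..ms}"
          have "d2 f k i j = d3 h k i j" using agreeD[OF z(1) k i j] by simp
          also have "\<dots> = d3 (d2 a) k i j"
            using agreeD[OF a(3) k i j] agreeD[OF a(3) nt_shift[OF k] i j] by (simp add: d3_def)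
          finally show "c k i (Suc j) = c k i j" by (simp add: c_def d2_def d3_def)
        qed
        \<comment> \<open>At the pole, membership in \<open>C0\<close> makes the coefficients equal
          in \<open>i\<close>.\<close>
        also have "\<dots> = c k 1 1"
        proof -
          obtain A w where "\<forall>i\<in>{1..nr}. c k i 1 = A \<and> c k i 2 = A + w i"
            using \<open>c \<in> C0\<close> k unfolding C0_def by blast
          then show ?thesis using i r.n_pos by simp
        qed
        finally show ?thesis .
      qed
      obtain b m where b: "\<And>k. k \<in> {1..nt} \<Longrightarrow> c k 1 1 = b (k mod nt + 1) - b k + m"
        using cyclic_difference_exists[OF t.n_pos, of "\<lambda>k. c k 1 1"] by blast
      \<comment> \<open>A summand constant on each layer leaves \<open>d1\<close> and
        \<open>d2\<close> of the potential unchanged and absorbs the cyclic difference in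
        \<open>c\<close>.\<close>
      define q where "q = (\<lambda>k i j. 1 * a k i j + 1 * b k)"
      have "q \<in> C0" unfolding q_def by (intro C0_lin a C0_const)
      have "u = fscale 1 (form1 (d1 q) (d2 q) (d3 q)) + fscale m e"
        unfolding u e_def form1_lin
      proof (rule form1_cong)
        show "agree ns g (\<lambda>k i j. 1 * d1 q k i j + m * 0)"
          using a(2) by (auto simp: agree_def q_def d1_def)
        show "agree ms h (\<lambda>k i j. 1 * d2 q k i j + m * 0)"
          using a(3) by (auto simp: agree_def q_def d2_def)
        show "agree ns f (\<lambda>k i j. 1 * d3 q k i j + m * 1)"
          unfolding agree_def
        proof (intro ballI)
          fix k i j assume k: "k \<in> {1..nt}" and i: "i \<in> {1..nr}" and j: "j \<in> {1..ns}"
          have "f k i j - d3 a k i j = b (k mod nt + 1) - b k + m"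
            using c[OF k i j] b[OF k] by (simp add: c_def)
          then show "f k i j = 1 * d3 q k i j + m * 1" by (simp add: q_def d3_def)
        qed
      qed
      moreover have "form1 (d1 q) (d2 q) (d3 q) \<in> insert e (grad3 R S T ` U0)"
        unfolding U0_def grad_form0[symmetric] using \<open>q \<in> C0\<close> by (intro insertI2 imageI)
      ultimately show "u \<in> fspan (insert e (grad3 R S T ` U0))"
        by (simp only:) (intro fun_vs.span_add fun_vs.span_scale fun_vs.span_base insertI1)
    qed
    have "e \<in> ?K"
    proof -
      have "curl3 R S T e = form2 (\<lambda>k i j. 0) (\<lambda>k i j. 0) (\<lambda>k i j. 0)"
        unfolding e_def curl_form1 by (intro form2_cong) (auto simp: agree_def d1_def d2_def d3_def)
      moreover have "(\<lambda>k i j. 0, \<lambda>k i j. 0) \<in> C1" 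
        using C0_grad[OF C0_const[of "\<lambda>_. 0"]] by (simp add: d1_def[abs_def] d2_def[abs_def])
      ultimately show ?thesis using C0_const[of "\<lambda>_. 1"] by (auto simp: form_zero U1_def e_def)
    qed
    moreover have "fun_vs.subspace ?K"
    proof (rule fun_vs.subspaceI)
      show "0 \<in> ?K" using grad_U0 fun_vs.subspace_0[OF grad_subspace] by blast
      \<comment> \<open>As for gradients, the curl is handled linearly through coefficients of
        forms.\<close>
      have lin: "fscale a u + fscale b v \<in> ?K" if "u \<in> ?K" "v \<in> ?K" for a b u v
      proof -
        from that obtain g h f g' h' f' where C: "(g, h) \<in> C1" "f \<in> C0" "(g', h') \<in> C1" "f' \<in> C0"
          and u: "u = form1 g h f" "v = form1 g' h' f'"
          and curl: "curl3 R S T (form1 g h f) = 0" "curl3 R S T (form1 g' h' f') = 0" by (auto simp: U1_def)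
        note z = curl[unfolded curl_form1, THEN form2_eq_0(1)] curl[unfolded curl_form1, THEN form2_eq_0(2)]
          curl[unfolded curl_form1, THEN form2_eq_0(3)]
        have z': "d2 f k i j = d3 h k i j" "d2 f' k i j = d3 h' k i j"
          "d1 h k i j = d2 g k i j" "d1 h' k i j = d2 g' k i j"
          if "k \<in> {1..nt}" "i \<in> {1..nr}" "j \<in> {1..ms}" for k i j
          using z(1,2,5,6)[THEN agreeD, OF that] by auto
        have z'': "d1 f k i j = d3 g k i j" "d1 f' k i j = d3 g' k i j"
          if "k \<in> {1..nt}" "i \<in> {1..nr}" "j \<in> {1..ns}" for k i j
          using z(3,4)[THEN agreeD, OF that] by auto
        have lin: "d1 (\<lambda>k i j. a * x k i j + b * y k i j) k i j = a * d1 x k i j + b * d1 y k i j"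
          "d2 (\<lambda>k i j. a * x k i j + b * y k i j) k i j = a * d2 x k i j + b * d2 y k i j"
          "d3 (\<lambda>k i j. a * x k i j + b * y k i j) k i j = a * d3 x k i j + b * d3 y k i j"
          for x y k i j by (simp_all add: d1_def d2_def d3_def algebra_simps)
        have "curl3 R S T (fscale a u + fscale b v) = form2 (\<lambda>k i j. 0) (\<lambda>k i j. 0) (\<lambda>k i j. 0)"
          unfolding u form1_lin curl_form1
          by (intro form2_cong) (auto simp: agree_def lin z' z'')
        then show ?thesis
          using C1_lin[OF C(1,3), of a b] C0_lin[OF C(2,4), of a b] by (auto simp: form_zero U1_def u form1_lin)
      qed
      show "u + v \<in> ?K" if "u \<in> ?K" "v \<in> ?K" for u v using lin[OF that, of 1 1] by simp
      show "fscale c u \<in> ?K" if "u \<in> ?K" for c u using lin[OF that that, of c 0] by simp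
    qed
    ultimately show "fspan (insert e (grad3 R S T ` U0)) \<subseteq> ?K"
      using grad_U0 by (intro fun_vs.span_minimal) auto
  qed
  moreover have "grad3 R S T ` U0 \<subseteq> fspan F" using grad_U0 assms(1) by blast
  ultimately show ?thesis
    using fdim_insert_span[OF grad_subspace _ assms(2)] by (simp add: cohom_dim_def)
qed

text \<open>Kernel and image are equal as sets, so their dimensions cancel. A preimage has
  r-component \<open>v\<close>, which takes care of \<open>w\<close>, and t-component
  \<open>a\<close>, which takes care of the rest.\<close>

lemma cohom_dim_2: "cohom_dim (curl3 R S T ` U1) U2 (div3 R S T) = 0"
proof -
  have "{G \<in> U2. div3 R S T G = 0} = curl3 R S T ` U1"
  proof (intro equalityI subsetI)
    fix u assume "u \<in> curl3 R S T ` U1"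
    then obtain g h f where C: "(g, h) \<in> C1" "f \<in> C0" and u: "u = curl3 R S T (form1 g h f)"
      by (auto simp: U1_def)
    have "(\<lambda>k i j. d1 f k i j - d3 g k i j, \<lambda>k i j. d2 f k i j - d3 h k i j) \<in> C1"
      using C1_lin[OF C0_grad[OF C(2)] C1_d3[OF C(1)], of 1 "-1"] by simp
    moreover have "div3 R S T u = form3 (\<lambda>k i j. 0)"
      unfolding u curl_form1 div_form2
      by (intro form3_cong) (auto simp: agree_def d1_def d2_def d3_def)
    ultimately show "u \<in> {G \<in> U2. div3 R S T G = 0}"
      using C1_rot[OF C(1)] by (auto simp: form_zero U2_def u curl_form1)
  next
    fix u assume "u \<in> {G \<in> U2. div3 R S T G = 0}"
    then obtain h g w where C: "(g, h) \<in> C1" "w \<in> C2" and u: "u = form2 h g w"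
      and div: "div3 R S T (form2 h g w) = 0" by (auto simp: U2_def)
    note z = form3_eq_0[OF div[unfolded div_form2]]
    obtain v where v: "(v, \<lambda>k i j. 0) \<in> C1" "\<And>k i j. j \<ge> 1 \<Longrightarrow> d2 v k i j = - w k i j"
      using C2_primitive[OF C(2)] by blast
    \<comment> \<open>What remains of the pair after subtracting the curl of the 1-form with
      r-component \<open>v\<close>; vanishing divergence makes it rotation-free on each
      layer.\<close>
    define g' h' where "g' = (\<lambda>k i j. 1 * g k i j + 1 * d3 v k i j)"
      and "h' = (\<lambda>k i j. 1 * h k i j + 1 * (0 :: real))"
    have C': "(g', h') \<in> C1"
      unfolding g'_def h'_def using C1_d3[OF v(1)] by (intro C1_lin C) (simp add: d3_def[abs_def])
    have "agree ms (d1 h') (d2 g')"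
      unfolding agree_def
    proof (intro ballI)
      fix k i j assume "k \<in> {1..nt}" "i \<in> {1..nr}" and j: "j \<in> {1..ms}"
      then have "d1 h k i j - d2 g k i j + d3 w k i j = 0" using agreeD[OF z] by simp
      moreover have "d3 w k i j = - d3 (d2 v) k i j" using v(2)[of j] j by (simp add: d3_def)
      ultimately show "d1 h' k i j = d2 g' k i j" by (simp add: d1_def d2_def d3_def g'_def h'_def)
    qed
    then obtain a where a: "a \<in> C0" "agree ns (d1 a) g'" "agree ms (d2 a) h'"
      using C1_potential[OF C'] by blast
    have "curl3 R S T (form1 v (\<lambda>k i j. 0) a) = u"
      unfolding u curl_form1
    proof (rule form2_cong)
      show "agree ms (\<lambda>k i j. d2 a k i j - d3 (\<lambda>k i j. 0) k i j) h"
        using a(3) by (auto simp: agree_def h'_def d3_def)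
      show "agree ns (\<lambda>k i j. d1 a k i j - d3 v k i j) g"
        using a(2) by (auto simp: agree_def g'_def)
      show "agree ms (\<lambda>k i j. d1 (\<lambda>k i j. 0) k i j - d2 v k i j) w"
        using v(2) by (auto simp: agree_def d1_def)
    qed
    then show "u \<in> curl3 R S T ` U1" using v(1) a(1) by (force simp: U1_def)
  qed
  then show ?thesis by (simp add: cohom_dim_def)
qed

text \<open>Every 3-form is the divergence of a 2-form with an s-component only, since integration
  outwards from the pole respects the pole conditions.\<close>

lemma cohom_dim_3: "cohom_dim (div3 R S T ` U2) U3 (\<lambda>_. (0 :: pt3 \<Rightarrow> real)) = 0"
proof -
  have "U3 = div3 R S T ` U2"
  proof (intro equalityI subsetI)
    fix u assume "u \<in> div3 R S T ` U2"
    then obtain h g w where C: "(g, h) \<in> C1" "w \<in> C2" and u: "u = div3 R S T (form2 h g w)"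
      by (auto simp: U2_def)
    have "(\<lambda>k i j. d1 h k i j - d2 g k i j + d3 w k i j) \<in> C2"
      using C1_rot[OF C(1)] C(2) nt_shift by (auto simp: C2_def d3_def)
    then show "u \<in> U3" by (auto simp: u div_form2 U3_def)
  next
    fix u assume "u \<in> U3"
    then obtain w where w: "w \<in> C2" "u = form3 w" by (auto simp: U3_def)
    obtain v where v: "(v, \<lambda>k i j. 0) \<in> C1" "\<And>k i j. j \<ge> 1 \<Longrightarrow> d2 v k i j = - w k i j"
      using C2_primitive[OF w(1)] by blast
    have "div3 R S T (form2 (\<lambda>k i j. 0) v (\<lambda>k i j. 0)) = u"
      unfolding w div_form2 by (intro form3_cong) (auto simp: agree_def v(2) d1_def d3_def)
    moreover have "(\<lambda>k i j. 0) \<in> C2" by (simp add: C2_def)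
    ultimately show "u \<in> div3 R S T ` U2" using v(1) by (force simp: U2_def)
  qed
  then show ?thesis by (simp add: cohom_dim_def)
qed

end

section \<open>The extraction matrices\<close>

lemma sum_blocks:
  fixes f :: "nat \<Rightarrow> 'a::comm_monoid_add"
  shows "(\<Sum>l = 1..n * m. f l) = (\<Sum>k = 1..n. \<Sum>a = 1..m. f (a + (k - 1) * m))"
proof (induction n)
  case (Suc n)
  have "(\<Sum>l = 1..Suc n * m. f l) = (\<Sum>l = 1..n * m + m. f l)" by (simp add: add.commute)
  also have "\<dots> = (\<Sum>l = 1..n * m. f l) + (\<Sum>l = n * m + 1..n * m + m. f l)"
    by (rule sum.ub_add_nat) simp
  also have "(\<Sum>l = n * m + 1..n * m + m. f l) = (\<Sum>a = 1..m. f (a + n * m))"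
    by (rule sum.reindex_bij_witness[of _ "\<lambda>a. a + n * m" "\<lambda>l. l - n * m"]) auto
  finally show ?case using Suc by simp
qed simp

lemma block_decode:
  fixes a k m :: nat
  assumes "a \<in> {1..m}" "1 \<le> k"
  shows "(a + (k - 1) * m - 1) mod m + 1 = a" "(a + (k - 1) * m - 1) div m + 1 = k"
    "(a + (k - 1) * m - 1) div m = k - 1"
proof -
  from assms obtain a' k' where "a = Suc a'" "k = Suc k'"
    by (metis atLeastAtMost_iff not0_implies_Suc not_one_le_zero)
  then show "(a + (k - 1) * m - 1) mod m + 1 = a" "(a + (k - 1) * m - 1) div m + 1 = k"
    "(a + (k - 1) * m - 1) div m = k - 1"
    using assms by auto
qed

lemma block_eq_iff:
  fixes i j m :: nat
  assumes "i \<in> {1..m}" "i' \<in> {1..m}" "1 \<le> j" "1 \<le> j'"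
  shows "i + (j - 1) * m = i' + (j' - 1) * m \<longleftrightarrow> i = i' \<and> j = j'"
  using block_decode(1,2)[OF assms(1,3)] block_decode(1,2)[OF assms(2,4)] by metis

text \<open>The row vector \<open>Y\<close> times \<open>M\<close>, read at column
  \<open>(i, j)\<close>. A combination of the functions given by the rows of \<open>M\<close> has
  these spline coefficients, so the matrix acts transposed.\<close>

definition row_comb :: "nat \<Rightarrow> nat \<Rightarrow> (nat \<Rightarrow> nat \<Rightarrow> real) \<Rightarrow> (nat \<Rightarrow> real) \<Rightarrow> nat \<Rightarrow> nat \<Rightarrow> real" where
  "row_comb m nf M Y i j = (\<Sum>a = 1..m. Y a * M a (i + (j - 1) * nf))"

text \<open>Row \<open>a\<close> of copy number \<open>k\<close> meets only the columns of layer
  \<open>k\<close>, so the function \<open>H k\<close> factors out.\<close>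

lemma mgen_kronI:
  assumes a: "a \<in> {1..m}" and k: "k \<in> {1..nt}"
  shows "mgen (kronI m (nf * ng) M) (nf * ng * nt) (tp3 F nf G ng H) (a + (k - 1) * m) p
    = (\<Sum>i = 1..nf. \<Sum>j = 1..ng. M a (i + (j - 1) * nf) * F i (fst p) * G j (fst (snd p)) * H k (snd (snd p)))"
proof -
  let ?c = "nf * ng"
  have K: "kronI m ?c M (a + (k - 1) * m) (b + (k' - 1) * ?c) = (if k = k' then M a b else 0)"
    if "b \<in> {1..?c}" "k' \<in> {1..nt}" for b k'
    using block_decode[OF a, of k] block_decode[OF that(1), of k'] k that by (auto simp: kronI_def)
  have P: "tp3 F nf G ng H (i + (j - 1) * nf + (k' - 1) * ?c) p
      = F i (fst p) * G j (fst (snd p)) * H k' (snd (snd p))"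
    if i: "i \<in> {1..nf}" and j: "j \<in> {1..ng}" and k': "k' \<in> {1..nt}" for i j k'
  proof -
    \<comment> \<open>One flat index in two groupings: by layers, and with \<open>j\<close> and
      \<open>k'\<close> merged, as \<open>tp3\<close> decodes it.\<close>
    have e: "i + (j - 1) * nf + (k' - 1) * ?c = i + (j + (k' - 1) * ng - 1) * nf"
    proof -
      obtain l where "j = Suc l" using j by (cases j) auto
      then show ?thesis by (simp add: algebra_simps)
    qed
    have j': "1 \<le> j + (k' - 1) * ng" using j by simp
    note d = block_decode[OF i j']
    have b: "i + (j - 1) * nf \<in> {1..?c}"
    proof -
      have "i + (j - 1) * nf \<le> nf + (j - 1) * nf" using i by simp
      also have "\<dots> = j * nf" using j by (simp add: mult_eq_if)
      also have "\<dots> \<le> ?c" using j by (simp add: mult.commute)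
      finally show ?thesis using i by simp
    qed
    have "(i + (j - 1) * nf + (k' - 1) * ?c - 1) div (nf * ng) + 1 = k'"
      using block_decode(2)[OF b, of k'] k' by simp
    then show ?thesis
      using d block_decode(1)[OF j, of k'] k' unfolding tp3_def e by simp
  qed
  have "mgen (kronI m ?c M) (?c * nt) (tp3 F nf G ng H) (a + (k - 1) * m) p
     = (\<Sum>k' = 1..nt. \<Sum>b = 1..?c. kronI m ?c M (a + (k - 1) * m) (b + (k' - 1) * ?c)
          * tp3 F nf G ng H (b + (k' - 1) * ?c) p)"
    unfolding mgen_def mult.commute[of ?c nt] by (rule sum_blocks)
  also have "\<dots> = (\<Sum>k' = 1..nt. if k' = k then \<Sum>b = 1..?c. M a b * tp3 F nf G ng H (b + (k - 1) * ?c) p else 0)"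
  proof (rule sum.cong[OF refl])
    fix k' assume k': "k' \<in> {1..nt}"
    have "(\<Sum>b = 1..?c. kronI m ?c M (a + (k - 1) * m) (b + (k' - 1) * ?c) * tp3 F nf G ng H (b + (k' - 1) * ?c) p)
      = (\<Sum>b = 1..?c. (if k = k' then M a b else 0) * tp3 F nf G ng H (b + (k' - 1) * ?c) p)"
      by (rule sum.cong[OF refl]) (subst K, assumption, rule k', rule refl)
    then show "(\<Sum>b = 1..?c. kronI m ?c M (a + (k - 1) * m) (b + (k' - 1) * ?c) * tp3 F nf G ng H (b + (k' - 1) * ?c) p)
      = (if k' = k then \<Sum>b = 1..?c. M a b * tp3 F nf G ng H (b + (k - 1) * ?c) p else 0)"
      by (cases "k' = k") auto
  qed
  also have "\<dots> = (\<Sum>b = 1..?c. M a b * tp3 F nf G ng H (b + (k - 1) * ?c) p)" using k by simp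
  also have "\<dots> = (\<Sum>j = 1..ng. \<Sum>i = 1..nf. M a (i + (j - 1) * nf) * tp3 F nf G ng H (i + (j - 1) * nf + (k - 1) * ?c) p)"
    unfolding mult.commute[of nf ng] by (rule sum_blocks)
  also have "\<dots> = (\<Sum>j = 1..ng. \<Sum>i = 1..nf. M a (i + (j - 1) * nf) * F i (fst p) * G j (fst (snd p)) * H k (snd (snd p)))"
    by (intro sum.cong refl) (simp only: P[OF _ _ k] mult.assoc)
  also have "\<dots> = (\<Sum>i = 1..nf. \<Sum>j = 1..ng. M a (i + (j - 1) * nf) * F i (fst p) * G j (fst (snd p)) * H k (snd (snd p)))"
    by (rule sum.swap)
  finally show ?thesis .
qed

lemma sum_mgen_kronI:
  "(\<Sum>l = 1..nt * m. y l * mgen (kronI m (nf * ng) M) (nf * ng * nt) (tp3 F nf G ng H) l p)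
   = tsum nf F ng G nt H (\<lambda>k. row_comb m nf M (\<lambda>a. y (a + (k - 1) * m))) p"
proof -
  have "(\<Sum>l = 1..nt * m. y l * mgen (kronI m (nf * ng) M) (nf * ng * nt) (tp3 F nf G ng H) l p)
    = (\<Sum>k = 1..nt. \<Sum>a = 1..m. \<Sum>i = 1..nf. \<Sum>j = 1..ng. y (a + (k - 1) * m) *
        M a (i + (j - 1) * nf) * F i (fst p) * G j (fst (snd p)) * H k (snd (snd p)))"
    unfolding sum_blocks by (intro sum.cong refl) (subst mgen_kronI, assumption, assumption, simp add: sum_distrib_left mult.assoc)
  also have "\<dots> = (\<Sum>k = 1..nt. \<Sum>i = 1..nf. \<Sum>j = 1..ng. \<Sum>a = 1..m. y (a + (k - 1) * m) *
        M a (i + (j - 1) * nf) * F i (fst p) * G j (fst (snd p)) * H k (snd (snd p)))"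
  proof (rule sum.cong[OF refl])
    fix k
    show "(\<Sum>a = 1..m. \<Sum>i = 1..nf. \<Sum>j = 1..ng. y (a + (k - 1) * m) *
        M a (i + (j - 1) * nf) * F i (fst p) * G j (fst (snd p)) * H k (snd (snd p)))
      = (\<Sum>i = 1..nf. \<Sum>j = 1..ng. \<Sum>a = 1..m. y (a + (k - 1) * m) *
        M a (i + (j - 1) * nf) * F i (fst p) * G j (fst (snd p)) * H k (snd (snd p)))"
      by (subst sum.swap, rule sum.cong[OF refl], rule sum.swap)
  qed
  finally show ?thesis by (simp add: tsum_def row_comb_def sum_distrib_right)
qed

lemma row_comb_stack_top: "row_comb (m + n) nf (stack m M zmat) Y i j = row_comb m nf M Y i j"
proof -
  have "row_comb (m + n) nf (stack m M zmat) Y i j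
    = (\<Sum>a = 1..m. Y a * stack m M zmat a (i + (j - 1) * nf))
      + (\<Sum>a = m + 1..m + n. Y a * stack m M zmat a (i + (j - 1) * nf))"
    unfolding row_comb_def by (rule sum.ub_add_nat) simp
  then show ?thesis by (simp add: stack_def zmat_def row_comb_def)
qed

lemma row_comb_stack_bottom:
  "row_comb (m + n) nf (stack m zmat M) Y i j = row_comb n nf M (\<lambda>a. Y (m + a)) i j"
proof -
  have "row_comb (m + n) nf (stack m zmat M) Y i j
    = (\<Sum>a = 1..m. Y a * stack m zmat M a (i + (j - 1) * nf))
      + (\<Sum>a = m + 1..m + n. Y a * stack m zmat M a (i + (j - 1) * nf))"
    unfolding row_comb_def by (rule sum.ub_add_nat) simp
  also have "(\<Sum>a = m + 1..m + n. Y a * stack m zmat M a (i + (j - 1) * nf))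
    = (\<Sum>a = 1..n. Y (m + a) * M a (i + (j - 1) * nf))"
    by (rule sum.reindex_bij_witness[of _ "\<lambda>a. m + a" "\<lambda>a. a - m"]) (auto simp: stack_def)
  also have "(\<Sum>a = 1..m. Y a * stack m zmat M a (i + (j - 1) * nf)) = 0"
    by (rule sum.neutral) (simp add: stack_def zmat_def)
  finally show ?thesis by (simp add: row_comb_def)
qed

lemma row_comb_unit:
  assumes "a0 \<in> {1..m}" "\<And>a. a \<in> {1..m} \<Longrightarrow> M a (i + (j - 1) * nf) = (if a = a0 then 1 else 0)"
  shows "row_comb m nf M Y i j = Y a0"
proof -
  have "row_comb m nf M Y i j = (\<Sum>a = 1..m. if a = a0 then Y a else 0)"
    unfolding row_comb_def by (intro sum.cong refl) (subst assms(2), assumption, simp)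
  then show ?thesis using assms(1) by simp
qed

lemma row_comb_head:
  assumes "q \<le> m" "\<And>a. a \<in> {1..m} \<Longrightarrow> q < a \<Longrightarrow> M a (i + (j - 1) * nf) = 0"
  shows "row_comb m nf M Y i j = (\<Sum>a = 1..q. Y a * M a (i + (j - 1) * nf))"
  unfolding row_comb_def by (rule sum.mono_neutral_right) (use assms in auto)

text \<open>Linear functions restricted to the points at angle \<open>theta n i\<close> on the unit
  circle, the first ring around the pole.\<close>

definition polar_waves :: "nat \<Rightarrow> (nat \<Rightarrow> real) set" where
  "polar_waves n = {\<lambda>i. u * cos (theta n i) + v * sin (theta n i) | u v. True}"

lemma polar_wavesI: "(\<lambda>i. u * cos (theta n i) + v * sin (theta n i)) \<in> polar_waves n"
  by (auto simp: polar_waves_def)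

lemma polar_waves_lin:
  assumes "v \<in> polar_waves n" "w \<in> polar_waves n"
  shows "(\<lambda>i. a * v i + b * w i) \<in> polar_waves n"
proof -
  from assms obtain c d c' d' where "v = (\<lambda>i. c * cos (theta n i) + d * sin (theta n i))"
    "w = (\<lambda>i. c' * cos (theta n i) + d' * sin (theta n i))" by (auto simp: polar_waves_def)
  then have "(\<lambda>i. a * v i + b * w i)
    = (\<lambda>i. (a * c + b * c') * cos (theta n i) + (a * d + b * d') * sin (theta n i))"
    by (auto simp: algebra_simps)
  then show ?thesis using polar_wavesI by simp
qed

section \<open>Rows of the polar extraction matrices\<close>

locale polar_sizes =
  fixes nr ns ms :: nat
  assumes ms: "1 \<le> ms" and ns: "ns = Suc ms"
begin

lemma block_bound:
  assumes "i \<in> {1..nr}" "j < q"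
  shows "i + j * nr \<le> q * nr"
proof -
  have "i + j * nr \<le> Suc j * nr" using assms by simp
  also have "\<dots> \<le> q * nr" using assms by (intro mult_right_mono) auto
  finally show ?thesis .
qed

text \<open>The second-ring entries of \<open>Ebar\<close> are barycentric coordinates of the point
  at angle \<open>theta nr i\<close> in the equilateral triangle with vertices (2, 0), (-1, sqrt 3),
  (-1, -sqrt 3), and 1/3 are those of the centre. So \<open>Y\<close> acts as vertex values of an
  affine function.\<close>

lemma E0_rows:
  assumes i: "i \<in> {1..nr}"
  shows "row_comb (nb0 nr ns) nr (E0 nr ns) Y i 1 = (Y 1 + Y 2 + Y 3) / 3"
    and "row_comb (nb0 nr ns) nr (E0 nr ns) Y i 2 = (Y 1 + Y 2 + Y 3) / 3
      + ((Y 1 / 3 - (Y 2 + Y 3) / 6) * cos (theta nr i) + (sqrt 3 / 6 * (Y 2 - Y 3)) * sin (theta nr i))"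
    and "j \<in> {3..ns} \<Longrightarrow> row_comb (nb0 nr ns) nr (E0 nr ns) Y i j = Y (3 + (i + (j - 3) * nr))"
proof -
  have s3: "(\<Sum>a = 1..3. f a) = f 1 + f 2 + f 3" for f :: "nat \<Rightarrow> real"
    by (simp add: numeral_eq_Suc)
  have h: "row_comb (nb0 nr ns) nr (E0 nr ns) Y i j = (\<Sum>a = 1..3. Y a * E0 nr ns a (i + (j - 1) * nr))"
    if "j = 1 \<or> j = 2" for j
    by (rule row_comb_head) (use that i in \<open>auto simp: E0_def nb0_def\<close>)
  have e1: "E0 nr ns a (i + (1 - 1) * nr) = 1/3" if "a \<in> {1..3}" for a
    using that i block_decode[OF i, of 1] by (auto simp: E0_def Ebar_def)
  have "row_comb (nb0 nr ns) nr (E0 nr ns) Y i 1 = (\<Sum>a = 1..3. Y a * E0 nr ns a (i + (1 - 1) * nr))"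
    by (rule h) simp
  also have "\<dots> = (\<Sum>a = 1..3. Y a * (1/3))"
    by (intro sum.cong refl) (subst e1, assumption, rule refl)
  finally show "row_comb (nb0 nr ns) nr (E0 nr ns) Y i 1 = (Y 1 + Y 2 + Y 3) / 3"
    unfolding s3 by simp
  have e2: "E0 nr ns a (i + (2 - 1) * nr) = Ebar nr a i 2" if "a \<in> {1..3}" for a
    using that i block_decode[OF i, of 2] by (auto simp: E0_def numeral_2_eq_2)
  have "row_comb (nb0 nr ns) nr (E0 nr ns) Y i 2 = Y 1 * Ebar nr 1 i 2 + Y 2 * Ebar nr 2 i 2 + Y 3 * Ebar nr 3 i 2"
    using h[of 2] e2[of 1] e2[of 2] e2[of 3] unfolding s3 by simp
  then show "row_comb (nb0 nr ns) nr (E0 nr ns) Y i 2 = (Y 1 + Y 2 + Y 3) / 3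
      + ((Y 1 / 3 - (Y 2 + Y 3) / 6) * cos (theta nr i) + (sqrt 3 / 6 * (Y 2 - Y 3)) * sin (theta nr i))"
    by (simp add: Ebar_def field_simps)
  show "row_comb (nb0 nr ns) nr (E0 nr ns) Y i j = Y (3 + (i + (j - 3) * nr))" if j: "j \<in> {3..ns}"
  proof (rule row_comb_unit)
    have "i + (j - 3) * nr \<le> (ns - 2) * nr" using j by (intro block_bound i) auto
    then show "3 + (i + (j - 3) * nr) \<in> {1..nb0 nr ns}" by (simp add: nb0_def mult.commute)
    obtain l where l: "j = l + 3" using j by (metis atLeastAtMost_iff le_add_diff_inverse2)
    show "E0 nr ns a (i + (j - 1) * nr) = (if a = 3 + (i + (j - 3) * nr) then 1 else 0)"
      if "a \<in> {1..nb0 nr ns}" for a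
      using i unfolding l E0_def by (auto simp: algebra_simps)
  qed
qed

lemma E0_surj:
  assumes "w \<in> polar_waves nr" and f: "\<And>i. i \<in> {1..nr} \<Longrightarrow> f i 1 = A \<and> f i 2 = A + w i"
  obtains Y where "\<And>i j. i \<in> {1..nr} \<Longrightarrow> j \<in> {1..ns} \<Longrightarrow> row_comb (nb0 nr ns) nr (E0 nr ns) Y i j = f i j"
proof -
  from assms obtain u v where w: "w = (\<lambda>i. u * cos (theta nr i) + v * sin (theta nr i))"
    by (auto simp: polar_waves_def)
  \<comment> \<open>The values of the affine function with constant term \<open>A\<close> and
    gradient \<open>(u, v)\<close> at the three vertices of the triangle.\<close>
  define Y where "Y = (\<lambda>a. if a = 1 then A + 2 * u else if a = 2 then A - u + sqrt 3 * v
    else if a = 3 then A - u - sqrt 3 * v else f ((a - 3 - 1) mod nr + 1) ((a - 3 - 1) div nr + 1 + 2))"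
  have "row_comb (nb0 nr ns) nr (E0 nr ns) Y i j = f i j" if i: "i \<in> {1..nr}" and j: "j \<in> {1..ns}" for i j
  proof -
    have Y: "Y 1 = A + 2 * u" "Y 2 = A - u + sqrt 3 * v" "Y 3 = A - u - sqrt 3 * v"
      by (simp_all add: Y_def)
    consider "j = 1" | "j = 2" | "j \<in> {3..ns}" using j by force
    then show ?thesis
    proof cases
      case 1
      show ?thesis unfolding 1 E0_rows(1)[OF i] Y using f[OF i] by simp
    next
      case 2
      have "(A + 2 * u) / 3 - (A - u + sqrt 3 * v + (A - u - sqrt 3 * v)) / 6 = u"
        "sqrt 3 / 6 * (A - u + sqrt 3 * v - (A - u - sqrt 3 * v)) = v" 
        "(A + 2 * u + (A - u + sqrt 3 * v) + (A - u - sqrt 3 * v)) / 3 = A"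
        by (simp_all add: field_simps)
      then show ?thesis unfolding 2 E0_rows(2)[OF i] Y using f[OF i] by (simp add: w)
    next
      case 3
      have "j - 3 = j - 2 - 1" "1 \<le> j - 2" "Suc (Suc (j - 2)) = j" using 3 by auto
      then have "Y (3 + (i + (j - 3) * nr)) = f i j"
        using block_decode(1,2)[OF i, of "j - 2"] i 3 by (simp add: Y_def)
      then show ?thesis using E0_rows(3)[OF i 3] by simp
    qed
  qed
  then show ?thesis using that by blast
qed

lemma nb1_eq: "nb1 nr ns = 2 + 2 * (ms - 1) * nr"
proof -
  obtain l where "ms = Suc l" using ms by (cases ms) auto
  then show ?thesis by (simp add: nb1_def nb0_def ns algebra_simps)
qed

text \<open>Beyond the two polar rows the blocks of \<open>nr\<close> rows alternate: odd block
  numbers \<open>2 * j - 5\<close> belong to the r-component, even ones \<open>2 * j - 4\<close> to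
  the s-component, so the two never share a row.\<close>

lemma E10_rows:
  assumes i: "i \<in> {1..nr}"
  shows "row_comb (nb1 nr ns) nr (E10 nr ns) Y i 1 = 0"
    and "row_comb (nb1 nr ns) nr (E10 nr ns) Y i 2
      = Y 1 * (Ebar nr 2 (i mod nr + 1) 2 - Ebar nr 2 i 2) + Y 2 * (Ebar nr 3 (i mod nr + 1) 2 - Ebar nr 3 i 2)"
    and "j \<in> {3..ns} \<Longrightarrow> row_comb (nb1 nr ns) nr (E10 nr ns) Y i j = Y (2 + i + (2 * j - 5) * nr)"
proof -
  have s2: "(\<Sum>a = 1..2. f a) = f 1 + f 2" for f :: "nat \<Rightarrow> real" by (simp add: numeral_eq_Suc)
  have E: "E10 nr ns a (i + (j - 1) * nr) = (if j \<in> {3..ns} \<and> a = 2 + i + (2 * j - 5) * nr then 1 else 0)"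
    if "2 < a" "1 \<le> j" for a j
  proof -
    have "(\<exists>i' j'. 1 \<le> i' \<and> i' \<le> nr \<and> 3 \<le> j' \<and> j' \<le> ns \<and> a = 2 + i' + (2 * j' - 5) * nr
        \<and> i + (j - 1) * nr = i' + (j' - 1) * nr) \<longleftrightarrow> j \<in> {3..ns} \<and> a = 2 + i + (2 * j - 5) * nr"
      (is "?l \<longleftrightarrow> ?r")
    proof
      assume ?l
      then obtain i' j' where *: "i' \<in> {1..nr}" "j' \<in> {3..ns}" "a = 2 + i' + (2 * j' - 5) * nr"
        "i + (j - 1) * nr = i' + (j' - 1) * nr" by auto
      then have "1 \<le> j'" by simp
      from iffD1[OF block_eq_iff[OF i *(1) that(2) this] *(4)] have "i = i' \<and> j = j'" .
      with * show ?r by simp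
    qed (use i in auto)
    then show ?thesis using that by (simp add: E10_def)
  qed
  have h: "row_comb (nb1 nr ns) nr (E10 nr ns) Y i j = (\<Sum>a = 1..2. Y a * E10 nr ns a (i + (j - 1) * nr))"
    if "j = 1 \<or> j = 2" for j
    by (rule row_comb_head) (use that E[of _ j] in \<open>auto simp: nb1_eq\<close>)
  show "row_comb (nb1 nr ns) nr (E10 nr ns) Y i 1 = 0"
    using h[of 1] i unfolding s2 by (simp add: E10_def)
  show "row_comb (nb1 nr ns) nr (E10 nr ns) Y i 2
      = Y 1 * (Ebar nr 2 (i mod nr + 1) 2 - Ebar nr 2 i 2) + Y 2 * (Ebar nr 3 (i mod nr + 1) 2 - Ebar nr 3 i 2)"
    using h[of 2] i unfolding s2 by (simp add: E10_def numeral_2_eq_2 numeral_3_eq_3)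
  show "row_comb (nb1 nr ns) nr (E10 nr ns) Y i j = Y (2 + i + (2 * j - 5) * nr)" if j: "j \<in> {3..ns}"
  proof (rule row_comb_unit)
    have "i + (2 * j - 5) * nr \<le> (2 * (ms - 1)) * nr" using j by (intro block_bound i) (auto simp: ns)
    then show "2 + i + (2 * j - 5) * nr \<in> {1..nb1 nr ns}" by (simp add: nb1_eq)
    fix a assume a: "a \<in> {1..nb1 nr ns}"
    show "E10 nr ns a (i + (j - 1) * nr) = (if a = 2 + i + (2 * j - 5) * nr then 1 else 0)"
    \<comment> \<open>The two polar rows end at column \<open>2 * nr\<close>, which any ring
      \<open>j \<ge> 3\<close> lies beyond.\<close>
    proof (cases "2 < a")
      case False
      obtain l where "j = l + 3" using j by (metis atLeastAtMost_iff le_add_diff_inverse2)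
      then have "\<not> i + (j - 1) * nr \<le> 2 * nr" using i by (simp add: algebra_simps)
      then show ?thesis using False i by (simp add: E10_def)
    qed (use E[of a j] j in auto)
  qed
qed

lemma E01_rows:
  assumes i: "i \<in> {1..nr}"
  shows "row_comb (nb1 nr ns) nr (E01 nr ns) Y i 1
      = Y 1 * (Ebar nr 2 i 2 - Ebar nr 2 i 1) + Y 2 * (Ebar nr 3 i 2 - Ebar nr 3 i 1)"
    and "j \<in> {2..ms} \<Longrightarrow> row_comb (nb1 nr ns) nr (E01 nr ns) Y i j = Y (2 + i + (2 * j - 4) * nr)"
proof -
  have s2: "(\<Sum>a = 1..2. f a) = f 1 + f 2" for f :: "nat \<Rightarrow> real" by (simp add: numeral_eq_Suc)
  have E: "E01 nr ns a (i + (j - 1) * nr) = (if j \<in> {2..ms} \<and> a = 2 + i + (2 * j - 4) * nr then 1 else 0)"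
    if "2 < a" "1 \<le> j" for a j
  proof -
    have "(\<exists>i' j'. 1 \<le> i' \<and> i' \<le> nr \<and> 2 \<le> j' \<and> j' \<le> ns - 1 \<and> a = 2 + i' + (2 * j' - 4) * nr
        \<and> i + (j - 1) * nr = i' + (j' - 1) * nr) \<longleftrightarrow> j \<in> {2..ms} \<and> a = 2 + i + (2 * j - 4) * nr"
      (is "?l \<longleftrightarrow> ?r")
    proof
      assume ?l
      then obtain i' j' where *: "i' \<in> {1..nr}" "j' \<in> {2..ms}" "a = 2 + i' + (2 * j' - 4) * nr"
        "i + (j - 1) * nr = i' + (j' - 1) * nr" by (auto simp: ns)
      then have "1 \<le> j'" by simp
      from iffD1[OF block_eq_iff[OF i *(1) that(2) this] *(4)] have "i = i' \<and> j = j'" .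
      with * show ?r by simp
    qed (use i in \<open>auto simp: ns\<close>)
    then show ?thesis using that by (simp add: E01_def)
  qed
  have h: "row_comb (nb1 nr ns) nr (E01 nr ns) Y i 1 = (\<Sum>a = 1..2. Y a * E01 nr ns a (i + (1 - 1) * nr))"
    by (rule row_comb_head) (use E[of _ 1] in \<open>auto simp: nb1_eq\<close>)
  show "row_comb (nb1 nr ns) nr (E01 nr ns) Y i 1
      = Y 1 * (Ebar nr 2 i 2 - Ebar nr 2 i 1) + Y 2 * (Ebar nr 3 i 2 - Ebar nr 3 i 1)"
    using h i unfolding s2 by (simp add: E01_def numeral_2_eq_2 numeral_3_eq_3)
  show "row_comb (nb1 nr ns) nr (E01 nr ns) Y i j = Y (2 + i + (2 * j - 4) * nr)" if j: "j \<in> {2..ms}"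
  proof (rule row_comb_unit)
    have "i + (2 * j - 4) * nr \<le> (2 * (ms - 1)) * nr" using j by (intro block_bound i) auto
    then show "2 + i + (2 * j - 4) * nr \<in> {1..nb1 nr ns}" by (simp add: nb1_eq)
    fix a assume a: "a \<in> {1..nb1 nr ns}"
    show "E01 nr ns a (i + (j - 1) * nr) = (if a = 2 + i + (2 * j - 4) * nr then 1 else 0)"
    proof (cases "2 < a")
      case False
      obtain l where "j = l + 2" using j by (metis atLeastAtMost_iff le_add_diff_inverse2)
      then have "\<not> i + (j - 1) * nr \<le> nr" using i by (simp add: algebra_simps)
      then show ?thesis using False i by (simp add: E01_def)
    qed (use E[of a j] j in auto)
  qed
qed

text \<open>Differences of barycentric coordinates add up to 0, so the second and third rows carry
  all waves.\<close>

lemma polar_wave_coeffs: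
  "Y1 * (Ebar nr 2 i 2 - Ebar nr 2 i 1) + Y2 * (Ebar nr 3 i 2 - Ebar nr 3 i 1)
   = (- (Y1 + Y2) / 6) * cos (theta nr i) + (sqrt 3 / 6 * (Y1 - Y2)) * sin (theta nr i)"
  by (simp add: Ebar_def field_simps)

text \<open>The constants 1/3 cancel in both matrices: one takes the difference to the pole, the
  other the angular difference, of the same coordinates. Hence a common wave.\<close>

lemma E1_rows_wave:
  obtains w where "w \<in> polar_waves nr"
    "\<And>i. i \<in> {1..nr} \<Longrightarrow> row_comb (nb1 nr ns) nr (E01 nr ns) Y i 1 = w i"
    "\<And>i. i \<in> {1..nr} \<Longrightarrow> row_comb (nb1 nr ns) nr (E10 nr ns) Y i 2 = w (i mod nr + 1) - w i"
proof -
  define w where "w = (\<lambda>i. (- (Y 1 + Y 2) / 6) * cos (theta nr i) + (sqrt 3 / 6 * (Y 1 - Y 2)) * sin (theta nr i))"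
  have "w \<in> polar_waves nr" unfolding w_def by (rule polar_wavesI)
  moreover have "row_comb (nb1 nr ns) nr (E01 nr ns) Y i 1 = w i" if "i \<in> {1..nr}" for i
    unfolding E01_rows(1)[OF that] polar_wave_coeffs w_def ..
  moreover have "row_comb (nb1 nr ns) nr (E10 nr ns) Y i 2 = w (i mod nr + 1) - w i" if "i \<in> {1..nr}" for i
    unfolding E10_rows(2)[OF that] w_def polar_wave_coeffs[symmetric] by (simp add: Ebar_def algebra_simps)
  ultimately show ?thesis using that by blast
qed

lemma E1_surj:
  assumes "w \<in> polar_waves nr"
    and gh: "\<And>i. i \<in> {1..nr} \<Longrightarrow> g i 1 = 0 \<and> g i 2 = w (i mod nr + 1) - w i \<and> h i 1 = w i"
  obtains Y where "\<And>i j. i \<in> {1..nr} \<Longrightarrow> j \<in> {1..ns} \<Longrightarrow> row_comb (nb1 nr ns) nr (E10 nr ns) Y i j = g i j"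
    "\<And>i j. i \<in> {1..nr} \<Longrightarrow> j \<in> {1..ms} \<Longrightarrow> row_comb (nb1 nr ns) nr (E01 nr ns) Y i j = h i j"
proof -
  from assms obtain u v where w: "w = (\<lambda>i. u * cos (theta nr i) + v * sin (theta nr i))"
    by (auto simp: polar_waves_def)
  \<comment> \<open>The first two values are vertex values of the linear function with gradient
    \<open>(u, v)\<close> minus its value at the first vertex; the parity of \<open>q\<close> then
    separates the entries of \<open>g\<close> from those of \<open>h\<close>.\<close>
  define Y where "Y = (\<lambda>a. if a = 1 then sqrt 3 * v - 3 * u else if a = 2 then - sqrt 3 * v - 3 * u
    else let i = (a - 2 - 1) mod nr + 1; q = (a - 2 - 1) div nr
      in if odd q then g i ((q + 5) div 2) else h i ((q + 4) div 2))"
  have "- (Y 1 + Y 2) / 6 = u" "sqrt 3 / 6 * (Y 1 - Y 2) = v" by (simp_all add: Y_def field_simps)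
  note Yw = polar_wave_coeffs[of "Y 1" _ "Y 2", unfolded this]
  have Yi: "Y (2 + i + q * nr) = (if odd q then g i ((q + 5) div 2) else h i ((q + 4) div 2))"
    if i: "i \<in> {1..nr}" for i q
  proof -
    have "(2 + i + q * nr - 2 - 1) mod nr + 1 = i" "(2 + i + q * nr - 2 - 1) div nr = q"
      using block_decode(1,3)[OF i, of "q + 1"] by simp_all
    moreover have "2 + i + q * nr \<noteq> 1" "2 + i + q * nr \<noteq> 2" using i by auto
    ultimately show ?thesis unfolding Y_def Let_def by presburger
  qed
  have "row_comb (nb1 nr ns) nr (E10 nr ns) Y i j = g i j" if i: "i \<in> {1..nr}" and j: "j \<in> {1..ns}" for i j
  proof -
    consider "j = 1" | "j = 2" | "j \<in> {3..ns}" using j by force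
    then show ?thesis
    proof cases
      case 1
      then show ?thesis using E10_rows(1)[OF i] gh[OF i] by simp
    next
      case 2
      have "row_comb (nb1 nr ns) nr (E10 nr ns) Y i 2
        = (Y 1 * (Ebar nr 2 (i mod nr + 1) 2 - Ebar nr 2 (i mod nr + 1) 1)
            + Y 2 * (Ebar nr 3 (i mod nr + 1) 2 - Ebar nr 3 (i mod nr + 1) 1))
          - (Y 1 * (Ebar nr 2 i 2 - Ebar nr 2 i 1) + Y 2 * (Ebar nr 3 i 2 - Ebar nr 3 i 1))"
        unfolding E10_rows(2)[OF i] by (simp add: Ebar_def algebra_simps)
      also have "\<dots> = w (i mod nr + 1) - w i" unfolding Yw w ..
      finally show ?thesis using 2 gh[OF i] by simp
    next
      case 3
      then have "odd (2 * j - 5)" "(2 * j - 5 + 5) div 2 = j" by auto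
      then show ?thesis using E10_rows(3)[OF i 3] Yi[OF i, of "2 * j - 5"] by simp
    qed
  qed
  moreover have "row_comb (nb1 nr ns) nr (E01 nr ns) Y i j = h i j" if i: "i \<in> {1..nr}" and j: "j \<in> {1..ms}" for i j
  proof (cases "j = 1")
    case True
    show ?thesis unfolding True E01_rows(1)[OF i] Yw using gh[OF i] by (simp add: w)
  next
    case False
    then have j2: "j \<in> {2..ms}" using j by auto
    then have "even (2 * j - 4)" "(2 * j - 4 + 4) div 2 = j" by auto
    then show ?thesis using E01_rows(2)[OF i j2] Yi[OF i, of "2 * j - 4"] by simp
  qed
  ultimately show ?thesis using that by blast
qed

lemma nb2_eq: "nb2 nr ns = (ms - 1) * nr"
  using ms by (simp add: nb2_def nb0_def ns mult.commute)

lemma E2_rows: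
  assumes i: "i \<in> {1..nr}"
  shows "row_comb (nb2 nr ns) nr (E2 nr ns) Y i 1 = 0"
    and "j \<in> {2..ms} \<Longrightarrow> row_comb (nb2 nr ns) nr (E2 nr ns) Y i j = Y (i + (j - 2) * nr)"
proof -
  show "row_comb (nb2 nr ns) nr (E2 nr ns) Y i 1 = 0"
    unfolding row_comb_def by (rule sum.neutral) (use i in \<open>auto simp: E2_def\<close>)
  show "row_comb (nb2 nr ns) nr (E2 nr ns) Y i j = Y (i + (j - 2) * nr)" if j: "j \<in> {2..ms}"
  proof (rule row_comb_unit)
    have "i + (j - 2) * nr \<le> (ms - 1) * nr" using j by (intro block_bound i) auto
    then show "i + (j - 2) * nr \<in> {1..nb2 nr ns}" using i by (simp add: nb2_eq)
    obtain l where "j = l + 2" using j by (metis atLeastAtMost_iff le_add_diff_inverse2)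
    then show "E2 nr ns a (i + (j - 1) * nr) = (if a = i + (j - 2) * nr then 1 else 0)" for a
      by (auto simp: E2_def algebra_simps)
  qed
qed

lemma E2_surj:
  assumes "\<And>i. i \<in> {1..nr} \<Longrightarrow> w i 1 = 0"
  obtains Y where "\<And>i j. i \<in> {1..nr} \<Longrightarrow> j \<in> {1..ms} \<Longrightarrow> row_comb (nb2 nr ns) nr (E2 nr ns) Y i j = w i j"
proof -
  define Y where "Y = (\<lambda>a. w ((a - 1) mod nr + 1) ((a - 1) div nr + 1 + 1))"
  have "row_comb (nb2 nr ns) nr (E2 nr ns) Y i j = w i j" if i: "i \<in> {1..nr}" and j: "j \<in> {1..ms}" for i j
  proof (cases "j = 1")
    case True
    then show ?thesis using E2_rows(1)[OF i] assms[OF i] by simp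
  next
    case False
    then have j2: "j \<in> {2..ms}" and "j - 2 = j - 1 - 1" "1 \<le> j - 1" using j by auto
    then have "Y (i + (j - 2) * nr) = w i j"
      using block_decode(1,2)[OF i, of "j - 1"] by (simp add: Y_def)
    then show ?thesis using E2_rows(2)[OF i j2] by simp
  qed
  then show ?thesis using that by blast
qed

end

section \<open>From matrix rows to coefficient spaces\<close>

lemma layer_coeffs:
  fixes P :: "nat \<Rightarrow> nat \<Rightarrow> real"
  obtains y where "\<And>k a. k \<in> {1..nt} \<Longrightarrow> a \<in> {1..m} \<Longrightarrow> y (a + (k - 1) * m) = P k a"
proof -
  define y where "y = (\<lambda>l. P ((l - 1) div m + 1) ((l - 1) mod m + 1))"
  have "y (a + (k - 1) * m) = P k a" if "k \<in> {1..nt}" "a \<in> {1..m}" for k a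
    using that block_decode(1,2)[of a m k] by (simp add: y_def)
  then show ?thesis using that by blast
qed

text \<open>The two row blocks of a stacked matrix use disjoint entries of one vector, so they can
  be prescribed independently.\<close>

lemma stacked_coeffs:
  fixes P Q :: "nat \<Rightarrow> nat \<Rightarrow> real"
  obtains y where "\<And>k a. k \<in> {1..nt} \<Longrightarrow> a \<in> {1..m} \<Longrightarrow> y (a + (k - 1) * (m + n)) = P k a"
    "\<And>k a. k \<in> {1..nt} \<Longrightarrow> a \<in> {1..n} \<Longrightarrow> y (m + a + (k - 1) * (m + n)) = Q k a"
proof -
  obtain y where y: "\<And>k a. k \<in> {1..nt} \<Longrightarrow> a \<in> {1..m + n} \<Longrightarrow>
      y (a + (k - 1) * (m + n)) = (if a \<le> m then P k a else Q k (a - m))"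
    using layer_coeffs[of nt "m + n" "\<lambda>k a. if a \<le> m then P k a else Q k (a - m)"] by blast
  show ?thesis by (rule that[of y]) (use y in auto)
qed

lemma row_comb_cong: "(\<And>a. a \<in> {1..m} \<Longrightarrow> Y a = Y' a) \<Longrightarrow> row_comb m nf M Y i j = row_comb m nf M Y' i j"
  unfolding row_comb_def by (intro sum.cong refl) simp

lemma row_comb_uminus: "row_comb m nf (\<lambda>a b. - M a b) Y i j = - row_comb m nf M Y i j"
  by (simp add: row_comb_def sum_negf)

lemma tsum_uminus: "tsum a F b G c H (\<lambda>k i j. - f k i j) p = - tsum a F b G c H f p"
  by (simp add: tsum_def sum_negf)

lemma restr_sum:
  fixes F :: "nat \<Rightarrow> pt3 \<Rightarrow> 'b::real_vector"
  shows "(\<Sum>l \<in> A. y l *\<^sub>R restr D (F l) p) = restr D (\<lambda>p. \<Sum>l \<in> A. y l *\<^sub>R F l p) p"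
  by (simp add: restr_def)

locale polar_torus_complex =
  torus_complex nr R Br Dr "\<lambda>i. i mod nr + 1" ns ms S Bs Ds nt T Bt Dt "polar_waves nr" + polar_sizes nr ns ms
  for nr R Br Dr ns ms S Bs Ds nt T Bt Dt
begin

lemma E0_C0: "(\<lambda>k. row_comb (nb0 nr ns) nr (E0 nr ns) (Y k)) \<in> C0"
  unfolding C0_def
proof (intro CollectI ballI)
  fix k
  show "\<exists>A. \<exists>w \<in> polar_waves nr. \<forall>i \<in> {1..nr}. row_comb (nb0 nr ns) nr (E0 nr ns) (Y k) i 1 = A
      \<and> row_comb (nb0 nr ns) nr (E0 nr ns) (Y k) i 2 = A + w i"
    by (intro exI[of _ "(Y k 1 + Y k 2 + Y k 3) / 3"] bexI[of _ "\<lambda>i. (Y k 1 / 3 - (Y k 2 + Y k 3) / 6) * cos (theta nr i)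
        + (sqrt 3 / 6 * (Y k 2 - Y k 3)) * sin (theta nr i)"] ballI conjI E0_rows(1) E0_rows(2) polar_wavesI)
qed

lemma C0_rows:
  assumes "f \<in> C0"
  obtains Y where "agree ns f (\<lambda>k. row_comb (nb0 nr ns) nr (E0 nr ns) (Y k))"
proof -
  have "\<forall>k \<in> {1..nt}. \<exists>Y. \<forall>i \<in> {1..nr}. \<forall>j \<in> {1..ns}. f k i j = row_comb (nb0 nr ns) nr (E0 nr ns) Y i j"
  proof
    fix k assume "k \<in> {1..nt}"
    then obtain A w where "w \<in> polar_waves nr" "\<forall>i\<in>{1..nr}. f k i 1 = A \<and> f k i 2 = A + w i"
      using assms unfolding C0_def by blast
    then show "\<exists>Y. \<forall>i \<in> {1..nr}. \<forall>j \<in> {1..ns}. f k i j = row_comb (nb0 nr ns) nr (E0 nr ns) Y i j"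
      using E0_surj[of w "f k" A] by metis
  qed
  then obtain Y where "\<forall>k \<in> {1..nt}. \<forall>i \<in> {1..nr}. \<forall>j \<in> {1..ns}. f k i j = row_comb (nb0 nr ns) nr (E0 nr ns) (Y k) i j"
    using bchoice by metis
  then show ?thesis using that unfolding agree_def by blast
qed

lemma E1_C1:
  "(\<lambda>k. row_comb (nb1 nr ns) nr (E10 nr ns) (Y k), \<lambda>k. row_comb (nb1 nr ns) nr (E01 nr ns) (Y k)) \<in> C1"
  unfolding C1_def
proof (rule CollectI, rule case_prodI, rule ballI)
  fix k
  obtain w where "w \<in> polar_waves nr"
    "\<And>i. i \<in> {1..nr} \<Longrightarrow> row_comb (nb1 nr ns) nr (E01 nr ns) (Y k) i 1 = w i"
    "\<And>i. i \<in> {1..nr} \<Longrightarrow> row_comb (nb1 nr ns) nr (E10 nr ns) (Y k) i 2 = w (i mod nr + 1) - w i"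
    using E1_rows_wave[of "Y k"] by blast
  then show "\<exists>w\<in>polar_waves nr. \<forall>i\<in>{1..nr}. row_comb (nb1 nr ns) nr (E10 nr ns) (Y k) i 1 = 0 \<and>
      row_comb (nb1 nr ns) nr (E10 nr ns) (Y k) i 2 = w (i mod nr + 1) - w i \<and>
      row_comb (nb1 nr ns) nr (E01 nr ns) (Y k) i 1 = w i"
    by (intro bexI[of _ w] ballI conjI E10_rows(1))
qed

lemma C1_rows:
  assumes "(g, h) \<in> C1"
  obtains Y where "agree ns g (\<lambda>k. row_comb (nb1 nr ns) nr (E10 nr ns) (Y k))"
    "agree ms h (\<lambda>k. row_comb (nb1 nr ns) nr (E01 nr ns) (Y k))"
proof -
  have "\<forall>k \<in> {1..nt}. \<exists>Y. (\<forall>i \<in> {1..nr}. \<forall>j \<in> {1..ns}. g k i j = row_comb (nb1 nr ns) nr (E10 nr ns) Y i j)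
    \<and> (\<forall>i \<in> {1..nr}. \<forall>j \<in> {1..ms}. h k i j = row_comb (nb1 nr ns) nr (E01 nr ns) Y i j)"
  proof
    fix k assume "k \<in> {1..nt}"
    then obtain w where "w \<in> polar_waves nr"
      "\<forall>i\<in>{1..nr}. g k i 1 = 0 \<and> g k i 2 = w (i mod nr + 1) - w i \<and> h k i 1 = w i"
      using assms unfolding C1_def by blast
    then show "\<exists>Y. (\<forall>i \<in> {1..nr}. \<forall>j \<in> {1..ns}. g k i j = row_comb (nb1 nr ns) nr (E10 nr ns) Y i j)
      \<and> (\<forall>i \<in> {1..nr}. \<forall>j \<in> {1..ms}. h k i j = row_comb (nb1 nr ns) nr (E01 nr ns) Y i j)"
      using E1_surj[of w "g k" "h k"] by metis
  qed
  then obtain Y where "\<forall>k \<in> {1..nt}. (\<forall>i \<in> {1..nr}. \<forall>j \<in> {1..ns}. g k i j = row_comb (nb1 nr ns) nr (E10 nr ns) (Y k) i j)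
    \<and> (\<forall>i \<in> {1..nr}. \<forall>j \<in> {1..ms}. h k i j = row_comb (nb1 nr ns) nr (E01 nr ns) (Y k) i j)"
    using bchoice by metis
  then show ?thesis using that unfolding agree_def by blast
qed

lemma E2_C2: "(\<lambda>k. row_comb (nb2 nr ns) nr (E2 nr ns) (Y k)) \<in> C2"
  unfolding C2_def by (intro CollectI ballI E2_rows(1))

lemma C2_rows:
  assumes "w \<in> C2"
  obtains Y where "agree ms w (\<lambda>k. row_comb (nb2 nr ns) nr (E2 nr ns) (Y k))"
proof -
  have "\<forall>k \<in> {1..nt}. \<exists>Y. \<forall>i \<in> {1..nr}. \<forall>j \<in> {1..ms}. w k i j = row_comb (nb2 nr ns) nr (E2 nr ns) Y i j"
  proof
    fix k assume "k \<in> {1..nt}"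
    then have "\<forall>i\<in>{1..nr}. w k i 1 = 0" using assms unfolding C2_def by blast
    then show "\<exists>Y. \<forall>i \<in> {1..nr}. \<forall>j \<in> {1..ms}. w k i j = row_comb (nb2 nr ns) nr (E2 nr ns) Y i j"
      using E2_surj[of "w k"] by metis
  qed
  then obtain Y where "\<forall>k \<in> {1..nt}. \<forall>i \<in> {1..nr}. \<forall>j \<in> {1..ms}. w k i j = row_comb (nb2 nr ns) nr (E2 nr ns) (Y k) i j"
    using bchoice by metis
  then show ?thesis using that unfolding agree_def by blast
qed

lemma agree_rows:
  assumes "agree b f (\<lambda>k. row_comb m nr M (Y k))"
    and "\<And>k a. k \<in> {1..nt} \<Longrightarrow> a \<in> {1..m} \<Longrightarrow> Y' k a = Y k a"
  shows "agree b f (\<lambda>k. row_comb m nr M (Y' k))"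
  unfolding agree_def
proof (intro ballI)
  fix k i j assume k: "k \<in> {1..nt}" and ij: "i \<in> {1..nr}" "j \<in> {1..b}"
  have "row_comb m nr M (Y' k) i j = row_comb m nr M (Y k) i j"
    by (rule row_comb_cong) (rule assms(2)[OF k])
  then show "f k i j = row_comb m nr M (Y' k) i j" using agreeD[OF assms(1) k ij] by simp
qed

lemma U0_eq: "U0 = fspan {restr Om (mgen (kronI (nb0 nr ns) (nr * ns) (E0 nr ns)) (nr * ns * nt)
    (tp3 Br nr Bs ns Bt) l) | l. 1 \<le> l \<and> l \<le> nt * nb0 nr ns}"
proof -
  let ?m = "nb0 nr ns"
  let ?f = "\<lambda>y k. row_comb ?m nr (E0 nr ns) (\<lambda>a. y (a + (k - 1) * ?m))"
  have comb: "(\<lambda>p. \<Sum>l = 1..nt * ?m. y l *\<^sub>R restr Om (mgen (kronI ?m (nr * ns) (E0 nr ns)) (nr * ns * nt)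
    (tp3 Br nr Bs ns Bt) l) p) = form0 (?f y)" for y
    unfolding restr_sum form0_def unfolding real_scaleR_def sum_mgen_kronI by (rule ext) (rule refl)
  show ?thesis unfolding fspan_family comb U0_def
  proof (intro equalityI subsetI)
    fix u assume "u \<in> form0 ` C0"
    then obtain f where f: "f \<in> C0" "u = form0 f" by auto
    obtain Y where Y: "agree ns f (\<lambda>k. row_comb ?m nr (E0 nr ns) (Y k))" by (rule C0_rows[OF f(1)])
    obtain y where y: "\<And>k a. k \<in> {1..nt} \<Longrightarrow> a \<in> {1..?m} \<Longrightarrow> y (a + (k - 1) * ?m) = Y k a"
      using layer_coeffs[of nt ?m Y] by blast
    have "form0 f = form0 (?f y)" by (rule form0_cong agree_rows[OF Y] y)+
    then show "u \<in> {form0 (?f y) | y. True}" using f(2) by blast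
  next
    fix u assume "u \<in> {form0 (?f y) | y. True}"
    then obtain y where u: "u = form0 (?f y)" by blast
    show "u \<in> form0 ` C0" unfolding u by (intro imageI E0_C0)
  qed
qed

text \<open>All three components share one vector \<open>y\<close>: its upper block determines the
  coupled pair \<open>(g, h)\<close>, its lower block the t-component \<open>f\<close>.\<close>

lemma U1_eq: "U1 = fspan {restr Om (\<lambda>p.
    (mgen (kronI (nb1 nr ns + nb0 nr ns) (nr * ns) (stack (nb1 nr ns) (E10 nr ns) zmat)) (nr * ns * nt) (tp3 Dr nr Bs ns Bt) l p,
     mgen (kronI (nb1 nr ns + nb0 nr ns) (nr * ms) (stack (nb1 nr ns) (E01 nr ns) zmat)) (nr * ms * nt) (tp3 Br nr Ds ms Bt) l p,
     mgen (kronI (nb1 nr ns + nb0 nr ns) (nr * ns) (stack (nb1 nr ns) zmat (E0 nr ns))) (nr * ns * nt) (tp3 Br nr Bs ns Dt) l p))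
    | l. 1 \<le> l \<and> l \<le> nt * (nb1 nr ns + nb0 nr ns)}"
proof -
  let ?m = "nb1 nr ns + nb0 nr ns"
  let ?g = "\<lambda>y k. row_comb (nb1 nr ns) nr (E10 nr ns) (\<lambda>a. y (a + (k - 1) * ?m))"
  let ?h = "\<lambda>y k. row_comb (nb1 nr ns) nr (E01 nr ns) (\<lambda>a. y (a + (k - 1) * ?m))"
  let ?f = "\<lambda>y k. row_comb (nb0 nr ns) nr (E0 nr ns) (\<lambda>a. y (nb1 nr ns + a + (k - 1) * ?m))"
  have comb: "(\<lambda>p. \<Sum>l = 1..nt * ?m. y l *\<^sub>R restr Om (\<lambda>p.
    (mgen (kronI ?m (nr * ns) (stack (nb1 nr ns) (E10 nr ns) zmat)) (nr * ns * nt) (tp3 Dr nr Bs ns Bt) l p,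
     mgen (kronI ?m (nr * ms) (stack (nb1 nr ns) (E01 nr ns) zmat)) (nr * ms * nt) (tp3 Br nr Ds ms Bt) l p,
     mgen (kronI ?m (nr * ns) (stack (nb1 nr ns) zmat (E0 nr ns))) (nr * ns * nt) (tp3 Br nr Bs ns Dt) l p)) p)
    = form1 (?g y) (?h y) (?f y)" for y
    unfolding restr_sum form1_def scaleR_Pair sum_prod real_scaleR_def sum_mgen_kronI
      row_comb_stack_top[abs_def] row_comb_stack_bottom[abs_def] by (rule ext) (rule refl)
  show ?thesis unfolding fspan_family comb U1_def
  proof (intro equalityI subsetI)
    fix u assume "u \<in> {form1 g h f | g h f. (g, h) \<in> C1 \<and> f \<in> C0}"
    then obtain g h f where C: "(g, h) \<in> C1" "f \<in> C0" "u = form1 g h f" by auto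
    obtain P where P: "agree ns g (\<lambda>k. row_comb (nb1 nr ns) nr (E10 nr ns) (P k))"
      "agree ms h (\<lambda>k. row_comb (nb1 nr ns) nr (E01 nr ns) (P k))" by (rule C1_rows[OF C(1)])
    obtain Q where Q: "agree ns f (\<lambda>k. row_comb (nb0 nr ns) nr (E0 nr ns) (Q k))" by (rule C0_rows[OF C(2)])
    obtain y where y: "\<And>k a. k \<in> {1..nt} \<Longrightarrow> a \<in> {1..nb1 nr ns} \<Longrightarrow> y (a + (k - 1) * ?m) = P k a"
      "\<And>k a. k \<in> {1..nt} \<Longrightarrow> a \<in> {1..nb0 nr ns} \<Longrightarrow> y (nb1 nr ns + a + (k - 1) * ?m) = Q k a"
      using stacked_coeffs[of nt "nb1 nr ns" "nb0 nr ns" P Q] by blast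
    have "form1 g h f = form1 (?g y) (?h y) (?f y)"
      by (intro form1_cong agree_rows[OF P(1)] agree_rows[OF P(2)] agree_rows[OF Q] y)
    then show "u \<in> {form1 (?g y) (?h y) (?f y) | y. True}" using C(3) by blast
  next
    fix u assume "u \<in> {form1 (?g y) (?h y) (?f y) | y. True}"
    then obtain y where u: "u = form1 (?g y) (?h y) (?f y)" by blast
    show "u \<in> {form1 g h f | g h f. (g, h) \<in> C1 \<and> f \<in> C0}"
      unfolding u by (intro CollectI exI conjI, rule refl, rule E1_C1, rule E0_C0)
  qed
qed

text \<open>Here the upper block of \<open>y\<close> determines \<open>w\<close> and the lower one
  the pair; the negated matrix turns into the minus sign of \<open>form2\<close>.\<close>

lemma U2_eq: "U2 = fspan {restr Om (\<lambda>p.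
    (mgen (kronI (nb2 nr ns + nb1 nr ns) (nr * ms) (stack (nb2 nr ns) zmat (E01 nr ns))) (nr * ms * nt) (tp3 Br nr Ds ms Dt) l p,
     mgen (kronI (nb2 nr ns + nb1 nr ns) (nr * ns) (stack (nb2 nr ns) zmat (\<lambda>a b. - E10 nr ns a b))) (nr * ns * nt) (tp3 Dr nr Bs ns Dt) l p,
     mgen (kronI (nb2 nr ns + nb1 nr ns) (nr * ms) (stack (nb2 nr ns) (E2 nr ns) zmat)) (nr * ms * nt) (tp3 Dr nr Ds ms Bt) l p))
    | l. 1 \<le> l \<and> l \<le> nt * (nb2 nr ns + nb1 nr ns)}"
proof -
  let ?m = "nb2 nr ns + nb1 nr ns"
  let ?w = "\<lambda>y k. row_comb (nb2 nr ns) nr (E2 nr ns) (\<lambda>a. y (a + (k - 1) * ?m))"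
  let ?h = "\<lambda>y k. row_comb (nb1 nr ns) nr (E01 nr ns) (\<lambda>a. y (nb2 nr ns + a + (k - 1) * ?m))"
  let ?g = "\<lambda>y k. row_comb (nb1 nr ns) nr (E10 nr ns) (\<lambda>a. y (nb2 nr ns + a + (k - 1) * ?m))"
  have comb: "(\<lambda>p. \<Sum>l = 1..nt * ?m. y l *\<^sub>R restr Om (\<lambda>p.
    (mgen (kronI ?m (nr * ms) (stack (nb2 nr ns) zmat (E01 nr ns))) (nr * ms * nt) (tp3 Br nr Ds ms Dt) l p,
     mgen (kronI ?m (nr * ns) (stack (nb2 nr ns) zmat (\<lambda>a b. - E10 nr ns a b))) (nr * ns * nt) (tp3 Dr nr Bs ns Dt) l p,
     mgen (kronI ?m (nr * ms) (stack (nb2 nr ns) (E2 nr ns) zmat)) (nr * ms * nt) (tp3 Dr nr Ds ms Bt) l p)) p)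
    = form2 (?h y) (?g y) (?w y)" for y
    unfolding restr_sum form2_def scaleR_Pair sum_prod real_scaleR_def sum_mgen_kronI
      row_comb_stack_top[abs_def] row_comb_stack_bottom[abs_def] row_comb_uminus[abs_def] tsum_uminus
    by (rule ext) (rule refl)
  show ?thesis unfolding fspan_family comb U2_def
  proof (intro equalityI subsetI)
    fix u assume "u \<in> {form2 h g w | h g w. (g, h) \<in> C1 \<and> w \<in> C2}"
    then obtain g h w where C: "(g, h) \<in> C1" "w \<in> C2" "u = form2 h g w" by auto
    obtain Q where Q: "agree ns g (\<lambda>k. row_comb (nb1 nr ns) nr (E10 nr ns) (Q k))"
      "agree ms h (\<lambda>k. row_comb (nb1 nr ns) nr (E01 nr ns) (Q k))" by (rule C1_rows[OF C(1)])
    obtain P where P: "agree ms w (\<lambda>k. row_comb (nb2 nr ns) nr (E2 nr ns) (P k))" by (rule C2_rows[OF C(2)])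
    obtain y where y: "\<And>k a. k \<in> {1..nt} \<Longrightarrow> a \<in> {1..nb2 nr ns} \<Longrightarrow> y (a + (k - 1) * ?m) = P k a"
      "\<And>k a. k \<in> {1..nt} \<Longrightarrow> a \<in> {1..nb1 nr ns} \<Longrightarrow> y (nb2 nr ns + a + (k - 1) * ?m) = Q k a"
      using stacked_coeffs[of nt "nb2 nr ns" "nb1 nr ns" P Q] by blast
    have "form2 h g w = form2 (?h y) (?g y) (?w y)"
      by (intro form2_cong agree_rows[OF P] agree_rows[OF Q(1)] agree_rows[OF Q(2)] y)
    then show "u \<in> {form2 (?h y) (?g y) (?w y) | y. True}" using C(3) by blast
  next
    fix u assume "u \<in> {form2 (?h y) (?g y) (?w y) | y. True}"
    then obtain y where u: "u = form2 (?h y) (?g y) (?w y)" by blast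
    show "u \<in> {form2 h g w | h g w. (g, h) \<in> C1 \<and> w \<in> C2}"
      unfolding u by (intro CollectI exI conjI, rule refl, rule E1_C1, rule E2_C2)
  qed
qed

lemma U3_eq: "U3 = fspan {restr Om (mgen (kronI (nb2 nr ns) (nr * ms) (E2 nr ns)) (nr * ms * nt)
    (tp3 Dr nr Ds ms Dt) l) | l. 1 \<le> l \<and> l \<le> nt * nb2 nr ns}"
proof -
  let ?m = "nb2 nr ns"
  let ?w = "\<lambda>y k. row_comb ?m nr (E2 nr ns) (\<lambda>a. y (a + (k - 1) * ?m))"
  have comb: "(\<lambda>p. \<Sum>l = 1..nt * ?m. y l *\<^sub>R restr Om (mgen (kronI ?m (nr * ms) (E2 nr ns)) (nr * ms * nt)
    (tp3 Dr nr Ds ms Dt) l) p) = form3 (?w y)" for y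
    unfolding restr_sum form3_def unfolding real_scaleR_def sum_mgen_kronI by (rule ext) (rule refl)
  show ?thesis unfolding fspan_family comb U3_def
  proof (intro equalityI subsetI)
    fix u assume "u \<in> form3 ` C2"
    then obtain w where w: "w \<in> C2" "u = form3 w" by auto
    obtain Y where Y: "agree ms w (\<lambda>k. row_comb ?m nr (E2 nr ns) (Y k))" by (rule C2_rows[OF w(1)])
    obtain y where y: "\<And>k a. k \<in> {1..nt} \<Longrightarrow> a \<in> {1..?m} \<Longrightarrow> y (a + (k - 1) * ?m) = Y k a"
      using layer_coeffs[of nt ?m Y] by blast
    have "form3 w = form3 (?w y)" by (rule form3_cong agree_rows[OF Y] y)+
    then show "u \<in> {form3 (?w y) | y. True}" using w(2) by blast
  next
    fix u assume "u \<in> {form3 (?w y) | y. True}"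
    then obtain y where u: "u = form3 (?w y)" by blast
    show "u \<in> form3 ` C2" unfolding u by (intro imageI E2_C2)
  qed
qed

end

theorem theorem4p1:
  fixes tr ts tt :: "int \<Rightarrow> real" and nr ns nt pr ps pt :: nat and R S T :: real
  assumes "periodic_C1_knots tr nr R pr"
    and "open_C1_knots ts ns S ps"
    and "periodic_C1_knots tt nt T pt"
  shows "cohom_dim {0} (V0 tr nr R pr ts ns S ps tt nt T pt) (grad3 R S T) = 1
       \<and> cohom_dim (grad3 R S T ` V0 tr nr R pr ts ns S ps tt nt T pt)
                   (V1 tr nr R pr ts ns S ps tt nt T pt) (curl3 R S T) = 1
       \<and> cohom_dim (curl3 R S T ` V1 tr nr R pr ts ns S ps tt nt T pt)
                   (V2 tr nr R pr ts ns S ps tt nt T pt) (div3 R S T) = 0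
       \<and> cohom_dim (div3 R S T ` V2 tr nr R pr ts ns S ps tt nt T pt)
                   (V3 tr nr R pr ts ns S ps tt nt T pt) (\<lambda>_. (0 :: pt3 \<Rightarrow> real)) = 0"
proof -
  let ?Br = "\<lambda>i. pbspl tr R pr (int i)" and ?Dr = "\<lambda>i. pD tr R pr (int i)"
    and ?Bs = "\<lambda>j. bspl ts ps (int j)" and ?Ds = "\<lambda>j. oD ts ps (int j)"
    and ?Bt = "\<lambda>k. pbspl tt T pt (int k)" and ?Dt = "\<lambda>k. pD tt T pt (int k)"
  interpret r: spline_pair nr nr R ?Br ?Dr "\<lambda>i. i mod nr + 1" by (rule periodic_spline_pair) fact
  interpret s: spline_pair ns "ns - 1" S ?Bs ?Ds Suc by (rule open_spline_pair) fact
  interpret t: spline_pair nt nt T ?Bt ?Dt "\<lambda>k. k mod nt + 1" by (rule periodic_spline_pair) fact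
  have ns: "2 \<le> ns" using assms(2) by (rule open_spline_pair)
  have z: "(\<lambda>i. 0) \<in> polar_waves nr" using polar_wavesI[of 0 nr 0] by simp
  interpret polar_torus_complex nr R ?Br ?Dr ns "ns - 1" S ?Bs ?Ds nt T ?Bt ?Dt
    by unfold_locales (use ns r.n_pos z in \<open>auto intro: polar_waves_lin\<close>)
  have B: "Bfr tr R pr = ?Br" "Dfr tr R pr = ?Dr" "Bfs ts ps = ?Bs" "Dfs ts ps = ?Ds"
    "Bft tt T pt = ?Bt" "Dft tt T pt = ?Dt"
    by (simp_all add: fun_eq_iff Bfr_def Dfr_def Bfs_def Dfs_def Bft_def Dft_def)
  have V0: "V0 tr nr R pr ts ns S ps tt nt T pt = U0"
    unfolding V0_def B by (rule U0_eq[symmetric])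
  have V1: "V1 tr nr R pr ts ns S ps tt nt T pt = U1"
    unfolding V1_def N100_def N010_def N001_def B add.commute[of "nb0 nr ns" "nb1 nr ns"] by (rule U1_eq[symmetric])
  have V2: "V2 tr nr R pr ts ns S ps tt nt T pt = U2"
    unfolding V2_def N011_def N101_def N110_def B add.commute[of "nb1 nr ns" "nb2 nr ns"] by (rule U2_eq[symmetric])
  have V3: "V3 tr nr R pr ts ns S ps tt nt T pt = U3"
    unfolding V3_def B by (rule U3_eq[symmetric])
  have fin: "finite {g l | l. 1 \<le> l \<and> l \<le> (N :: nat)}" for g :: "nat \<Rightarrow> pt3 \<Rightarrow> pt3" and N
  proof -
    have "{g l | l. 1 \<le> l \<and> l \<le> N} = g ` {1..N}" by auto
    then show ?thesis by simp
  qed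
  \<comment> \<open>The finite spanning set is the generating family of \<open>V1\<close>
    itself.\<close>
  have "cohom_dim (grad3 R S T ` U0) U1 (curl3 R S T) = 1"
    by (rule cohom_dim_1[OF equalityD1[OF U1_eq] fin])
  then show ?thesis unfolding V0 V1 V2 V3 using cohom_dim_0 cohom_dim_2 cohom_dim_3 by blast
qed

end
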